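(* Let $u$ be the solution of $u''+\beta Au'+\alpha u'+Au=0$ in $\Omega\times(0,\infty)$, $u=0$ on $\partial\Omega\times[0,\infty)$, $u(0)=u_0$, $u'(0)=u_1$. The following decay estimates hold for the energy $E(u)(t)=\frac12\left(\|u'(t)\|^2+|u(t)|_1^2\right)$: (i) if $0<\delta<\min\left(\frac{\alpha+\beta\lambda_1}{2},\frac{\lambda_1}{\alpha+\beta\lambda_1}\right)$ or $0<\delta=\frac{\alpha+\beta\lambda_1}{2}$, then $$E(u)(t)\le C(\alpha,\beta,\lambda_1)\,e^{-2\delta t}E(u)(0);$$ (ii) if $\delta=\frac{\lambda_1}{\alpha+\beta\lambda_1}$, then $$\|u'(t)\|^2\le C\,e^{-2\delta t}E(u)(0).$$
   Context: $\Omega\subset\mathbb{R}^d$ is a bounded domain, $\|\cdot\|$ and $(\cdot,\cdot)$ are the norm and inner product of $L^2(\Omega)$, and $A=-\Delta$ with domain $D(A)=H^2(\Omega)\cap H_0^1(\Omega)$ is self-adjoint and positive definite on $L^2(\Omega)$; $\lambda_1>0$ is its smallest eigenvalue, so $\|v\|^2\le\lambda_1^{-1}\|A^{1/2}v\|^2$ for $v\in H_0^1(\Omega)$. $|v|_1=\|A^{1/2}v\|$ and $a(w,v)=(A^{1/2}w,A^{1/2}v)$. Primes denote time derivatives. The damping parameters are constants with ($\alpha>0$, $\beta\ge0$) or ($\alpha\ge0$, $\beta>0$). The solution is understood in the variational sense: $u(t)\in H_0^1(\Omega)$ with $(u'',v)+\beta a(u',v)+\alpha(u',v)+a(u,v)=0$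 for all $v\in H_0^1(\Omega)$, $t>0$, and $u(0)=u_0$, $u'(0)=u_1$. $C$ and $C(\alpha,\beta,\lambda_1)$ denote positive constants independent of $t$ and of the initial data; the estimates are for $t\ge0$.
   Formalization: For δ=(α+βλ₁)/2 in (i) the theorem also requires δ²<λ₁ and βδ≤1, and in (ii) it also requires δ≤(α+βλ₁)/2; without these the stated estimates fail (first or high eigenmodes). *)

theory Defs
  imports "HOL-Analysis.Analysis"
begin

section \<open>The space $L^2(\Omega)$\<close>

text \<open>
  Elements of \<open>L\<^sup>2(\<Omega>)\<close> are represented by functions on the whole ambient space, of which only
  the values on \<open>\<Omega>\<close> matter; equality in \<open>L\<^sup>2(\<Omega>)\<close> is equality almost everywhere in \<open>\<Omega>\<close>.
\<close>

definition L2 :: "'a::euclidean_space set \<Rightarrow> ('a \<Rightarrow> real) set" where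
  "L2 \<Omega> = {f. f \<in> borel_measurable (lebesgue_on \<Omega>) \<and> integrable (lebesgue_on \<Omega>) (\<lambda>x. (f x)\<^sup>2)}"

definition L2_inner :: "'a::euclidean_space set \<Rightarrow> ('a \<Rightarrow> real) \<Rightarrow> ('a \<Rightarrow> real) \<Rightarrow> real" where
  "L2_inner \<Omega> f g = (LINT x|lebesgue_on \<Omega>. f x * g x)"

definition L2_norm :: "'a::euclidean_space set \<Rightarrow> ('a \<Rightarrow> real) \<Rightarrow> real" where
  "L2_norm \<Omega> f = sqrt (L2_inner \<Omega> f f)"

definition L2_eq :: "'a::euclidean_space set \<Rightarrow> ('a \<Rightarrow> real) \<Rightarrow> ('a \<Rightarrow> real) \<Rightarrow> bool" where
  "L2_eq \<Omega> f g \<longleftrightarrow> (AE x in lebesgue_on \<Omega>. f x = g x)"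

section \<open>Sobolev spaces\<close>

definition partial_deriv :: "'a::euclidean_space \<Rightarrow> ('a \<Rightarrow> real) \<Rightarrow> 'a \<Rightarrow> real" where
  "partial_deriv i f = (\<lambda>x. frechet_derivative f (at x) i)"

text \<open>A list of basis vectors plays the role of a multi-index.\<close>

definition iterated_partial :: "'a::euclidean_space list \<Rightarrow> ('a \<Rightarrow> real) \<Rightarrow> 'a \<Rightarrow> real" where
  "iterated_partial is f = foldr partial_deriv is f"

text \<open>
  If all iterated partial derivatives are (Frechet) differentiable, they are in particular
  continuous, so this is \<open>C\<^sup>\<infinity>\<close>.
\<close>

definition smooth :: "('a::euclidean_space \<Rightarrow> real) \<Rightarrow> bool" where
  "smooth f \<longleftrightarrow> (\<forall>is. set is \<subseteq> Basis \<longrightarrow> (\<forall>x. iterated_partial is f differentiable (at x)))"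

definition test_function :: "'a::euclidean_space set \<Rightarrow> ('a \<Rightarrow> real) \<Rightarrow> bool" where
  "test_function \<Omega> \<phi> \<longleftrightarrow>
     smooth \<phi> \<and> compact (closure {x. \<phi> x \<noteq> 0}) \<and> closure {x. \<phi> x \<noteq> 0} \<subseteq> \<Omega>"

definition weak_deriv ::
  "'a::euclidean_space set \<Rightarrow> 'a list \<Rightarrow> ('a \<Rightarrow> real) \<Rightarrow> ('a \<Rightarrow> real) \<Rightarrow> bool" where
  "weak_deriv \<Omega> is f g \<longleftrightarrow>
     (\<forall>\<phi>. test_function \<Omega> \<phi> \<longrightarrow>
        L2_inner \<Omega> f (iterated_partial is \<phi>) = (- 1) ^ length is * L2_inner \<Omega> g \<phi>)"

definition sobolev :: "nat \<Rightarrow> 'a::euclidean_space set \<Rightarrow> ('a \<Rightarrow> real) set" where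
  "sobolev k \<Omega> =
     {f \<in> L2 \<Omega>. \<forall>is. set is \<subseteq> Basis \<and> length is \<le> k \<longrightarrow> (\<exists>g \<in> L2 \<Omega>. weak_deriv \<Omega> is f g)}"

text \<open>\<open>H\<^sub>0\<^sup>1(\<Omega>)\<close>: the closure of the test functions in the norm of \<open>H\<^sup>1(\<Omega>)\<close>.\<close>

definition H01 :: "'a::euclidean_space set \<Rightarrow> ('a \<Rightarrow> real) set" where
  "H01 \<Omega> =
     {f \<in> L2 \<Omega>. \<exists>\<phi> :: nat \<Rightarrow> 'a \<Rightarrow> real.
        (\<forall>n. test_function \<Omega> (\<phi> n)) \<and>
        (\<lambda>n. L2_norm \<Omega> (\<lambda>x. \<phi> n x - f x)) \<longlonglongrightarrow> 0 \<and>
        (\<forall>i\<in>Basis. \<exists>g \<in> L2 \<Omega>. weak_deriv \<Omega> [i] f g \<and>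
           (\<lambda>n. L2_norm \<Omega> (\<lambda>x. partial_deriv i (\<phi> n) x - g x)) \<longlonglongrightarrow> 0)}"

section \<open>Unbounded operators on $L^2(\Omega)$\<close>

text \<open>
  An unbounded operator is represented by its graph, a set of pairs \<open>(v, T v)\<close> of square integrable
  functions; a graph is closed under changing either component on a null set.
\<close>

type_synonym 'a L2_op = "(('a \<Rightarrow> real) \<times> ('a \<Rightarrow> real)) set"

definition densely_defined :: "'a::euclidean_space set \<Rightarrow> 'a L2_op \<Rightarrow> bool" where
  "densely_defined \<Omega> T \<longleftrightarrow>
     (\<forall>f \<in> L2 \<Omega>. \<forall>\<epsilon>>0. \<exists>v \<in> Domain T. L2_norm \<Omega> (\<lambda>x. f x - v x) < \<epsilon>)"

definition adjoint_op :: "'a::euclidean_space set \<Rightarrow> 'a L2_op \<Rightarrow> 'a L2_op" where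
  "adjoint_op \<Omega> T =
     {(w, z). w \<in> L2 \<Omega> \<and> z \<in> L2 \<Omega> \<and> (\<forall>(v, g) \<in> T. L2_inner \<Omega> g w = L2_inner \<Omega> v z)}"

definition self_adjoint :: "'a::euclidean_space set \<Rightarrow> 'a L2_op \<Rightarrow> bool" where
  "self_adjoint \<Omega> T \<longleftrightarrow> densely_defined \<Omega> T \<and> adjoint_op \<Omega> T = T"

definition positive_definite :: "'a::euclidean_space set \<Rightarrow> 'a L2_op \<Rightarrow> bool" where
  "positive_definite \<Omega> T \<longleftrightarrow> (\<forall>(v, g) \<in> T. \<not> L2_eq \<Omega> v (\<lambda>x. 0) \<longrightarrow> L2_inner \<Omega> g v > 0)"

definition eigenvalue :: "'a::euclidean_space set \<Rightarrow> 'a L2_op \<Rightarrow> real \<Rightarrow> bool" where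
  "eigenvalue \<Omega> T \<mu> \<longleftrightarrow> (\<exists>v. (v, \<lambda>x. \<mu> * v x) \<in> T \<and> \<not> L2_eq \<Omega> v (\<lambda>x. 0))"

definition smallest_eigenvalue :: "'a::euclidean_space set \<Rightarrow> 'a L2_op \<Rightarrow> real \<Rightarrow> bool" where
  "smallest_eigenvalue \<Omega> T \<mu> \<longleftrightarrow> eigenvalue \<Omega> T \<mu> \<and> (\<forall>\<nu>. eigenvalue \<Omega> T \<nu> \<longrightarrow> \<mu> \<le> \<nu>)"

text \<open>
  \<open>T\<^bsup>1/2\<^esup>\<close> is the unique nonnegative self-adjoint operator whose square is \<open>T\<close>; the square,
  including its domain, is the composition of the graph with itself.
\<close>

definition is_sqrt_op :: "'a::euclidean_space set \<Rightarrow> 'a L2_op \<Rightarrow> 'a L2_op \<Rightarrow> bool" where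
  "is_sqrt_op \<Omega> T B \<longleftrightarrow>
     self_adjoint \<Omega> B \<and> (\<forall>(v, g) \<in> B. L2_inner \<Omega> g v \<ge> 0) \<and> B O B = T"

text \<open>The value of an operator at a point of its domain (determined almost everywhere).\<close>

definition op_app :: "'a L2_op \<Rightarrow> ('a \<Rightarrow> real) \<Rightarrow> 'a \<Rightarrow> real" where
  "op_app T v = (SOME g. (v, g) \<in> T)"

section \<open>The operator $A = -\Delta$ and the energy\<close>

definition neg_laplacian :: "'a::euclidean_space set \<Rightarrow> 'a L2_op" where
  "neg_laplacian \<Omega> =
     {(v, g). v \<in> sobolev 2 \<Omega> \<inter> H01 \<Omega> \<and> g \<in> L2 \<Omega> \<and>
        (\<exists>w. (\<forall>i\<in>Basis. w i \<in> L2 \<Omega> \<and> weak_deriv \<Omega> [i, i] v (w i)) \<and>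
             L2_eq \<Omega> g (\<lambda>x. - (\<Sum>i\<in>Basis. w i x)))}"

text \<open>
  The standing assumptions on the domain. \<open>B\<close> is \<open>A\<^bsup>1/2\<^esup>\<close>. That \<open>A\<close> with this domain is self-adjoint is
  an assumption on \<open>\<Omega>\<close>: it can fail, for instance for a polygon with a reentrant corner.
\<close>

definition dirichlet_setting :: "'a::euclidean_space set \<Rightarrow> 'a L2_op \<Rightarrow> real \<Rightarrow> bool" where
  "dirichlet_setting \<Omega> B lam\<^sub>1 \<longleftrightarrow>
     open \<Omega> \<and> connected \<Omega> \<and> \<Omega> \<noteq> {} \<and> bounded \<Omega> \<and>
     self_adjoint \<Omega> (neg_laplacian \<Omega>) \<and> positive_definite \<Omega> (neg_laplacian \<Omega>) \<and>
     is_sqrt_op \<Omega> (neg_laplacian \<Omega>) B \<and>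
     smallest_eigenvalue \<Omega> (neg_laplacian \<Omega>) lam\<^sub>1"

text \<open>\<open>a(w, v) = (A\<^bsup>1/2\<^esup> w, A\<^bsup>1/2\<^esup> v)\<close> and \<open>|v|\<^sub>1 = \<parallel>A\<^bsup>1/2\<^esup> v\<parallel>\<close>, with \<open>B = A\<^bsup>1/2\<^esup>\<close>.\<close>

definition a_form ::
  "'a::euclidean_space set \<Rightarrow> 'a L2_op \<Rightarrow> ('a \<Rightarrow> real) \<Rightarrow> ('a \<Rightarrow> real) \<Rightarrow> real" where
  "a_form \<Omega> B w v = L2_inner \<Omega> (op_app B w) (op_app B v)"

definition norm1 :: "'a::euclidean_space set \<Rightarrow> 'a L2_op \<Rightarrow> ('a \<Rightarrow> real) \<Rightarrow> real" where
  "norm1 \<Omega> B v = L2_norm \<Omega> (op_app B v)"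

definition energy ::
  "'a::euclidean_space set \<Rightarrow> 'a L2_op \<Rightarrow> (real \<Rightarrow> 'a \<Rightarrow> real) \<Rightarrow> (real \<Rightarrow> 'a \<Rightarrow> real) \<Rightarrow> real \<Rightarrow> real"
  where
  "energy \<Omega> B u u' t = 1/2 * ((L2_norm \<Omega> (u' t))\<^sup>2 + (norm1 \<Omega> B (u t))\<^sup>2)"

section \<open>Solutions of the damped wave equation\<close>

text \<open>
  \<open>u\<close> is continuous on \<open>[0,\<infinity>)\<close> with values in \<open>H\<^sub>0\<^sup>1(\<Omega>)\<close> and continuously differentiable with values in
  \<open>L\<^sup>2(\<Omega>)\<close>, with derivative \<open>u'\<close>. In the variational equation \<open>(u''(t), v)\<close> is the number \<open>r\<close>, the time
  derivative of \<open>(u', v)\<close>; if \<open>u'\<close> is differentiable in \<open>L\<^sup>2(\<Omega>)\<close>, this is the inner product of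
  its derivative with \<open>v\<close>, but for \<open>\<beta> = 0\<close> and general data of finite energy \<open>u''(t)\<close> need not be square
  integrable. The term \<open>a(u'(t), v)\<close> requires \<open>u'(t) \<in> H\<^sub>0\<^sup>1(\<Omega>)\<close> and is absent if \<open>\<beta> = 0\<close>.
\<close>

definition damped_wave_solution ::
  "'a::euclidean_space set \<Rightarrow> 'a L2_op \<Rightarrow> real \<Rightarrow> real \<Rightarrow> ('a \<Rightarrow> real) \<Rightarrow> ('a \<Rightarrow> real) \<Rightarrow>
    (real \<Rightarrow> 'a \<Rightarrow> real) \<Rightarrow> (real \<Rightarrow> 'a \<Rightarrow> real) \<Rightarrow> bool"
  where
  "damped_wave_solution \<Omega> B \<alpha> \<beta> u\<^sub>0 u\<^sub>1 u u' \<longleftrightarrow>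
     u\<^sub>0 \<in> H01 \<Omega> \<and> u\<^sub>1 \<in> L2 \<Omega> \<and>
     (\<forall>t\<ge>0. u t \<in> H01 \<Omega> \<and> u' t \<in> L2 \<Omega>) \<and>
     (\<forall>t\<ge>0. ((\<lambda>s. norm1 \<Omega> B (\<lambda>x. u s x - u t x)) \<longlongrightarrow> 0) (at t within {0..})) \<and>
     (\<forall>t\<ge>0. ((\<lambda>s. L2_norm \<Omega> (\<lambda>x. (u s x - u t x) / (s - t) - u' t x)) \<longlongrightarrow> 0)
               (at t within {0..})) \<and>
     (\<forall>t\<ge>0. ((\<lambda>s. L2_norm \<Omega> (\<lambda>x. u' s x - u' t x)) \<longlongrightarrow> 0) (at t within {0..})) \<and>
     (\<beta> > 0 \<longrightarrow> (\<forall>t>0. u' t \<in> H01 \<Omega>)) \<and>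
     (\<forall>v \<in> H01 \<Omega>. \<forall>t>0. \<exists>r.
        ((\<lambda>s. L2_inner \<Omega> (u' s) v) has_real_derivative r) (at t) \<and>
        r + \<beta> * a_form \<Omega> B (u' t) v + \<alpha> * L2_inner \<Omega> (u' t) v + a_form \<Omega> B (u t) v = 0) \<and>
     L2_eq \<Omega> (u 0) u\<^sub>0 \<and> L2_eq \<Omega> (u' 0) u\<^sub>1"

end

theory Submission
  imports Defs
begin

text \<open>
  The scaled solution \<open>U(t) = e\<^bsup>\<delta>t\<^esup> u(t)\<close> solves
  \<open>U'' + (\<beta> A + \<alpha> - 2 \<delta>) U' + (1 - \<beta> \<delta>) A U + \<delta> (\<delta> - \<alpha>) U = 0\<close>, whose energy
  \<open>F = 1/2 (\<parallel>U'\<parallel>\<^sup>2 + (1 - \<beta> \<delta>) |U|\<^sub>1\<^sup>2 + \<delta> (\<delta> - \<alpha>) \<parallel>U\<parallel>\<^sup>2)\<close> decreases as soon as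
  \<open>\<alpha> + \<beta> \<lambda>\<^sub>1 \<ge> 2 \<delta>\<close>. Unless \<open>\<beta> \<delta> = 1\<close>, it is equivalent to the energy of \<open>U\<close>.

  A variational solution is too irregular to be used as a test function in its own equation, so
  \<open>F' \<le> 0\<close> is derived from two-time kernels: with \<open>P(t, s) = (U(t), U(s))\<close> and
  \<open>a(t, s) = a(U(t), U(s))\<close>, the sum \<open>P\<^sub>t + P\<^sub>s + \<beta> a + (\<alpha> - 2 \<delta>) P\<close> depends on \<open>t + s\<close> only, say it
  is \<open>h(t + s)\<close>, and the second difference of this identity along \<open>t \<mapsto> U(t + \<eta>) - U(t)\<close> gives the
  monotonicity of \<open>F\<close> in the limit \<open>\<eta> \<rightarrow> 0\<close>.
  In the degenerate case \<open>\<beta> \<delta> = 1\<close> the same identity at \<open>(t, t)\<close> and \<open>(2 t, 0)\<close> gives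
  \<open>|U(t)|\<^sub>1\<^sup>2 \<le> K + |U(0)|\<^sub>1 |U(2 t)|\<^sub>1\<close>, which excludes everything between boundedness and exponential
  growth; the latter is impossible because smaller values of \<open>\<delta>\<close> are not degenerate.

  Test functions belong to the domain of \<open>A\<close>, which identifies \<open>\<parallel>A\<^bsup>1/2\<^esup> \<phi>\<parallel>\<close> with the norm of the
  gradient of \<open>\<phi>\<close> and makes them dense in \<open>H\<^sub>0\<^sup>1(\<Omega>)\<close> for the graph norm of \<open>A\<^bsup>1/2\<^esup>\<close>. Poincare's
  inequality with the constant \<open>\<lambda>\<^sub>1\<close> holds because, by Rellich's theorem, the minimum of the Rayleigh
  quotient is attained and is therefore an eigenvalue of \<open>A\<close>.
\<close>

section \<open>The space $L^2(\Omega)$\<close>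

text \<open>On an eigenfunction of A with eigenvalue \<lambda> the exponents of the equation solve
  r^2 + (\<alpha> + \<beta> \<lambda>) r + \<lambda> = 0, and the potential part of F is this
  polynomial at r = - \<delta>, namely \<lambda> - \<delta> (\<alpha> + \<beta> \<lambda>) +
  \<delta>^2. It is affine in \<lambda> with slope 1 - \<beta> \<delta>. So F controls the full
  energy as soon as the slope and the value at the smallest eigenvalue are positive, and these two
  conditions lie behind the restrictions on \<delta>. The remaining one, \<delta> \<le> (\<alpha> +
  \<beta> \<open>lam\<close>) / 2, makes the damping nonnegative. At slope zero F sees L^2 norms
  only, and |U|_1 has to be recovered by other means.

  The estimates are made for real kernels instead of functions: the constants then visibly depend on
  \<alpha>, \<beta> and \<open>lam\<close> alone, and the exponential weight becomes an operation on
  kernels. The equation enters through one fact: for fixed v the sum (u', v) + \<beta> a(u, v) is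
  differentiable in time, even where its second summand is not known to be.\<close>

lemma cauchy_schwarz_of_quadratic:
  fixes A B C :: real
  assumes quad: "\<And>x y. 0 \<le> x\<^sup>2 * A + y\<^sup>2 * B + 2 * x * y * C"
  shows "\<bar>C\<bar> \<le> sqrt A * sqrt B"
proof -
  have pos: "0 \<le> A" "0 \<le> B"
    using quad[of 1 0] quad[of 0 1] by auto
  have "C\<^sup>2 \<le> A * B"
  proof (cases "B = 0")
    case True
    \<comment> \<open>For B = 0 the form is affine in y at x = 1; the y chosen below makes its value
      -1.\<close>
    have "C = 0"
    proof (rule ccontr)
      assume "C \<noteq> 0"
      then show False
        using quad[of 1 "- (A + 1) / (2 * C)"] True pos by (simp add: field_simps)
    qed
    with True show ?thesis by simp
  next
    case False
    then have "B > 0" using pos by simp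
    have "0 \<le> B * (A * B - C\<^sup>2)"
      using quad[of B "- C"] by (simp add: power2_eq_square algebra_simps)
    then show ?thesis
      using \<open>B > 0\<close> by (simp add: zero_le_mult_iff)
  qed
  then have "\<bar>C\<bar> \<le> sqrt (A * B)"
    by (metis real_sqrt_abs real_sqrt_le_iff)
  then show ?thesis
    by (simp add: real_sqrt_mult)
qed

lemma L2_measurable: "f \<in> L2 \<Omega> \<Longrightarrow> f \<in> borel_measurable (lebesgue_on \<Omega>)"
  by (simp add: L2_def)

lemma L2_square_integrable: "f \<in> L2 \<Omega> \<Longrightarrow> integrable (lebesgue_on \<Omega>) (\<lambda>x. (f x)\<^sup>2)"
  by (simp add: L2_def)

lemma L2_mult_integrable:
  assumes "f \<in> L2 \<Omega>" "g \<in> L2 \<Omega>"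
  shows "integrable (lebesgue_on \<Omega>) (\<lambda>x. f x * g x)"
proof (rule Bochner_Integration.integrable_bound)
  show "integrable (lebesgue_on \<Omega>) (\<lambda>x. (f x)\<^sup>2 + (g x)\<^sup>2)"
    using assms by (simp add: L2_square_integrable)
  show "(\<lambda>x. f x * g x) \<in> borel_measurable (lebesgue_on \<Omega>)"
    using assms by (intro borel_measurable_times L2_measurable)
  show "AE x in lebesgue_on \<Omega>. norm (f x * g x) \<le> norm ((f x)\<^sup>2 + (g x)\<^sup>2)"
  proof (intro AE_I2)
    fix x
    have "0 \<le> \<bar>f x\<bar> * \<bar>g x\<bar>" by (rule mult_nonneg_nonneg) simp_all
    moreover have "2 * \<bar>f x\<bar> * \<bar>g x\<bar> \<le> (f x)\<^sup>2 + (g x)\<^sup>2"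
      using sum_squares_bound[of "\<bar>f x\<bar>" "\<bar>g x\<bar>"] by simp
    ultimately have "\<bar>f x\<bar> * \<bar>g x\<bar> \<le> (f x)\<^sup>2 + (g x)\<^sup>2" by linarith
    then show "norm (f x * g x) \<le> norm ((f x)\<^sup>2 + (g x)\<^sup>2)"
      by (simp add: abs_mult)
  qed
qed

lemma L2_add: "f \<in> L2 \<Omega> \<Longrightarrow> g \<in> L2 \<Omega> \<Longrightarrow> (\<lambda>x. f x + g x) \<in> L2 \<Omega>"
proof -
  assume *: "f \<in> L2 \<Omega>" "g \<in> L2 \<Omega>"
  have "integrable (lebesgue_on \<Omega>) (\<lambda>x. (f x)\<^sup>2 + (g x)\<^sup>2 + 2 * (f x * g x))"
    using * by (intro Bochner_Integration.integrable_add integrable_mult_right L2_mult_integrable L2_square_integrable)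
  then show ?thesis
    using * by (simp add: L2_def power2_sum mult.assoc borel_measurable_add)
qed

lemma L2_scale: "f \<in> L2 \<Omega> \<Longrightarrow> (\<lambda>x. c * f x) \<in> L2 \<Omega>"
  by (simp add: L2_def power_mult_distrib borel_measurable_times)

lemma L2_diff: "f \<in> L2 \<Omega> \<Longrightarrow> g \<in> L2 \<Omega> \<Longrightarrow> (\<lambda>x. f x - g x) \<in> L2 \<Omega>"
  using L2_add[OF _ L2_scale, of f \<Omega> g "- 1"] by simp

lemma L2_zero: "(\<lambda>x. 0) \<in> L2 \<Omega>"
  by (simp add: L2_def)

lemma L2_sum: "(\<And>i. i \<in> I \<Longrightarrow> f i \<in> L2 \<Omega>) \<Longrightarrow> (\<lambda>x. \<Sum>i\<in>I. f i x) \<in> L2 \<Omega>"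
  by (induction I rule: infinite_finite_induct) (auto simp: L2_zero L2_add)

lemma L2_inner_commute: "L2_inner \<Omega> f g = L2_inner \<Omega> g f"
  by (simp add: L2_inner_def mult.commute)

lemma L2_inner_add_left:
  "f \<in> L2 \<Omega> \<Longrightarrow> g \<in> L2 \<Omega> \<Longrightarrow> h \<in> L2 \<Omega> \<Longrightarrow> L2_inner \<Omega> (\<lambda>x. f x + g x) h = L2_inner \<Omega> f h + L2_inner \<Omega> g h"
  by (simp add: L2_inner_def distrib_right L2_mult_integrable)

lemma L2_inner_diff_left:
  "f \<in> L2 \<Omega> \<Longrightarrow> g \<in> L2 \<Omega> \<Longrightarrow> h \<in> L2 \<Omega> \<Longrightarrow> L2_inner \<Omega> (\<lambda>x. f x - g x) h = L2_inner \<Omega> f h - L2_inner \<Omega> g h"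
  by (simp add: L2_inner_def left_diff_distrib L2_mult_integrable)

lemma L2_inner_scale_left: "L2_inner \<Omega> (\<lambda>x. c * f x) h = c * L2_inner \<Omega> f h"
  by (simp add: L2_inner_def mult.assoc)

lemma L2_inner_add_right:
  "f \<in> L2 \<Omega> \<Longrightarrow> g \<in> L2 \<Omega> \<Longrightarrow> h \<in> L2 \<Omega> \<Longrightarrow> L2_inner \<Omega> h (\<lambda>x. f x + g x) = L2_inner \<Omega> h f + L2_inner \<Omega> h g"
  using L2_inner_add_left[of f \<Omega> g h] by (simp add: L2_inner_commute)

lemma L2_inner_diff_right:
  "f \<in> L2 \<Omega> \<Longrightarrow> g \<in> L2 \<Omega> \<Longrightarrow> h \<in> L2 \<Omega> \<Longrightarrow> L2_inner \<Omega> h (\<lambda>x. f x - g x) = L2_inner \<Omega> h f - L2_inner \<Omega> h g"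
  using L2_inner_diff_left[of f \<Omega> g h] by (simp add: L2_inner_commute)

lemma L2_inner_scale_right: "L2_inner \<Omega> h (\<lambda>x. c * f x) = c * L2_inner \<Omega> h f"
  using L2_inner_scale_left[of \<Omega> c f h] by (simp add: L2_inner_commute)

lemma L2_inner_sum_left:
  "(\<And>i. i \<in> I \<Longrightarrow> f i \<in> L2 \<Omega>) \<Longrightarrow> h \<in> L2 \<Omega> \<Longrightarrow>
    L2_inner \<Omega> (\<lambda>x. \<Sum>i\<in>I. f i x) h = (\<Sum>i\<in>I. L2_inner \<Omega> (f i) h)"
  by (simp add: L2_inner_def sum_distrib_right L2_mult_integrable)

lemma L2_inner_self_nonneg: "L2_inner \<Omega> f f \<ge> 0"
  by (simp add: L2_inner_def)

lemma L2_norm_nonneg: "L2_norm \<Omega> f \<ge> 0"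
  by (simp add: L2_norm_def L2_inner_self_nonneg)

lemma L2_norm_power2: "(L2_norm \<Omega> f)\<^sup>2 = L2_inner \<Omega> f f"
  by (simp add: L2_norm_def L2_inner_self_nonneg)

lemma L2_norm_scale: "L2_norm \<Omega> (\<lambda>x. c * f x) = \<bar>c\<bar> * L2_norm \<Omega> f"
proof -
  have "L2_inner \<Omega> (\<lambda>x. c * f x) (\<lambda>x. c * f x) = c\<^sup>2 * L2_inner \<Omega> f f"
    by (simp add: L2_inner_scale_left L2_inner_scale_right power2_eq_square)
  then show ?thesis by (simp add: L2_norm_def real_sqrt_mult)
qed

lemma L2_norm_diff_commute: "L2_norm \<Omega> (\<lambda>x. f x - g x) = L2_norm \<Omega> (\<lambda>x. g x - f x)"
proof -
  have "(f x - g x) * (f x - g x) = (g x - f x) * (g x - f x)" for x by (simp add: algebra_simps)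
  then show ?thesis by (simp only: L2_norm_def L2_inner_def)
qed

lemma L2_inner_comb:
  assumes "f \<in> L2 \<Omega>" "g \<in> L2 \<Omega>"
  shows "L2_inner \<Omega> (\<lambda>z. x * f z + y * g z) (\<lambda>z. x * f z + y * g z) =
    x\<^sup>2 * L2_inner \<Omega> f f + y\<^sup>2 * L2_inner \<Omega> g g + 2 * x * y * L2_inner \<Omega> f g"
proof -
  have L2: "(\<lambda>z. x * f z) \<in> L2 \<Omega>" "(\<lambda>z. y * g z) \<in> L2 \<Omega>"
    using assms by (auto intro: L2_scale)
  show ?thesis
    unfolding L2_inner_add_left[OF L2 L2_add[OF L2]] L2_inner_scale_left
      L2_inner_add_right[OF L2 assms(1)] L2_inner_add_right[OF L2 assms(2)]
      L2_inner_scale_right L2_inner_commute[of \<Omega> g f]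
    by (simp add: power2_eq_square algebra_simps)
qed

lemma L2_cauchy_schwarz:
  assumes "f \<in> L2 \<Omega>" "g \<in> L2 \<Omega>"
  shows "\<bar>L2_inner \<Omega> f g\<bar> \<le> L2_norm \<Omega> f * L2_norm \<Omega> g"
  unfolding L2_norm_def
  by (rule cauchy_schwarz_of_quadratic)
    (simp only: L2_inner_comb[OF assms, symmetric] L2_inner_self_nonneg)

lemma L2_norm_triangle:
  assumes "f \<in> L2 \<Omega>" "g \<in> L2 \<Omega>"
  shows "L2_norm \<Omega> (\<lambda>x. f x + g x) \<le> L2_norm \<Omega> f + L2_norm \<Omega> g"
proof (rule power2_le_imp_le)
  show "(L2_norm \<Omega> (\<lambda>x. f x + g x))\<^sup>2 \<le> (L2_norm \<Omega> f + L2_norm \<Omega> g)\<^sup>2"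
    using L2_inner_comb[OF assms, of 1 1] L2_cauchy_schwarz[OF assms]
    by (simp add: L2_norm_power2 power2_sum)
qed (simp add: L2_norm_nonneg)

lemma L2_norm_triangle_diff:
  assumes "f \<in> L2 \<Omega>" "g \<in> L2 \<Omega>" "h \<in> L2 \<Omega>"
  shows "L2_norm \<Omega> (\<lambda>x. f x - h x) \<le> L2_norm \<Omega> (\<lambda>x. f x - g x) + L2_norm \<Omega> (\<lambda>x. g x - h x)"
  using L2_norm_triangle[OF L2_diff[OF assms(1,2)] L2_diff[OF assms(2,3)]] by simp

lemma L2_inner_tendsto:
  assumes f: "\<forall>\<^sub>F n in F. f n \<in> L2 \<Omega>" "f0 \<in> L2 \<Omega>" "((\<lambda>n. L2_norm \<Omega> (\<lambda>x. f n x - f0 x)) \<longlongrightarrow> 0) F"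
    and g: "\<forall>\<^sub>F n in F. g n \<in> L2 \<Omega>" "g0 \<in> L2 \<Omega>" "((\<lambda>n. L2_norm \<Omega> (\<lambda>x. g n x - g0 x)) \<longlongrightarrow> 0) F"
  shows "((\<lambda>n. L2_inner \<Omega> (f n) (g n)) \<longlongrightarrow> L2_inner \<Omega> f0 g0) F"
proof -
  let ?a = "\<lambda>n. L2_norm \<Omega> (\<lambda>x. f n x - f0 x)" and ?b = "\<lambda>n. L2_norm \<Omega> (\<lambda>x. g n x - g0 x)"
  have "((\<lambda>n. ?a n * ?b n + ?a n * L2_norm \<Omega> g0 + L2_norm \<Omega> f0 * ?b n) \<longlongrightarrow>
      0 * 0 + 0 * L2_norm \<Omega> g0 + L2_norm \<Omega> f0 * 0) F"
    by (intro tendsto_intros f g)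
  then have lim: "((\<lambda>n. ?a n * ?b n + ?a n * L2_norm \<Omega> g0 + L2_norm \<Omega> f0 * ?b n) \<longlongrightarrow> 0) F"
    by simp
  have "\<forall>\<^sub>F n in F. norm (L2_inner \<Omega> (f n) (g n) - L2_inner \<Omega> f0 g0) \<le>
      ?a n * ?b n + ?a n * L2_norm \<Omega> g0 + L2_norm \<Omega> f0 * ?b n"
    using f(1) g(1)
  proof eventually_elim
    case (elim n)
    let ?f = "\<lambda>x. f n x - f0 x" and ?g = "\<lambda>x. g n x - g0 x"
    have L2: "?f \<in> L2 \<Omega>" "?g \<in> L2 \<Omega>" using elim f(2) g(2) by (auto intro: L2_diff)
    have "L2_inner \<Omega> (f n) (g n) - L2_inner \<Omega> f0 g0 =
        L2_inner \<Omega> ?f ?g + L2_inner \<Omega> ?f g0 + L2_inner \<Omega> f0 ?g"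
      using elim f(2) g(2) by (simp add: L2_inner_diff_left L2_inner_diff_right L2_diff)
    then show ?case
      using L2_cauchy_schwarz[OF L2] L2_cauchy_schwarz[OF L2(1) g(2)] L2_cauchy_schwarz[OF f(2) L2(2)]
      by (simp add: abs_le_iff)
  qed
  then have "((\<lambda>n. L2_inner \<Omega> (f n) (g n) - L2_inner \<Omega> f0 g0) \<longlongrightarrow> 0) F"
    by (rule Lim_null_comparison) (rule lim)
  then show ?thesis
    by (simp add: LIM_zero_iff)
qed

lemma L2_inner_cong:
  assumes "L2_eq \<Omega> f f'" "L2_eq \<Omega> g g'" "f \<in> L2 \<Omega>" "f' \<in> L2 \<Omega>" "g \<in> L2 \<Omega>" "g' \<in> L2 \<Omega>"
  shows "L2_inner \<Omega> f g = L2_inner \<Omega> f' g'"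
  unfolding L2_inner_def
proof (rule integral_cong_AE)
  show "AE x in lebesgue_on \<Omega>. f x * g x = f' x * g' x"
    using assms(1,2) unfolding L2_eq_def by eventually_elim simp
qed (use assms L2_measurable in \<open>blast intro: borel_measurable_times\<close>)+

lemma L2_norm_eq_0_iff:
  assumes "f \<in> L2 \<Omega>"
  shows "L2_norm \<Omega> f = 0 \<longleftrightarrow> L2_eq \<Omega> f (\<lambda>x. 0)"
  using integral_nonneg_eq_0_iff_AE[OF L2_square_integrable[OF assms]]
  by (simp add: L2_norm_def L2_inner_def L2_eq_def flip: power2_eq_square)

lemma L2_eq_iff_norm:
  assumes "f \<in> L2 \<Omega>" "g \<in> L2 \<Omega>"
  shows "L2_eq \<Omega> f g \<longleftrightarrow> L2_norm \<Omega> (\<lambda>x. f x - g x) = 0"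
  unfolding L2_norm_eq_0_iff[OF L2_diff[OF assms]] by (simp add: L2_eq_def)

lemma L2_norm_nn_integral:
  assumes "f \<in> L2 \<Omega>"
  shows "(\<integral>\<^sup>+x. ennreal ((f x)\<^sup>2) \<partial>lebesgue_on \<Omega>) = ennreal ((L2_norm \<Omega> f)\<^sup>2)"
proof -
  have "(LINT x|lebesgue_on \<Omega>. (f x)\<^sup>2) = (L2_norm \<Omega> f)\<^sup>2"
    unfolding L2_norm_power2 L2_inner_def by (simp add: power2_eq_square)
  then show ?thesis
    using nn_integral_eq_integral[OF L2_square_integrable[OF assms]] by simp
qed

text \<open>Fatou's lemma estimates a limit before it is known to be square integrable, so
  membership and norm bound are obtained together.\<close>

lemma L2_iff_nn_integral:
  assumes "f \<in> borel_measurable (lebesgue_on \<Omega>)"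
    and "(\<integral>\<^sup>+x. ennreal ((f x)\<^sup>2) \<partial>lebesgue_on \<Omega>) \<le> ennreal (c\<^sup>2)" "c \<ge> 0"
  shows "f \<in> L2 \<Omega>" "L2_norm \<Omega> f \<le> c"
proof -
  show L2: "f \<in> L2 \<Omega>"
  proof -
    have "integrable (lebesgue_on \<Omega>) (\<lambda>x. (f x)\<^sup>2)"
    proof (rule integrableI_bounded)
      have "(\<integral>\<^sup>+x. ennreal ((f x)\<^sup>2) \<partial>lebesgue_on \<Omega>) < \<infinity>"
        using assms(2) by (rule le_less_trans) simp
      then show "(\<integral>\<^sup>+x. ennreal (norm ((f x)\<^sup>2)) \<partial>lebesgue_on \<Omega>) < \<infinity>" by simp
    qed (use assms(1) in measurable)
    then show ?thesis using assms(1) by (simp add: L2_def)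
  qed
  show "L2_norm \<Omega> f \<le> c"
  proof (rule power2_le_imp_le)
    show "(L2_norm \<Omega> f)\<^sup>2 \<le> c\<^sup>2"
      using assms(2) unfolding L2_norm_nn_integral[OF L2] by simp
  qed fact
qed

text \<open>Riesz-Fischer. A subsequence whose increments have norm at most 2^-k has, on a finite
  measure space, summable increments in L^1 and therefore converges almost everywhere. Fatou's lemma
  then turns the Cauchy property into convergence in norm.\<close>

lemma L2_complete:
  assumes fin: "finite_measure (lebesgue_on \<Omega>)"
    and f: "\<And>n. f n \<in> L2 \<Omega>"
    and cauchy: "\<And>e. e > 0 \<Longrightarrow> \<exists>N. \<forall>m\<ge>N. \<forall>n\<ge>N. L2_norm \<Omega> (\<lambda>x. f m x - f n x) < e"
  shows "\<exists>g \<in> L2 \<Omega>. (\<lambda>n. L2_norm \<Omega> (\<lambda>x. f n x - g x)) \<longlonglongrightarrow> 0"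
proof -
  interpret finite_measure "lebesgue_on \<Omega>" by fact
  have one: "(\<lambda>x. 1) \<in> L2 \<Omega>" by (simp add: L2_def)
  obtain N where N: "\<And>e m n. e > 0 \<Longrightarrow> m \<ge> N e \<Longrightarrow> n \<ge> N e \<Longrightarrow> L2_norm \<Omega> (\<lambda>x. f m x - f n x) < e"
    using cauchy by metis
  \<comment> \<open>The maximum makes \<open>r\<close> strictly increasing and puts
    \<open>r k\<close> past the Cauchy threshold for 2^-k.\<close>
  define r where "r = rec_nat (N 1) (\<lambda>k rk. max (Suc rk) (N ((1/2) ^ Suc k)))"
  have r_Suc: "r (Suc k) = max (Suc (r k)) (N ((1/2) ^ Suc k))" for k
    by (simp add: r_def)
  have r_ge: "r k \<ge> N ((1/2) ^ k)" for k
    by (cases k) (simp_all add: r_Suc, simp add: r_def)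
  have r_mono: "strict_mono r"
    unfolding strict_mono_Suc_iff by (simp add: r_Suc less_max_iff_disj)
  define d where "d k = (\<lambda>x. f (r (Suc k)) x - f (r k) x)" for k
  have d_L2: "d k \<in> L2 \<Omega>" for k unfolding d_def by (intro L2_diff f)
  have d_norm: "L2_norm \<Omega> (d k) \<le> (1/2) ^ k" for k
    using N[of "(1/2) ^ k" "r (Suc k)" "r k"] r_ge[of k] strict_mono_leD[OF r_mono, of k "Suc k"]
    by (simp add: d_def)
  have abs_L2: "(\<lambda>x. \<bar>d k x\<bar>) \<in> L2 \<Omega>" for k
    using d_L2[of k] unfolding L2_def by (auto intro: borel_measurable_abs)
  have abs_int: "(\<integral>\<^sup>+x. ennreal \<bar>d k x\<bar> \<partial>lebesgue_on \<Omega>) \<le> ennreal ((1/2) ^ k * L2_norm \<Omega> (\<lambda>x. 1))" for k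
  proof -
    have "(\<integral>\<^sup>+x. ennreal \<bar>d k x\<bar> \<partial>lebesgue_on \<Omega>) = ennreal (L2_inner \<Omega> (\<lambda>x. \<bar>d k x\<bar>) (\<lambda>x. 1))"
      using nn_integral_eq_integral[OF L2_mult_integrable[OF abs_L2 one, of k]] by (simp add: L2_inner_def)
    also have "\<dots> \<le> ennreal (L2_norm \<Omega> (\<lambda>x. \<bar>d k x\<bar>) * L2_norm \<Omega> (\<lambda>x. 1))"
      using L2_cauchy_schwarz[OF abs_L2 one, of k] by (intro ennreal_leI) simp
    also have "L2_norm \<Omega> (\<lambda>x. \<bar>d k x\<bar>) = L2_norm \<Omega> (d k)"
      by (simp add: L2_norm_def L2_inner_def)
    also have "ennreal (\<dots> * L2_norm \<Omega> (\<lambda>x. 1)) \<le> ennreal ((1/2) ^ k * L2_norm \<Omega> (\<lambda>x. 1))"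
      using d_norm[of k] by (intro ennreal_leI mult_right_mono L2_norm_nonneg)
    finally show ?thesis .
  qed
  have meas: "(\<lambda>x. ennreal \<bar>d k x\<bar>) \<in> borel_measurable (lebesgue_on \<Omega>)" for k
    using L2_measurable[OF d_L2[of k]] by measurable
  have "(\<integral>\<^sup>+x. (\<Sum>k. ennreal \<bar>d k x\<bar>) \<partial>lebesgue_on \<Omega>) = (\<Sum>k. \<integral>\<^sup>+x. ennreal \<bar>d k x\<bar> \<partial>lebesgue_on \<Omega>)"
    by (rule nn_integral_suminf) (rule meas)
  also have "\<dots> \<le> (\<Sum>k. ennreal ((1/2) ^ k * L2_norm \<Omega> (\<lambda>x. 1)))"
    by (intro suminf_le abs_int) auto
  also have "\<dots> = ennreal (\<Sum>k. (1/2) ^ k * L2_norm \<Omega> (\<lambda>x. 1))"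
    by (rule suminf_ennreal2) (simp_all add: L2_norm_nonneg summable_mult2 summable_geometric)
  also have "\<dots> < \<infinity>" by simp
  finally have "AE x in lebesgue_on \<Omega>. (\<Sum>k. ennreal \<bar>d k x\<bar>) \<noteq> \<infinity>"
    using meas by (intro nn_integral_PInf_AE borel_measurable_suminf) auto
  then have conv: "AE x in lebesgue_on \<Omega>. convergent (\<lambda>k. f (r k) x)"
  proof eventually_elim
    case (elim x)
    then have "summable (\<lambda>k. \<bar>d k x\<bar>)"
      by (intro summable_suminf_not_top) auto
    then have "summable (\<lambda>k. d k x)"
      by (rule summable_rabs_cancel)
    then have "convergent (\<lambda>n. \<Sum>k<n. d k x)"
      by (simp add: summable_iff_convergent)
    moreover have "(\<Sum>k<n. d k x) = f (r n) x - f (r 0) x" for n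
      by (simp add: d_def sum_lessThan_telescope[of "\<lambda>k. f (r k) x"])
    ultimately show ?case
      by (simp add: convergent_diff_const_right_iff)
  qed
  \<comment> \<open>Where the subsequence diverges, \<open>lim\<close> has an arbitrary value; this
    happens on a null set.\<close>
  define g where "g x = lim (\<lambda>k. f (r k) x)" for x
  have g_meas: "g \<in> borel_measurable (lebesgue_on \<Omega>)"
    unfolding g_def by (intro borel_measurable_lim_metric L2_measurable f)
  have bound: "(\<lambda>x. f n x - g x) \<in> L2 \<Omega> \<and> L2_norm \<Omega> (\<lambda>x. f n x - g x) \<le> e" if "e > 0" "n \<ge> N e" for e n
  proof -
    have "(\<integral>\<^sup>+x. ennreal ((f n x - g x)\<^sup>2) \<partial>lebesgue_on \<Omega>) =
        (\<integral>\<^sup>+x. liminf (\<lambda>k. ennreal ((f n x - f (r k) x)\<^sup>2)) \<partial>lebesgue_on \<Omega>)"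
    proof (rule nn_integral_cong_AE, use conv in eventually_elim)
      case (elim x)
      then have "(\<lambda>k. f (r k) x) \<longlonglongrightarrow> g x"
        by (simp add: g_def convergent_LIMSEQ_iff)
      then have "(\<lambda>k. ennreal ((f n x - f (r k) x)\<^sup>2)) \<longlonglongrightarrow> ennreal ((f n x - g x)\<^sup>2)"
        by (intro tendsto_ennrealI tendsto_intros)
      then show ?case
        by (rule lim_imp_Liminf[OF sequentially_bot, symmetric])
    qed
    also have "\<dots> \<le> liminf (\<lambda>k. \<integral>\<^sup>+x. ennreal ((f n x - f (r k) x)\<^sup>2) \<partial>lebesgue_on \<Omega>)"
      using L2_measurable[OF f] by (intro nn_integral_liminf) measurable
    also have "\<dots> \<le> ennreal (e\<^sup>2)"
    proof (rule Liminf_le)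
      show "\<forall>\<^sub>F k in sequentially. (\<integral>\<^sup>+x. ennreal ((f n x - f (r k) x)\<^sup>2) \<partial>lebesgue_on \<Omega>) \<le> ennreal (e\<^sup>2)"
        using eventually_ge_at_top[of "N e"]
      proof eventually_elim
        case (elim k)
        then have "r k \<ge> N e"
          using seq_suble[OF r_mono, of k] by simp
        then have "L2_norm \<Omega> (\<lambda>x. f n x - f (r k) x) \<le> e"
          using N[OF \<open>e > 0\<close> \<open>n \<ge> N e\<close>] by (simp add: less_imp_le)
        then show ?case
          unfolding L2_norm_nn_integral[OF L2_diff[OF f f]]
          by (intro ennreal_leI power_mono L2_norm_nonneg)
      qed
    qed simp
    finally show ?thesis
      using L2_iff_nn_integral[of "\<lambda>x. f n x - g x" \<Omega> e] g_meas L2_measurable[OF f[of n]] \<open>e > 0\<close>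
      by simp
  qed
  have "g \<in> L2 \<Omega>"
    using L2_diff[OF f[of "N 1"] conjunct1[OF bound[of 1 "N 1"]]] by simp
  moreover have "(\<lambda>n. L2_norm \<Omega> (\<lambda>x. f n x - g x)) \<longlonglongrightarrow> 0"
  proof (rule LIMSEQ_I)
    fix e :: real assume "e > 0"
    show "\<exists>no. \<forall>n\<ge>no. norm (L2_norm \<Omega> (\<lambda>x. f n x - g x) - 0) < e"
    proof (intro exI allI impI)
      fix n assume "n \<ge> N (e / 2)"
      then have "L2_norm \<Omega> (\<lambda>x. f n x - g x) \<le> e / 2"
        using bound[of "e / 2" n] \<open>e > 0\<close> by simp
      then show "norm (L2_norm \<Omega> (\<lambda>x. f n x - g x) - 0) < e"
        using \<open>e > 0\<close> by (simp add: L2_norm_nonneg)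
    qed
  qed
  ultimately show ?thesis by blast
qed

section \<open>Energy decay for two-time kernels\<close>

text \<open>Since \<open>g\<close> is assumed differentiable at \<open>x\<close> alone, l'Hopital's
  rule is applied once. The quotient it leaves combines two difference quotients of \<open>g\<close>
  based at \<open>x\<close>, with limit 2 D - D.\<close>

lemma second_difference_limit:
  fixes G g :: "real \<Rightarrow> real"
  assumes G: "\<And>y. y > 0 \<Longrightarrow> (G has_real_derivative g y) (at y)"
    and g: "(g has_real_derivative D) (at x)" and "x > 0"
  shows "((\<lambda>\<eta>. (G (x + 2 * \<eta>) - 2 * G (x + \<eta>) + G x) / \<eta>\<^sup>2) \<longlongrightarrow> D) (at_right 0)"
proof (rule lhopital_right_0[where g' = "\<lambda>\<eta>. 2 * \<eta>" and f' = "\<lambda>\<eta>. 2 * g (x + 2 * \<eta>) - 2 * g (x + \<eta>)"])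
  have contG: "isCont G x"
    using G[OF \<open>x > 0\<close>] DERIV_isCont by blast
  have "((\<lambda>\<eta>. G (x + 2 * \<eta>) - 2 * G (x + \<eta>) + G x) \<longlongrightarrow> G (x + 2 * 0) - 2 * G (x + 0) + G x) (at_right 0)"
    by (intro tendsto_intros isCont_tendsto_compose[of _ G]) (use contG in auto)
  then show "((\<lambda>\<eta>. G (x + 2 * \<eta>) - 2 * G (x + \<eta>) + G x) \<longlongrightarrow> 0) (at_right 0)"
    by simp
  show "((\<lambda>\<eta>::real. \<eta>\<^sup>2) \<longlongrightarrow> 0) (at_right 0)"
    by (rule tendsto_eq_intros | simp)+
  show "\<forall>\<^sub>F \<eta> in at_right 0. \<eta>\<^sup>2 \<noteq> (0::real)" "\<forall>\<^sub>F \<eta> in at_right 0. 2 * \<eta> \<noteq> (0::real)"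
    by (auto simp: eventually_at_filter)
  show "\<forall>\<^sub>F \<eta> in at_right 0. ((\<lambda>\<eta>. \<eta>\<^sup>2) has_real_derivative 2 * \<eta>) (at \<eta>)"
    by (auto intro!: always_eventually derivative_eq_intros)
  show "\<forall>\<^sub>F \<eta> in at_right 0. ((\<lambda>\<eta>. G (x + 2 * \<eta>) - 2 * G (x + \<eta>) + G x) has_real_derivative
      2 * g (x + 2 * \<eta>) - 2 * g (x + \<eta>)) (at \<eta>)"
    using eventually_at_right_less[of 0]
  proof eventually_elim
    case (elim \<eta>)
    then have "((\<lambda>\<eta>. G (x + 2 * \<eta>)) has_real_derivative g (x + 2 * \<eta>) * 2) (at \<eta>)"
      by (intro DERIV_chain2[OF G]) (use \<open>x > 0\<close> in \<open>auto intro!: derivative_eq_intros\<close>)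
    moreover have "((\<lambda>\<eta>. G (x + \<eta>)) has_real_derivative g (x + \<eta>) * 1) (at \<eta>)"
      using elim by (intro DERIV_chain2[OF G]) (use \<open>x > 0\<close> in \<open>auto intro!: derivative_eq_intros\<close>)
    ultimately show ?case
      by (auto intro!: derivative_eq_intros)
  qed
  have quot: "((\<lambda>y. (g y - g x) / (y - x)) \<longlongrightarrow> D) (at x)"
    using g by (simp add: has_field_derivative_iff)
  have lim2: "((\<lambda>\<eta>. (g (x + k * \<eta>) - g x) / (x + k * \<eta> - x)) \<longlongrightarrow> D) (at_right 0)" if "k > 0" for k
  proof (rule filterlim_compose[OF quot])
    have "((\<lambda>\<eta>. x + k * \<eta>) \<longlongrightarrow> x + k * 0) (at_right 0)"
      by (intro tendsto_intros)
    then show "filterlim (\<lambda>\<eta>. x + k * \<eta>) (at x) (at_right 0)"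
      using that by (auto simp: filterlim_at eventually_at_filter)
  qed
  have "((\<lambda>\<eta>. 2 * ((g (x + 2 * \<eta>) - g x) / (x + 2 * \<eta> - x)) - (g (x + 1 * \<eta>) - g x) / (x + 1 * \<eta> - x)) \<longlongrightarrow> 2 * D - D) (at_right 0)"
    by (intro tendsto_intros lim2) auto
  moreover have "\<forall>\<^sub>F \<eta> in at_right 0. 2 * ((g (x + 2 * \<eta>) - g x) / (x + 2 * \<eta> - x)) - (g (x + 1 * \<eta>) - g x) / (x + 1 * \<eta> - x)
      = (2 * g (x + 2 * \<eta>) - 2 * g (x + \<eta>)) / (2 * \<eta>)"
    using eventually_at_right_less[of 0] by eventually_elim (simp add: field_simps)
  ultimately show "((\<lambda>\<eta>. (2 * g (x + 2 * \<eta>) - 2 * g (x + \<eta>)) / (2 * \<eta>)) \<longlongrightarrow> D) (at_right 0)"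
    by (simp add: filterlim_cong[OF refl refl])
qed

lemma continuous_on_curve:
  assumes f: "continuous_on ({0..} \<times> {0..}) (\<lambda>(t, s). f t s)"
    and "continuous_on S x" "continuous_on S y"
    and "\<And>r. r \<in> S \<Longrightarrow> x r \<ge> 0" "\<And>r. r \<in> S \<Longrightarrow> y r \<ge> 0"
  shows "continuous_on S (\<lambda>r. f (x r) (y r :: real) :: real)"
proof -
  have "continuous_on S (\<lambda>r. (\<lambda>(t, s). f t s) (x r, y r))"
    by (rule continuous_on_compose2[OF f]) (use assms in \<open>auto intro!: continuous_intros\<close>)
  then show ?thesis by simp
qed

text \<open>Continuity of one partial derivative, here \<open>f2\<close>, upgrades the two partial
  derivatives to joint differentiability, and the chain rule applies. The curves in question are the
  diagonal, its translates and the segments on which t + s is constant.\<close>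

lemma has_derivative_along_curve:
  assumes f1: "\<And>t s. t > 0 \<Longrightarrow> s > 0 \<Longrightarrow> ((\<lambda>t. f t s) has_real_derivative f1 t s) (at t)"
    and f2: "\<And>t s. t > 0 \<Longrightarrow> s > 0 \<Longrightarrow> ((\<lambda>s. f t s) has_real_derivative f2 t s) (at s)"
    and cont: "continuous_on ({0..} \<times> {0..}) (\<lambda>(t, s). f2 t s :: real)"
    and x: "(x has_real_derivative x') (at r)" and y: "(y has_real_derivative y') (at r)"
    and "x r > 0" "y r > 0"
  shows "((\<lambda>r. f (x r) (y r)) has_real_derivative f1 (x r) (y r) * x' + f2 (x r) (y r) * y') (at r)"
proof -
  let ?t = "x r" and ?s = "y r"
  have contf2: "isCont (\<lambda>(t, s). f2 t s) (?t, ?s)"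
  proof -
    have "continuous_on ({0<..} \<times> {0<..}) (\<lambda>(t, s). f2 t s)"
      by (rule continuous_on_subset[OF cont]) auto
    moreover have "open ({0<..} \<times> {0<..} :: (real \<times> real) set)"
      by (intro open_Times) auto
    ultimately show ?thesis
      using assms(6,7) by (simp add: continuous_on_eq_continuous_at)
  qed
  have "((\<lambda>(t, s). f t s) has_derivative (\<lambda>(t, s). f1 ?t ?s * t + blinfun_mult_right (f2 ?t ?s) s))
          (at (?t, ?s) within {0<..} \<times> {0<..})"
  proof (rule has_derivative_partialsI)
    show "((\<lambda>t. f t ?s) has_derivative (*) (f1 ?t ?s)) (at ?t within {0<..})"
      using f1[of ?t ?s] assms(6,7)
      by (simp add: has_field_derivative_def has_derivative_at_withinI)
  next
    show "\<And>t s. t \<in> {0<..} \<Longrightarrow> s \<in> {0<..} \<Longrightarrow>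
        ((\<lambda>s. f t s) has_derivative blinfun_mult_right (f2 t s)) (at s within {0<..})"
      using f2 by (simp add: has_field_derivative_def has_derivative_at_withinI)
  next
    have "((\<lambda>z. blinfun_mult_right ((\<lambda>(t, s). f2 t s) z)) \<longlongrightarrow>
        blinfun_mult_right ((\<lambda>(t, s). f2 t s) (?t, ?s))) (at (?t, ?s) within {0<..} \<times> {0<..})"
      by (rule bounded_linear.tendsto[OF bounded_linear_blinfun_mult_right])
        (use contf2 in \<open>auto simp: isCont_def intro: tendsto_within_subset\<close>)
    then show "continuous (at (?t, ?s) within {0<..} \<times> {0<..}) (\<lambda>(t, s). blinfun_mult_right (f2 t s))"
      by (simp add: continuous_within case_prod_beta')
  qed (use assms in auto)
  then have "((\<lambda>(t, s). f t s) has_derivative (\<lambda>(t, s). f1 ?t ?s * t + f2 ?t ?s * s)) (at (?t, ?s))"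
    using assms(6,7) at_within_open[of "(?t, ?s)" "{0<..} \<times> {0<..}"]
    by (simp add: open_Times)
  moreover have "((\<lambda>r. (x r, y r)) has_derivative (\<lambda>h. (x' * h, y' * h))) (at r)"
    using x y by (auto simp: has_field_derivative_def intro: has_derivative_Pair)
  ultimately have "((\<lambda>r. (\<lambda>(t, s). f t s) (x r, y r)) has_derivative
      (\<lambda>h. (\<lambda>(t, s). f1 ?t ?s * t + f2 ?t ?s * s) (x' * h, y' * h))) (at r)"
    by (rule has_derivative_compose[rotated])
  then have "((\<lambda>r. f (x r) (y r)) has_derivative
      (\<lambda>h. (\<lambda>(t, s). f1 ?t ?s * t + f2 ?t ?s * s) (x' * h, y' * h))) (at r)"
    by simp
  then show ?thesis
    unfolding has_field_derivative_def
    by (rule has_derivative_eq_rhs) (simp add: fun_eq_iff algebra_simps)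
qed

lemma has_derivative_cong_pos:
  assumes "(f has_real_derivative D) (at (t::real))" "t > 0" "\<And>r. r > 0 \<Longrightarrow> f r = g r"
  shows "(g has_real_derivative D) (at t)"
  by (rule has_field_derivative_transform_within_open[OF assms(1), of "{0<..}"])
    (use assms in auto)

text \<open>Here \<open>p\<close>, \<open>q\<close>, \<open>m\<close> stand for (U(t), U(s)),
  (U'(t), U(s)), (U'(t), U'(s)) and \<open>a\<close> for a(U(t), U(s)), where U'' + \<beta> A U' +
  \<alpha> U' + \<kappa> A U + c U = 0. \<open>gram\<close> is the squared norm of x U(t) + y U(s) +
  z U'(t), and \<open>coercive\<close> is Poincare's inequality for x U(t) + y U(s). Only the sum
  \<open>q + \<beta> a\<close> is differentiated, as \<open>a\<close> by itself need not be
  differentiable. The sign of \<alpha> is left open because the exponential weight replaces \<alpha>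
  by \<alpha> - 2 \<delta>.\<close>

locale damped_kernel =
  fixes p q m a :: "real \<Rightarrow> real \<Rightarrow> real" and \<alpha> \<beta> \<kappa> c lam :: real
  assumes cont_p: "continuous_on ({0..} \<times> {0..}) (\<lambda>(t, s). p t s)"
    and cont_q: "continuous_on ({0..} \<times> {0..}) (\<lambda>(t, s). q t s)"
    and cont_m: "continuous_on ({0..} \<times> {0..}) (\<lambda>(t, s). m t s)"
    and cont_a: "continuous_on ({0..} \<times> {0..}) (\<lambda>(t, s). a t s)"
    and sym_p: "t \<ge> 0 \<Longrightarrow> s \<ge> 0 \<Longrightarrow> p s t = p t s"
    and sym_m: "t \<ge> 0 \<Longrightarrow> s \<ge> 0 \<Longrightarrow> m s t = m t s"
    and sym_a: "t \<ge> 0 \<Longrightarrow> s \<ge> 0 \<Longrightarrow> a s t = a t s"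
    and deriv_p: "t > 0 \<Longrightarrow> s > 0 \<Longrightarrow> ((\<lambda>t. p t s) has_real_derivative q t s) (at t)"
    and deriv_q: "t > 0 \<Longrightarrow> s > 0 \<Longrightarrow> ((\<lambda>s. q t s) has_real_derivative m t s) (at s)"
    and evolution: "t > 0 \<Longrightarrow> s > 0 \<Longrightarrow>
      ((\<lambda>t. q t s + \<beta> * a t s) has_real_derivative (- \<alpha> * q t s - \<kappa> * a t s - c * p t s)) (at t)"
    and gram: "t \<ge> 0 \<Longrightarrow> s \<ge> 0 \<Longrightarrow>
      0 \<le> x\<^sup>2 * p t t + y\<^sup>2 * p s s + z\<^sup>2 * m t t + 2 * x * y * p t s + 2 * x * z * q t t + 2 * y * z * q t s"
    and coercive: "t \<ge> 0 \<Longrightarrow> s \<ge> 0 \<Longrightarrow>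
      lam * (x\<^sup>2 * p t t + y\<^sup>2 * p s s + 2 * x * y * p t s)
        \<le> x\<^sup>2 * a t t + y\<^sup>2 * a s s + 2 * x * y * a t s"
    and nonneg: "\<beta> \<ge> 0" "lam > 0"
begin

lemma p_nonneg: "t \<ge> 0 \<Longrightarrow> p t t \<ge> 0"
  using gram[of t t 1 0 0] by simp

lemma m_nonneg: "t \<ge> 0 \<Longrightarrow> m t t \<ge> 0"
  using gram[of t t 0 0 1] by simp

lemma poincare: "t \<ge> 0 \<Longrightarrow> lam * p t t \<le> a t t"
  using coercive[of t t 1 0] by simp

lemma a_nonneg: "t \<ge> 0 \<Longrightarrow> a t t \<ge> 0"
  using poincare[of t] p_nonneg[of t] nonneg(2) by (smt (verit) mult_nonneg_nonneg)

lemma p_bound: "t \<ge> 0 \<Longrightarrow> s \<ge> 0 \<Longrightarrow> 2 * \<bar>p t s\<bar> \<le> p t t + p s s"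
  using gram[of t s 1 1 0] gram[of t s 1 "-1" 0] by auto

lemma q_bound: "t \<ge> 0 \<Longrightarrow> s \<ge> 0 \<Longrightarrow> 2 * \<bar>q t s\<bar> \<le> m t t + p s s"
  using gram[of t s 0 1 1] gram[of t s 0 1 "-1"] by auto

lemma a_cauchy_schwarz:
  assumes "t \<ge> 0" "s \<ge> 0"
  shows "a t s \<le> sqrt (a t t) * sqrt (a s s)"
proof -
  have quad: "0 \<le> x\<^sup>2 * a t t + y\<^sup>2 * a s s + 2 * x * y * a t s" for x y
  proof -
    have "0 \<le> x\<^sup>2 * p t t + y\<^sup>2 * p s s + 2 * x * y * p t s"
      using gram[OF assms, of x y 0] by simp
    then show ?thesis
      using coercive[OF assms, of x y] nonneg(2) by (smt (verit) mult_nonneg_nonneg)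
  qed
  then have "\<bar>a t s\<bar> \<le> sqrt (a t t) * sqrt (a s s)"
    by (rule cauchy_schwarz_of_quadratic)
  then show ?thesis by simp
qed

definition kernel_sum :: "real \<Rightarrow> real \<Rightarrow> real" where
  "kernel_sum t s = q t s + q s t + \<beta> * a t s + \<alpha> * p t s"

definition lagrangian :: "real \<Rightarrow> real \<Rightarrow> real" where
  "lagrangian t s = m t s - \<kappa> * a t s - c * p t s"

lemma cont_q': "continuous_on ({0..} \<times> {0..}) (\<lambda>(t, s). q s t)"
proof -
  have "continuous_on ({0..} \<times> {0..}) (\<lambda>z. q (snd z) (fst z))"
    by (rule continuous_on_curve[OF cont_q]) (auto intro!: continuous_intros)
  then show ?thesis by (simp add: case_prod_beta')
qed

lemma cont_kernel_sum: "continuous_on ({0..} \<times> {0..}) (\<lambda>(t, s). kernel_sum t s)"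
  using cont_p cont_q cont_q' cont_a unfolding kernel_sum_def case_prod_beta'
  by (intro continuous_intros) auto

lemma cont_lagrangian: "continuous_on ({0..} \<times> {0..}) (\<lambda>(t, s). lagrangian t s)"
  using cont_p cont_m cont_a unfolding lagrangian_def case_prod_beta'
  by (intro continuous_intros) auto

lemma kernel_sum_sym: "t \<ge> 0 \<Longrightarrow> s \<ge> 0 \<Longrightarrow> kernel_sum s t = kernel_sum t s"
  by (simp add: kernel_sum_def sym_p sym_a)

lemma lagrangian_sym: "t \<ge> 0 \<Longrightarrow> s \<ge> 0 \<Longrightarrow> lagrangian s t = lagrangian t s"
  by (simp add: lagrangian_def sym_p sym_a sym_m)

text \<open>The derivative of \<alpha> p cancels the friction term - \<alpha> q, and what remains is
  symmetric in t and s. Hence the two partial derivatives of \<open>kernel_sum\<close> coincide,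
  which is why it depends on t + s only.\<close>

lemma deriv_kernel_sum1:
  assumes "t > 0" "s > 0"
  shows "((\<lambda>t. kernel_sum t s) has_real_derivative lagrangian t s) (at t)"
proof -
  have "((\<lambda>t. q t s + \<beta> * a t s + q s t + \<alpha> * p t s) has_real_derivative
      (- \<alpha> * q t s - \<kappa> * a t s - c * p t s) + m s t + \<alpha> * q t s) (at t)"
    using assms by (intro DERIV_add evolution deriv_q DERIV_cmult deriv_p) auto
  moreover have "(- \<alpha> * q t s - \<kappa> * a t s - c * p t s) + m s t + \<alpha> * q t s = lagrangian t s"
    using assms by (simp add: lagrangian_def sym_m)
  moreover have "(\<lambda>t. q t s + \<beta> * a t s + q s t + \<alpha> * p t s) = (\<lambda>t. kernel_sum t s)"
    by (simp add: kernel_sum_def fun_eq_iff)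
  ultimately show ?thesis by simp
qed

lemma deriv_kernel_sum2:
  assumes "t > 0" "s > 0"
  shows "((\<lambda>s. kernel_sum t s) has_real_derivative lagrangian t s) (at s)"
proof -
  have "((\<lambda>s. kernel_sum s t) has_real_derivative lagrangian t s) (at s)"
    using deriv_kernel_sum1[of s t] assms by (simp add: lagrangian_sym)
  then show ?thesis
    by (rule has_derivative_cong_pos) (use assms kernel_sum_sym in auto)
qed

definition profile :: "real \<Rightarrow> real" where
  "profile x = kernel_sum x 0"

lemma kernel_sum_eq_profile:
  assumes "t \<ge> 0" "s \<ge> 0"
  shows "kernel_sum t s = profile (t + s)"
proof (cases "t + s = 0")
  case True
  with assms have "t = 0" "s = 0" by auto
  then show ?thesis by (simp add: profile_def)
next
  case False
  define x where "x = t + s"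
  have "x > 0" using False assms by (simp add: x_def)
  \<comment> \<open>Along t + s = x the two equal partial derivatives cancel. Continuity takes in
    the end points, where no equation is assumed.\<close>
  have const: "kernel_sum r (x - r) = kernel_sum 0 (x - 0)" if "r \<in> {0..x}" for r
  proof (rule DERIV_isconst2[of 0 x])
    show "continuous_on {0..x} (\<lambda>r. kernel_sum r (x - r))"
      by (rule continuous_on_curve[OF cont_kernel_sum]) (auto intro!: continuous_intros)
  next
    fix r assume "0 < r" "r < x"
    have "((\<lambda>r. kernel_sum (r) (x - r)) has_real_derivative lagrangian r (x - r) * 1 + lagrangian r (x - r) * (- 1)) (at r)"
      by (rule has_derivative_along_curve[OF deriv_kernel_sum1 deriv_kernel_sum2 cont_lagrangian])
        (use \<open>0 < r\<close> \<open>r < x\<close> in \<open>auto intro!: derivative_eq_intros\<close>)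
    then show "((\<lambda>r. kernel_sum (r) (x - r)) has_real_derivative 0) (at r)" by simp
  qed (use that \<open>x > 0\<close> in auto)
  have "kernel_sum t (x - t) = kernel_sum x (x - x)"
    using const[of t] const[of x] assms by (simp add: x_def)
  then show ?thesis by (simp add: x_def profile_def)
qed

lemma cont_profile: "continuous_on {0..} profile"
  unfolding profile_def by (rule continuous_on_curve[OF cont_kernel_sum]) (auto intro!: continuous_intros)

text \<open>Near x = 2 t the profile equals \<open>kernel_sum (x - t) t\<close>, whose second
  argument is fixed, so one partial derivative suffices.\<close>

lemma deriv_profile:
  assumes "t > 0"
  shows "(profile has_real_derivative lagrangian t t) (at (2 * t))"
proof -
  have "((\<lambda>x. kernel_sum (x - t) t) has_real_derivative lagrangian t t) (at (2 * t))"
  proof -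
    have "((\<lambda>x. kernel_sum x t) has_real_derivative lagrangian t t) (at (2 * t - t))"
      using deriv_kernel_sum1[of t t] assms by simp
    then show ?thesis
      using DERIV_shift[of "\<lambda>x. kernel_sum x t" "lagrangian t t" "2 * t" "- t"] by (simp add: algebra_simps)
  qed
  then show ?thesis
    by (rule has_field_derivative_transform_within_open[of _ _ _ "{t<..}"])
      (use assms in \<open>auto simp: kernel_sum_eq_profile\<close>)
qed


section \<open>Monotonicity of the energy by time differences\<close>

lemma deriv_p2:
  assumes "t > 0" "s > 0"
  shows "((\<lambda>s. p t s) has_real_derivative q s t) (at s)"
  by (rule has_derivative_cong_pos[OF deriv_p[of s t]]) (use assms sym_p in auto)

text \<open>This is the squared norm of U(t + \<eta>) - U(t), expanded into kernels.\<close>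

definition increment :: "real \<Rightarrow> real \<Rightarrow> real" where
  "increment \<eta> t = p (t + \<eta>) (t + \<eta>) - 2 * p (t + \<eta>) t + p t t"

lemma increment_nonneg: "\<eta> \<ge> 0 \<Longrightarrow> t \<ge> 0 \<Longrightarrow> increment \<eta> t \<ge> 0"
  using gram[of "t + \<eta>" t 1 "-1" 0] by (simp add: increment_def)

lemma deriv_increment:
  assumes "\<eta> > 0" "t > 0"
  shows "((\<lambda>t. increment \<eta> t) has_real_derivative
    2 * (q (t + \<eta>) (t + \<eta>) - q (t + \<eta>) t - q t (t + \<eta>) + q t t)) (at t)"
proof -
  have "((\<lambda>t. p (t + \<eta>) (t + \<eta>)) has_real_derivative q (t + \<eta>) (t + \<eta>) * 1 + q (t + \<eta>) (t + \<eta>) * 1) (at t)"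
    by (rule has_derivative_along_curve[OF deriv_p deriv_p2 cont_q'])
      (use assms in \<open>auto intro!: derivative_eq_intros\<close>)
  moreover have "((\<lambda>t. p (t + \<eta>) t) has_real_derivative q (t + \<eta>) t * 1 + q t (t + \<eta>) * 1) (at t)"
    by (rule has_derivative_along_curve[OF deriv_p deriv_p2 cont_q'])
      (use assms in \<open>auto intro!: derivative_eq_intros\<close>)
  moreover have "((\<lambda>t. p t t) has_real_derivative q t t * 1 + q t t * 1) (at t)"
    by (rule has_derivative_along_curve[OF deriv_p deriv_p2 cont_q'])
      (use assms in \<open>auto intro!: derivative_eq_intros\<close>)
  ultimately show ?thesis
    unfolding increment_def by (auto intro!: derivative_eq_intros)
qed

text \<open>L'Hopital's rule leaves a difference quotient of \<open>q (t + \<eta>)\<close>, a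
  function that itself moves with \<eta>. The mean value theorem turns it into a value of
  \<open>m\<close> near (t, t), and joint continuity of \<open>m\<close> gives the limit.\<close>

lemma increment_limit:
  assumes "t > 0"
  shows "((\<lambda>\<eta>. increment \<eta> t / \<eta>\<^sup>2) \<longlongrightarrow> m t t) (at_right 0)"
proof (rule lhopital_right_0[where g' = "\<lambda>\<eta>. 2 * \<eta>"
      and f' = "\<lambda>\<eta>. 2 * q (t + \<eta>) (t + \<eta>) - 2 * q (t + \<eta>) t"])
  have "((\<lambda>\<eta>. increment \<eta> t) \<longlongrightarrow> increment 0 t) (at 0 within {0..})"
  proof -
    have "continuous_on {0..} (\<lambda>\<eta>. increment \<eta> t)"
      unfolding increment_def using assms
      by (intro continuous_intros continuous_on_curve[OF cont_p]) (auto intro!: continuous_intros)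
    then show ?thesis
      by (auto simp: continuous_on_def)
  qed
  then have "((\<lambda>\<eta>. increment \<eta> t) \<longlongrightarrow> increment 0 t) (at_right 0)"
    by (rule tendsto_within_subset) auto
  then show "((\<lambda>\<eta>. increment \<eta> t) \<longlongrightarrow> 0) (at_right 0)"
    by (simp add: increment_def)
  show "((\<lambda>\<eta>::real. \<eta>\<^sup>2) \<longlongrightarrow> 0) (at_right 0)"
    by (rule tendsto_eq_intros | simp)+
  show "\<forall>\<^sub>F \<eta> in at_right 0. \<eta>\<^sup>2 \<noteq> (0::real)" "\<forall>\<^sub>F \<eta> in at_right 0. 2 * \<eta> \<noteq> (0::real)"
    by (auto simp: eventually_at_filter)
  show "\<forall>\<^sub>F \<eta> in at_right 0. ((\<lambda>\<eta>. \<eta>\<^sup>2) has_real_derivative 2 * \<eta>) (at \<eta>)"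
    by (auto intro!: always_eventually derivative_eq_intros)
  show "\<forall>\<^sub>F \<eta> in at_right 0. ((\<lambda>\<eta>. increment \<eta> t) has_real_derivative
      2 * q (t + \<eta>) (t + \<eta>) - 2 * q (t + \<eta>) t) (at \<eta>)"
    using eventually_at_right_less[of 0]
  proof eventually_elim
    case (elim \<eta>)
    have "((\<lambda>\<eta>. p (t + \<eta>) (t + \<eta>)) has_real_derivative q (t + \<eta>) (t + \<eta>) * 1 + q (t + \<eta>) (t + \<eta>) * 1) (at \<eta>)"
      by (rule has_derivative_along_curve[OF deriv_p deriv_p2 cont_q'])
        (use assms elim in \<open>auto intro!: derivative_eq_intros\<close>)
    moreover have "((\<lambda>\<eta>. p (t + \<eta>) t) has_real_derivative q (t + \<eta>) t * 1 + q t (t + \<eta>) * 0) (at \<eta>)"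
      by (rule has_derivative_along_curve[OF deriv_p deriv_p2 cont_q'])
        (use assms elim in \<open>auto intro!: derivative_eq_intros\<close>)
    ultimately show ?case
      unfolding increment_def by (auto intro!: derivative_eq_intros)
  qed
  have "isCont (\<lambda>z. (\<lambda>(t, s). m t s) z) (t, t)"
  proof -
    have "continuous_on ({0<..} \<times> {0<..}) (\<lambda>(t, s). m t s)"
      by (rule continuous_on_subset[OF cont_m]) auto
    then show ?thesis
      using assms by (simp add: continuous_on_eq_continuous_at open_Times)
  qed
  then have cont: "((\<lambda>(t, s). m t s) \<longlongrightarrow> m t t) (nhds (t, t))"
    unfolding isCont_def tendsto_at_iff_tendsto_nhds by simp
  have "\<exists>\<xi>. \<eta> > 0 \<longrightarrow> t < \<xi> \<and> \<xi> < t + \<eta> \<and> q (t + \<eta>) (t + \<eta>) - q (t + \<eta>) t = \<eta> * m (t + \<eta>) \<xi>" for \<eta>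
    using MVT2[of t "t + \<eta>" "q (t + \<eta>)" "m (t + \<eta>)"] deriv_q assms by force
  then obtain \<xi> where \<xi>: "\<eta> > 0 \<Longrightarrow> t < \<xi> \<eta> \<and> \<xi> \<eta> < t + \<eta> \<and>
      q (t + \<eta>) (t + \<eta>) - q (t + \<eta>) t = \<eta> * m (t + \<eta>) (\<xi> \<eta>)" for \<eta>
    by metis
  have lim_add: "((\<lambda>\<eta>. t + \<eta>) \<longlongrightarrow> t) (at_right 0)"
    by (rule tendsto_eq_intros | simp)+
  have "(\<xi> \<longlongrightarrow> t) (at_right 0)"
  proof (rule tendsto_sandwich[OF _ _ tendsto_const lim_add])
    show "\<forall>\<^sub>F \<eta> in at_right 0. t \<le> \<xi> \<eta>" "\<forall>\<^sub>F \<eta> in at_right 0. \<xi> \<eta> \<le> t + \<eta>"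
      using eventually_at_right_less[of 0] by (eventually_elim, use \<xi> in force)+
  qed
  then have "filterlim (\<lambda>\<eta>. (t + \<eta>, \<xi> \<eta>)) (nhds (t, t)) (at_right 0)"
    by (intro tendsto_Pair lim_add)
  then have "((\<lambda>\<eta>. m (t + \<eta>) (\<xi> \<eta>)) \<longlongrightarrow> m t t) (at_right 0)"
    using filterlim_compose[OF cont] by fastforce
  moreover have "\<forall>\<^sub>F \<eta> in at_right 0. m (t + \<eta>) (\<xi> \<eta>) = (2 * q (t + \<eta>) (t + \<eta>) - 2 * q (t + \<eta>) t) / (2 * \<eta>)"
    using eventually_at_right_less[of 0] by eventually_elim (use \<xi> in \<open>simp add: field_simps\<close>)
  ultimately show "((\<lambda>\<eta>. (2 * q (t + \<eta>) (t + \<eta>) - 2 * q (t + \<eta>) t) / (2 * \<eta>)) \<longlongrightarrow> m t t) (at_right 0)"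
    by (simp add: filterlim_cong[OF refl refl])
qed

definition energy_functional :: "real \<Rightarrow> real" where
  "energy_functional t = (m t t + \<kappa> * a t t + c * p t t) / 2"

lemma energy_functional_eq: "energy_functional t = m t t - lagrangian t t / 2"
  by (simp add: energy_functional_def lagrangian_def field_simps)

lemma cont_energy_functional: "continuous_on {0..} energy_functional"
  unfolding energy_functional_def
  by (intro continuous_intros continuous_on_curve[OF cont_p] continuous_on_curve[OF cont_a] continuous_on_curve[OF cont_m]) auto

text \<open>With w(t) = U(t + \<eta>) - U(t), the second difference of \<open>kernel_sum\<close> is
  2 (w', w) + \<beta> |w|_1^2 + \<alpha> ||w||^2. Subtracting an antiderivative \<open>Z\<close> of
  it from ||w||^2 leaves the derivative - \<beta> |w|_1^2 - \<alpha> ||w||^2, which Poincare's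
  inequality makes nonpositive. After division by \<eta>^2, ||w||^2 tends to \<open>m\<close> and
  \<open>Z\<close> to half the Lagrangian, and their difference is the energy.\<close>

lemma energy_functional_antimono_pos:
  assumes damp: "\<beta> * lam + \<alpha> \<ge> 0" and "0 < t1" "t1 \<le> t2"
  shows "energy_functional t2 \<le> energy_functional t1"
proof -
  define G where "G x = integral {0..x} profile" for x
  have G: "(G has_real_derivative profile y) (at y)" if "y > 0" for y
  proof -
    have "(G has_real_derivative profile y) (at y within {0..y + 1})"
      unfolding G_def
      by (rule integral_has_real_derivative) (use that continuous_on_subset[OF cont_profile] in auto)
    then show ?thesis
      using that at_within_Icc_at[of 0 y "y + 1"] by simp
  qed
  \<comment> \<open>\<open>G\<close> is an antiderivative of the profile. The factor 1 / 2 undoes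
    the inner derivative of 2 t, so that the derivative of \<open>Z \<eta>\<close> is the second
    difference of the profile.\<close>
  define Z where "Z \<eta> t = (G (2 * t + 2 * \<eta>) - 2 * G (2 * t + \<eta>) + G (2 * t)) / 2" for \<eta> t
  have Z_limit: "((\<lambda>\<eta>. Z \<eta> t / \<eta>\<^sup>2) \<longlongrightarrow> lagrangian t t / 2) (at_right 0)" if "t > 0" for t
    using tendsto_divide[OF second_difference_limit[OF G deriv_profile[OF that]] tendsto_const[of 2]] that
    by (simp add: Z_def mult.commute)
  have mono: "increment \<eta> t2 - Z \<eta> t2 \<le> increment \<eta> t1 - Z \<eta> t1" if "\<eta> > 0" for \<eta>
  proof (rule DERIV_nonpos_imp_nonincreasing[OF \<open>t1 \<le> t2\<close>])
    fix t assume "t1 \<le> t" "t \<le> t2"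
    then have t: "t > 0" using \<open>0 < t1\<close> by simp
    let ?q = "q (t + \<eta>) (t + \<eta>) - q (t + \<eta>) t - q t (t + \<eta>) + q t t"
    let ?V = "a (t + \<eta>) (t + \<eta>) - 2 * a (t + \<eta>) t + a t t"
    let ?\<Delta> = "profile (2 * t + 2 * \<eta>) - 2 * profile (2 * t + \<eta>) + profile (2 * t)"
    have dG: "((\<lambda>t. G (2 * t + k)) has_real_derivative profile (2 * t + k) * 2) (at t)" if "k \<ge> 0" for k
      by (intro DERIV_chain2[OF G]) (use that t in \<open>auto intro!: derivative_eq_intros\<close>)
    have dZ: "((\<lambda>t. Z \<eta> t) has_real_derivative ?\<Delta>) (at t)"
      unfolding Z_def using dG[of "2 * \<eta>"] dG[of \<eta>] dG[of 0] \<open>\<eta> > 0\<close>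
      by (auto intro!: derivative_eq_intros)
    have "?\<Delta> = kernel_sum (t + \<eta>) (t + \<eta>) - 2 * kernel_sum (t + \<eta>) t + kernel_sum t t"
      using t \<open>\<eta> > 0\<close> by (simp add: kernel_sum_eq_profile algebra_simps)
    also have "\<dots> = 2 * ?q + \<beta> * ?V + \<alpha> * increment \<eta> t"
      by (simp add: kernel_sum_def increment_def algebra_simps)
    finally have \<Delta>: "?\<Delta> = 2 * ?q + \<beta> * ?V + \<alpha> * increment \<eta> t" .
    have "lam * increment \<eta> t \<le> ?V"
      using coercive[of "t + \<eta>" t 1 "-1"] t \<open>\<eta> > 0\<close> by (simp add: increment_def algebra_simps)
    then have "\<beta> * (lam * increment \<eta> t) \<le> \<beta> * ?V"
      using nonneg(1) by (rule mult_left_mono)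
    moreover have "0 \<le> (\<beta> * lam + \<alpha>) * increment \<eta> t"
      using damp increment_nonneg[of \<eta> t] t \<open>\<eta> > 0\<close> by simp
    ultimately have "2 * ?q - ?\<Delta> \<le> 0"
      unfolding \<Delta> by (simp add: algebra_simps)
    then show "\<exists>D. ((\<lambda>t. increment \<eta> t - Z \<eta> t) has_real_derivative D) (at t) \<and> D \<le> 0"
      using DERIV_diff[OF deriv_increment[OF \<open>\<eta> > 0\<close> t] dZ] by blast
  qed
  have lim: "((\<lambda>\<eta>. increment \<eta> t / \<eta>\<^sup>2 - Z \<eta> t / \<eta>\<^sup>2) \<longlongrightarrow> energy_functional t) (at_right 0)" if "t > 0" for t
    unfolding energy_functional_eq by (intro tendsto_diff increment_limit Z_limit that)
  show ?thesis
  proof (rule tendsto_le[OF _ lim[of t1] lim[of t2]])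
    show "\<forall>\<^sub>F \<eta> in at_right 0. increment \<eta> t2 / \<eta>\<^sup>2 - Z \<eta> t2 / \<eta>\<^sup>2 \<le> increment \<eta> t1 / \<eta>\<^sup>2 - Z \<eta> t1 / \<eta>\<^sup>2"
      using eventually_at_right_less[of 0]
    proof eventually_elim
      case (elim \<eta>)
      then show ?case
        using divide_right_mono[OF mono, of \<eta> "\<eta>\<^sup>2"] by (simp add: diff_divide_distrib)
    qed
  qed (use assms in auto)
qed

lemma energy_functional_decreasing:
  assumes damp: "\<beta> * lam + \<alpha> \<ge> 0" and "0 \<le> t"
  shows "energy_functional t \<le> energy_functional 0"
proof (cases "t = 0")
  case False
  then have "t > 0" using assms by simp
  have "(energy_functional \<longlongrightarrow> energy_functional 0) (at 0 within {0..})"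
    using cont_energy_functional by (auto simp: continuous_on_def)
  then have lim: "(energy_functional \<longlongrightarrow> energy_functional 0) (at_right 0)"
    by (rule tendsto_within_subset) auto
  have "\<forall>\<^sub>F s in at_right 0. energy_functional t \<le> energy_functional s"
    using eventually_at_right_less[of 0] eventually_at_right_real[OF \<open>t > 0\<close>]
    by eventually_elim (use energy_functional_antimono_pos[OF damp] in auto)
  then show ?thesis
    using tendsto_lowerbound[OF lim] by simp
qed simp

end


text \<open>Once x(t) exceeds twice a scale L, each doubling of the time at least squares x / L - 1.
  Along t, 2 t, 4 t, ... this is growth at a fixed exponential rate, against \<open>subexp\<close>.
  The bound is free of \<open>B\<close>, which makes it uniform over all solutions.\<close>

lemma doubling_bound:
  fixes x :: "real \<Rightarrow> real"
  assumes nonneg: "\<And>t. t \<ge> 0 \<Longrightarrow> x t \<ge> 0" and "K \<ge> 0"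
    and doubling: "\<And>t. t \<ge> 0 \<Longrightarrow> (x t)\<^sup>2 \<le> K + x 0 * x (2 * t)"
    and subexp: "\<And>\<epsilon>. \<epsilon> > 0 \<Longrightarrow> \<exists>B. \<forall>t\<ge>0. x t \<le> B * exp (\<epsilon> * t)"
    and "t \<ge> 0"
  shows "x t \<le> 2 * (x 0 + sqrt K)"
proof (rule field_le_epsilon)
  fix e :: real assume "e > 0"
  \<comment> \<open>The summand e / 2 keeps \<open>L\<close> positive even if x 0 and K
    vanish.\<close>
  define L where "L = x 0 + sqrt K + e / 2"
  have L: "L > 0" "x 0 \<le> L" "K \<le> L\<^sup>2"
  proof -
    show "L > 0" "x 0 \<le> L"
      using nonneg[of 0] \<open>K \<ge> 0\<close> \<open>e > 0\<close> by (auto simp: L_def add_nonneg_pos)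
    have "(sqrt K)\<^sup>2 \<le> L\<^sup>2"
      using nonneg[of 0] \<open>K \<ge> 0\<close> \<open>e > 0\<close> by (intro power_mono) (auto simp: L_def)
    then show "K \<le> L\<^sup>2" using \<open>K \<ge> 0\<close> by simp
  qed
  have "x t \<le> 2 * L"
  proof (rule ccontr)
    assume large: "\<not> x t \<le> 2 * L"
    \<comment> \<open>In this normalization the hypothesis reads (w n + 1)^2 \<le> 2 + w (Suc n),
      which gives (w n)^2 \<le> w (Suc n) as long as w n \<ge> 1.\<close>
    define w where "w n = x (2 ^ n * t) / L - 1" for n :: nat
    have w0: "w 0 > 1"
      using large L(1) by (simp add: w_def field_simps)
    have step: "w (Suc n) \<ge> (w n)\<^sup>2" if "w n \<ge> 1" for n
    proof -
      have "(x (2 ^ n * t))\<^sup>2 \<le> K + x 0 * x (2 * (2 ^ n * t))"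
        using doubling[of "2 ^ n * t"] \<open>t \<ge> 0\<close> by simp
      also have "\<dots> \<le> L\<^sup>2 + L * x (2 * (2 ^ n * t))"
        using L nonneg[of "2 * (2 ^ n * t)"] \<open>t \<ge> 0\<close> by (intro add_mono mult_right_mono) auto
      finally have "(x (2 ^ n * t) / L)\<^sup>2 \<le> 1 + x (2 * (2 ^ n * t)) / L"
        using L(1) by (simp add: field_simps power2_eq_square)
      then have "(w n + 1)\<^sup>2 \<le> 2 + w (Suc n)"
        by (simp add: w_def mult.assoc)
      then show ?thesis
        using that by (simp add: power2_eq_square algebra_simps)
    qed
    have grow: "w n \<ge> w 0 ^ (2 ^ n)" for n
    proof (induction n)
      case (Suc n)
      have "1 \<le> w 0 ^ (2 ^ n)"
        using w0 by (simp add: one_le_power)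
      then have "w n \<ge> 1" using Suc by simp
      have "w 0 ^ 2 ^ Suc n = (w 0 ^ 2 ^ n)\<^sup>2"
        by (simp add: power_mult [symmetric] mult.commute)
      also have "\<dots> \<le> (w n)\<^sup>2"
        using Suc \<open>1 \<le> w 0 ^ (2 ^ n)\<close> by (intro power_mono) auto
      also have "\<dots> \<le> w (Suc n)"
        using step \<open>w n \<ge> 1\<close> by simp
      finally show ?case .
    qed simp
    have "t > 0"
    proof (rule ccontr)
      assume "\<not> t > 0"
      then have "t = 0" using \<open>t \<ge> 0\<close> by simp
      then have "x 0 > 2 * L" using large by simp
      then show False using L by linarith
    qed
    \<comment> \<open>Half of the exponential rate ln (w 0) / t that \<open>grow\<close>
      forces.\<close>
    define \<epsilon> where "\<epsilon> = ln (w 0) / (2 * t)"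
    have "\<epsilon> > 0" using w0 \<open>t > 0\<close> by (simp add: \<epsilon>_def)
    from subexp[OF this] obtain B where B: "\<And>t. t \<ge> 0 \<Longrightarrow> x t \<le> B * exp (\<epsilon> * t)"
      by blast
    define y where "y = exp (\<epsilon> * t)"
    have "y > 1" using \<open>\<epsilon> > 0\<close> \<open>t > 0\<close> by (simp add: y_def)
    have y2: "w 0 = y\<^sup>2"
    proof -
      have "y\<^sup>2 = exp (ln (w 0))"
        using \<open>t > 0\<close> unfolding y_def exp_double[symmetric] by (simp add: \<epsilon>_def)
      then show ?thesis using w0 by simp
    qed
    have "y ^ n \<le> B / L" if "n = 2 ^ k" for n k :: nat
    proof -
      have "(y ^ n) * (y ^ n) = w 0 ^ n"
        by (simp add: y2 power_mult_distrib power2_eq_square)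
      also have "\<dots> \<le> w k" using grow[of k] that by simp
      also have "\<dots> \<le> x (2 ^ k * t) / L" by (simp add: w_def)
      also have "\<dots> \<le> B * exp (\<epsilon> * (2 ^ k * t)) / L"
        using B[of "2 ^ k * t"] \<open>t \<ge> 0\<close> L(1) by (intro divide_right_mono) auto
      also have "exp (\<epsilon> * (2 ^ k * t)) = y ^ n"
        by (simp add: y_def that exp_of_nat_mult [symmetric] algebra_simps)
      finally have "y ^ n * y ^ n \<le> (B / L) * y ^ n" by simp
      moreover have "y ^ n > 0" using \<open>y > 1\<close> by simp
      ultimately show ?thesis
        by (simp only: mult_le_cancel_right_pos)
    qed
    then have bounded: "y ^ (2 ^ k) \<le> B / L" for k :: nat by simp
    obtain k where "B / L < y ^ k"
      using real_arch_pow[OF \<open>y > 1\<close>] by blast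
    also have "\<dots> \<le> y ^ (2 ^ k)"
      using \<open>y > 1\<close> by (intro power_increasing) (auto simp: less_imp_le)
    finally show False using bounded[of k] by simp
  qed
  then show "x t \<le> 2 * (x 0 + sqrt K) + e"
    by (simp add: L_def algebra_simps)
qed

section \<open>Exponential weights and decay of kernels\<close>

lemma weighted_kernel:
  assumes "damped_kernel p q m a \<alpha> \<beta> 1 0 lam"
  shows "damped_kernel (\<lambda>t s. exp (\<delta> * (t + s)) * p t s)
    (\<lambda>t s. exp (\<delta> * (t + s)) * (q t s + \<delta> * p t s))
    (\<lambda>t s. exp (\<delta> * (t + s)) * (m t s + \<delta> * q t s + \<delta> * q s t + \<delta>\<^sup>2 * p t s))
    (\<lambda>t s. exp (\<delta> * (t + s)) * a t s)
    (\<alpha> - 2 * \<delta>) \<beta> (1 - \<beta> * \<delta>) (\<delta> * (\<delta> - \<alpha>)) lam"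
proof -
  interpret damped_kernel p q m a \<alpha> \<beta> 1 0 lam by fact
  have cont_exp: "continuous_on ({0..} \<times> {0..}) (\<lambda>z :: real \<times> real. exp (\<delta> * (fst z + snd z)))"
    by (intro continuous_intros)
  note conts = cont_exp cont_p[unfolded case_prod_beta'] cont_q[unfolded case_prod_beta']
    cont_q'[unfolded case_prod_beta'] cont_m[unfolded case_prod_beta'] cont_a[unfolded case_prod_beta']
  have dexp1: "((\<lambda>t. exp (\<delta> * (t + s))) has_real_derivative \<delta> * exp (\<delta> * (t + s))) (at t)" for t s
    by (auto intro!: derivative_eq_intros)
  have dexp2: "((\<lambda>s. exp (\<delta> * (t + s))) has_real_derivative \<delta> * exp (\<delta> * (t + s))) (at s)" for t s
    by (auto intro!: derivative_eq_intros)
  have split: "exp (\<delta> * (t + s)) = exp (\<delta> * t) * exp (\<delta> * s)" for t s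
    by (simp add: distrib_left exp_add)
  show ?thesis
  proof
    show "continuous_on ({0..} \<times> {0..}) (\<lambda>(t, s). exp (\<delta> * (t + s)) * p t s)"
      "continuous_on ({0..} \<times> {0..}) (\<lambda>(t, s). exp (\<delta> * (t + s)) * (q t s + \<delta> * p t s))"
      "continuous_on ({0..} \<times> {0..}) (\<lambda>(t, s). exp (\<delta> * (t + s)) * (m t s + \<delta> * q t s + \<delta> * q s t + \<delta>\<^sup>2 * p t s))"
      "continuous_on ({0..} \<times> {0..}) (\<lambda>(t, s). exp (\<delta> * (t + s)) * a t s)"
      unfolding case_prod_beta' by (intro continuous_on_mult continuous_on_add continuous_on_const conts)+
  next
    fix t s :: real assume "t \<ge> 0" "s \<ge> 0"
    then show "exp (\<delta> * (s + t)) * p s t = exp (\<delta> * (t + s)) * p t s"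
      "exp (\<delta> * (s + t)) * (m s t + \<delta> * q s t + \<delta> * q t s + \<delta>\<^sup>2 * p s t) =
        exp (\<delta> * (t + s)) * (m t s + \<delta> * q t s + \<delta> * q s t + \<delta>\<^sup>2 * p t s)"
      "exp (\<delta> * (s + t)) * a s t = exp (\<delta> * (t + s)) * a t s"
      by (simp_all add: sym_p sym_m sym_a add.commute)
  next
    fix t s :: real assume "t > 0" "s > 0"
    show "((\<lambda>t. exp (\<delta> * (t + s)) * p t s) has_real_derivative
        exp (\<delta> * (t + s)) * (q t s + \<delta> * p t s)) (at t)"
      using DERIV_mult[OF dexp1[of s t] deriv_p[OF \<open>t > 0\<close> \<open>s > 0\<close>]] by (simp add: algebra_simps)
    show "((\<lambda>s. exp (\<delta> * (t + s)) * (q t s + \<delta> * p t s)) has_real_derivative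
        exp (\<delta> * (t + s)) * (m t s + \<delta> * q t s + \<delta> * q s t + \<delta>\<^sup>2 * p t s)) (at s)"
      using DERIV_mult[OF dexp2[of t s] DERIV_add[OF deriv_q[OF \<open>t > 0\<close> \<open>s > 0\<close>]
          DERIV_cmult[OF deriv_p2[OF \<open>t > 0\<close> \<open>s > 0\<close>], of \<delta>]]]
      by (simp add: algebra_simps power2_eq_square)
    have "((\<lambda>t. exp (\<delta> * (t + s)) * ((q t s + \<beta> * a t s) + \<delta> * p t s)) has_real_derivative
        \<delta> * exp (\<delta> * (t + s)) * ((q t s + \<beta> * a t s) + \<delta> * p t s) +
        ((- \<alpha> * q t s - 1 * a t s - 0 * p t s) + \<delta> * q t s) * exp (\<delta> * (t + s))) (at t)"
      by (rule DERIV_mult[OF dexp1 DERIV_add[OF evolution[OF \<open>t > 0\<close> \<open>s > 0\<close>]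
          DERIV_cmult[OF deriv_p[OF \<open>t > 0\<close> \<open>s > 0\<close>]]]])
    then show "((\<lambda>t. exp (\<delta> * (t + s)) * (q t s + \<delta> * p t s) + \<beta> * (exp (\<delta> * (t + s)) * a t s)) has_real_derivative
        - (\<alpha> - 2 * \<delta>) * (exp (\<delta> * (t + s)) * (q t s + \<delta> * p t s)) -
        (1 - \<beta> * \<delta>) * (exp (\<delta> * (t + s)) * a t s) - \<delta> * (\<delta> - \<alpha>) * (exp (\<delta> * (t + s)) * p t s)) (at t)"
      by (rule DERIV_cong[THEN DERIV_cong_ev[OF refl _ refl, THEN iffD1, rotated]])
        (auto simp: algebra_simps power2_eq_square)
  next
    fix t s x y z :: real assume "t \<ge> 0" "s \<ge> 0"
    \<comment> \<open>Since U' is the weight times u' + \<delta> u, the coefficient z of U'(t)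
      contributes \<delta> z to the coefficient of u(t).\<close>
    then show "0 \<le> x\<^sup>2 * (exp (\<delta> * (t + t)) * p t t) + y\<^sup>2 * (exp (\<delta> * (s + s)) * p s s) +
        z\<^sup>2 * (exp (\<delta> * (t + t)) * (m t t + \<delta> * q t t + \<delta> * q t t + \<delta>\<^sup>2 * p t t)) +
        2 * x * y * (exp (\<delta> * (t + s)) * p t s) +
        2 * x * z * (exp (\<delta> * (t + t)) * (q t t + \<delta> * p t t)) +
        2 * y * z * (exp (\<delta> * (t + s)) * (q t s + \<delta> * p t s))"
      using gram[of t s "exp (\<delta> * t) * (x + \<delta> * z)" "exp (\<delta> * s) * y" "exp (\<delta> * t) * z"]
      unfolding split by (simp add: algebra_simps power2_eq_square)
    show "lam * (x\<^sup>2 * (exp (\<delta> * (t + t)) * p t t) + y\<^sup>2 * (exp (\<delta> * (s + s)) * p s s) +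
          2 * x * y * (exp (\<delta> * (t + s)) * p t s))
        \<le> x\<^sup>2 * (exp (\<delta> * (t + t)) * a t t) + y\<^sup>2 * (exp (\<delta> * (s + s)) * a s s) +
          2 * x * y * (exp (\<delta> * (t + s)) * a t s)"
      using coercive[OF \<open>t \<ge> 0\<close> \<open>s \<ge> 0\<close>, of "exp (\<delta> * t) * x" "exp (\<delta> * s) * y"]
      unfolding split by (simp add: algebra_simps power2_eq_square)
  qed (use nonneg in auto)
qed


text \<open>\<open>lower\<close>, read with x = ||U||^2 and y = |U|_1^2, says that the potential
  part of the weighted energy controls |U|_1^2. \<open>D\<close> dominates \<delta>, so that the
  constant depends on \<delta> only through \<open>c0\<close>. Its two long factors come from
  bounding the weighted energy at time 0 and from recovering u' from u' + \<delta> u at time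
  t.\<close>

lemma nondegenerate_decay:
  assumes kernel: "damped_kernel p q m a \<alpha> \<beta> 1 0 lam"
    and "\<alpha> \<ge> 0" and \<delta>: "0 < \<delta>" "\<delta> \<le> (\<alpha> + \<beta> * lam) / 2" and D: "\<delta> \<le> D"
    and c0: "0 < c0" "c0 \<le> 1"
    and lower: "\<And>x y. 0 \<le> x \<Longrightarrow> lam * x \<le> y \<Longrightarrow>
      c0 * y \<le> (1 - \<beta> * \<delta>) * y + \<delta> * (\<delta> - \<alpha>) * x"
    and "t \<ge> 0"
  shows "m t t + a t t \<le> (2 * D\<^sup>2 / lam + D * (D + \<alpha>) / lam + 3) * (2 * D\<^sup>2 / lam + 3) / c0 *
    exp (- 2 * \<delta> * t) * (m 0 0 + a 0 0)"
proof -
  interpret K: damped_kernel p q m a \<alpha> \<beta> 1 0 lam by fact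
  interpret W: damped_kernel "\<lambda>t s. exp (\<delta> * (t + s)) * p t s"
    "\<lambda>t s. exp (\<delta> * (t + s)) * (q t s + \<delta> * p t s)"
    "\<lambda>t s. exp (\<delta> * (t + s)) * (m t s + \<delta> * q t s + \<delta> * q s t + \<delta>\<^sup>2 * p t s)"
    "\<lambda>t s. exp (\<delta> * (t + s)) * a t s"
    "\<alpha> - 2 * \<delta>" \<beta> "1 - \<beta> * \<delta>" "\<delta> * (\<delta> - \<alpha>)" lam
    by (rule weighted_kernel) fact
  let ?K1 = "2 * D\<^sup>2 / lam + D * (D + \<alpha>) / lam + 3" and ?K2 = "2 * D\<^sup>2 / lam + 3"
  \<comment> \<open>The squared norms of u' + \<delta> u at the times t and 0, that is, of U' with
    the weight removed.\<close>
  let ?v = "m t t + 2 * \<delta> * q t t + \<delta>\<^sup>2 * p t t" and ?w = "m 0 0 + 2 * \<delta> * q 0 0 + \<delta>\<^sup>2 * p 0 0"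
  have lam: "lam > 0" and "\<beta> \<ge> 0" using K.nonneg by auto
  have "D > 0" using \<delta> D by simp
  have \<delta>D: "\<delta>\<^sup>2 \<le> D\<^sup>2" using \<delta> D by (simp add: power_mono)
  have p_le: "p s s \<le> a s s / lam" if "s \<ge> 0" for s
    using K.poincare[OF that] lam by (simp add: field_simps)
  have \<delta>p: "\<delta>\<^sup>2 * p s s \<le> D\<^sup>2 / lam * a s s" if "s \<ge> 0" for s
  proof -
    have "\<delta>\<^sup>2 * p s s \<le> D\<^sup>2 * (a s s / lam)"
      using \<delta>D p_le[OF that] K.p_nonneg[OF that] by (intro mult_mono) auto
    then show ?thesis by simp
  qed
  have v0: "?v \<ge> 0"
    using K.gram[of t t \<delta> 0 1] \<open>t \<ge> 0\<close> by (simp add: algebra_simps)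
  have pos: "m 0 0 \<ge> 0" "a 0 0 \<ge> 0" "a t t \<ge> 0" "p 0 0 \<ge> 0"
    using K.m_nonneg K.a_nonneg K.p_nonneg \<open>t \<ge> 0\<close> by auto
  \<comment> \<open>The difference of the two sides is the squared norm of u' + 2 \<delta>
    u.\<close>
  have "m t t \<le> 2 * ?v + 2 * (\<delta>\<^sup>2 * p t t)"
    using K.gram[of t t "2 * \<delta>" 0 1] \<open>t \<ge> 0\<close> by (simp add: algebra_simps power2_eq_square)
  also have "\<dots> \<le> 2 * ?v + 2 * (D\<^sup>2 / lam * a t t)"
    using \<delta>p[OF \<open>t \<ge> 0\<close>] by linarith
  finally have "m t t + a t t \<le> 2 * ?v + (2 * D\<^sup>2 / lam + 1) * a t t"
    by (simp add: algebra_simps)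
  also have "\<dots> \<le> ?K2 * ?v + ?K2 * a t t"
    using v0 pos lam by (intro add_mono mult_right_mono) auto
  also have "\<dots> \<le> ?K2 / c0 * (?v + c0 * a t t)"
  proof -
    have "c0 * ?v \<le> 1 * ?v" using c0 v0 by (intro mult_right_mono) auto
    moreover have "?K2 \<ge> 0" using lam by simp
    ultimately have "?K2 * (c0 * ?v + c0 * a t t) \<le> ?K2 * (?v + c0 * a t t)"
      by (intro mult_left_mono) auto
    then show ?thesis using c0 by (simp add: field_simps)
  qed
  finally have upper: "m t t + a t t \<le> ?K2 / c0 * (?v + c0 * a t t)" .
  have "exp (2 * \<delta> * t) * (?v + c0 * a t t) \<le>
      exp (2 * \<delta> * t) * (?v + ((1 - \<beta> * \<delta>) * a t t + \<delta> * (\<delta> - \<alpha>) * p t t))"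
    using lower[OF K.p_nonneg K.poincare] \<open>t \<ge> 0\<close> by (intro mult_left_mono add_left_mono) auto
  also have "\<dots> = 2 * W.energy_functional t"
    by (simp only: W.energy_functional_def) (simp add: algebra_simps)
  also have "\<dots> \<le> 2 * W.energy_functional 0"
    using W.energy_functional_decreasing[OF _ \<open>t \<ge> 0\<close>] \<delta> by simp
  also have "\<dots> = ?w + (1 - \<beta> * \<delta>) * a 0 0 + \<delta> * (\<delta> - \<alpha>) * p 0 0"
    by (simp only: W.energy_functional_def) (simp add: field_simps)
  also have "\<dots> \<le> (2 * m 0 0 + 2 * (D\<^sup>2 / lam * a 0 0)) + 1 * a 0 0 + (D * (D + \<alpha>)) * (a 0 0 / lam)"
  proof -
    have "?w \<le> 2 * m 0 0 + 2 * (\<delta>\<^sup>2 * p 0 0)"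
      using K.gram[of 0 0 \<delta> 0 "-1"] by (simp add: algebra_simps)
    then have w: "?w \<le> 2 * m 0 0 + 2 * (D\<^sup>2 / lam * a 0 0)"
      using \<delta>p[of 0] by linarith
    have "\<delta> * (\<delta> - \<alpha>) \<le> \<delta> * (D + \<alpha>)"
      using \<delta> D \<open>\<alpha> \<ge> 0\<close> by (intro mult_left_mono) auto
    also have "\<dots> \<le> D * (D + \<alpha>)"
      using \<delta> D \<open>\<alpha> \<ge> 0\<close> by (intro mult_right_mono) auto
    finally have "\<delta> * (\<delta> - \<alpha>) * p 0 0 \<le> (D * (D + \<alpha>)) * (a 0 0 / lam)"
      by (rule mult_mono) (use pos p_le[of 0] \<open>\<alpha> \<ge> 0\<close> \<open>D > 0\<close> in auto)
    moreover have "(1 - \<beta> * \<delta>) * a 0 0 \<le> 1 * a 0 0"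
      using pos \<delta> \<open>\<beta> \<ge> 0\<close> by (intro mult_right_mono) auto
    ultimately show ?thesis using w by linarith
  qed
  also have "\<dots> = 2 * m 0 0 + (2 * D\<^sup>2 / lam + 1 + D * (D + \<alpha>) / lam) * a 0 0"
    by (simp add: algebra_simps add_divide_distrib)
  also have "\<dots> \<le> ?K1 * m 0 0 + ?K1 * a 0 0"
  proof -
    have "2 * D\<^sup>2 / lam \<ge> 0" "D * (D + \<alpha>) / lam \<ge> 0"
      using lam \<open>D > 0\<close> \<open>\<alpha> \<ge> 0\<close> by simp_all
    then show ?thesis
      using pos by (intro add_mono[of "2 * m 0 0"] mult_right_mono) linarith+
  qed
  also have "\<dots> = ?K1 * (m 0 0 + a 0 0)"
    by (simp only: distrib_left)
  finally have "exp (2 * \<delta> * t) * (?v + c0 * a t t) \<le> ?K1 * (m 0 0 + a 0 0)" .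
  moreover have "x \<le> exp (- 2 * \<delta> * t) * y" if "exp (2 * \<delta> * t) * x \<le> y" for x y
    using that by (simp add: exp_minus field_simps)
  ultimately have "?v + c0 * a t t \<le> exp (- 2 * \<delta> * t) * (?K1 * (m 0 0 + a 0 0))"
    by blast
  then have "?K2 / c0 * (?v + c0 * a t t) \<le> ?K2 / c0 * (exp (- 2 * \<delta> * t) * (?K1 * (m 0 0 + a 0 0)))"
    using c0 lam by (intro mult_left_mono) auto
  also have "\<dots> = ?K1 * ?K2 / c0 * exp (- 2 * \<delta> * t) * (m 0 0 + a 0 0)"
    by (simp only: times_divide_eq_left times_divide_eq_right mult.assoc mult.left_commute mult.commute)
  finally show ?thesis using upper by linarith
qed

text \<open>With \<kappa> = 0 the energy bounds \<open>m\<close> and \<open>p\<close> but not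
  \<open>a\<close>. Equating \<open>kernel_sum\<close> at (s, s) and (2 s, 0) expresses \<beta> a(s,
  s) by \<beta> a(2 s, 0) and bounded terms, and Cauchy-Schwarz for \<open>a\<close> yields the
  recursion of \<open>doubling_bound\<close> for the square root of a(s, s).\<close>

lemma degenerate_bound:
  assumes kernel: "damped_kernel p q m a \<alpha> \<beta> 0 c lam"
    and damp: "\<beta> * lam + \<alpha> \<ge> 0" and "\<beta> > 0" "c > 0"
    and subexp: "\<And>\<epsilon>. \<epsilon> > 0 \<Longrightarrow> \<exists>B. \<forall>t\<ge>0. a t t \<le> B * exp (\<epsilon> * t)"
    and "t \<ge> 0"
  shows "a t t \<le> 8 * (a 0 0 + (4 * (1 + 1 / c) + 4 * \<bar>\<alpha>\<bar> / c) / \<beta> * ((m 0 0 + c * p 0 0) / 2))"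
proof -
  interpret damped_kernel p q m a \<alpha> \<beta> 0 c lam by fact
  \<comment> \<open>Four terms in \<open>q\<close>, each at most (1 + 1 / c) F(0), and two terms
    \<alpha> p, each at most 2 |\<alpha>| F(0) / c, all divided by \<beta>.\<close>
  define k where "k = (4 * (1 + 1 / c) + 4 * \<bar>\<alpha>\<bar> / c) / \<beta>"
  have "k \<ge> 0" using \<open>\<beta> > 0\<close> \<open>c > 0\<close> by (simp add: k_def)
  have F0: "energy_functional 0 = (m 0 0 + c * p 0 0) / 2" by (simp add: energy_functional_def)
  have "energy_functional 0 \<ge> 0" using m_nonneg[of 0] p_nonneg[of 0] \<open>c > 0\<close> by (simp add: F0)
  have m_le: "m s s \<le> 2 * energy_functional 0" and p_le: "p s s \<le> 2 * energy_functional 0 / c" if "s \<ge> 0" for s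
    using energy_functional_decreasing[OF damp that] m_nonneg[OF that] p_nonneg[OF that] \<open>c > 0\<close>
    by (auto simp: energy_functional_def field_simps)
      (smt (verit) mult_nonneg_nonneg)
  have q_le: "\<bar>q r s\<bar> \<le> (1 + 1 / c) * energy_functional 0" if "r \<ge> 0" "s \<ge> 0" for r s
    using q_bound[OF that] m_le[OF that(1)] p_le[OF that(2)] by (simp add: algebra_simps)
  have \<alpha>p_le: "\<bar>\<alpha> * p r s\<bar> \<le> \<bar>\<alpha>\<bar> * (2 * energy_functional 0 / c)" if "r \<ge> 0" "s \<ge> 0" for r s
    using p_bound[OF that] p_le[OF that(1)] p_le[OF that(2)]
    unfolding abs_mult by (intro mult_left_mono) auto
  have main: "a s s \<le> k * energy_functional 0 + sqrt (a 0 0) * sqrt (a (2 * s) (2 * s))" if "s \<ge> 0" for s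
  proof -
    have "kernel_sum s s = kernel_sum (2 * s) 0"
      using that by (simp add: kernel_sum_eq_profile)
    then have "\<beta> * a s s = \<beta> * a (2 * s) 0 + q (2 * s) 0 + q 0 (2 * s) + \<alpha> * p (2 * s) 0
        - 2 * q s s - \<alpha> * p s s"
      by (simp add: kernel_sum_def)
    also have "\<dots> \<le> \<beta> * a (2 * s) 0 + 4 * ((1 + 1 / c) * energy_functional 0) + 2 * (\<bar>\<alpha>\<bar> * (2 * energy_functional 0 / c))"
      using q_le[of "2 * s" 0] q_le[of 0 "2 * s"] q_le[of s s] \<alpha>p_le[of "2 * s" 0] \<alpha>p_le[of s s] that
      by (auto simp: abs_le_iff)
    also have "\<dots> = \<beta> * (a (2 * s) 0 + k * energy_functional 0)"
      using \<open>\<beta> > 0\<close> by (simp add: k_def field_simps)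
    finally have "a s s \<le> a (2 * s) 0 + k * energy_functional 0"
      using \<open>\<beta> > 0\<close> by simp
    then show ?thesis
      using a_cauchy_schwarz[of "2 * s" 0] that by (simp add: mult.commute)
  qed
  have "sqrt (a t t) \<le> 2 * (sqrt (a 0 0) + sqrt (k * energy_functional 0))"
  proof (rule doubling_bound[where x = "\<lambda>t. sqrt (a t t)"])
    show "\<exists>B. \<forall>t\<ge>0. sqrt (a t t) \<le> B * exp (\<epsilon> * t)" if "\<epsilon> > 0" for \<epsilon>
    proof -
      have "\<exists>B. \<forall>t\<ge>0. a t t \<le> B * exp (2 * \<epsilon> * t)"
        using subexp[of "2 * \<epsilon>"] that by simp
      then obtain B where B: "\<And>t. t \<ge> 0 \<Longrightarrow> a t t \<le> B * exp (2 * \<epsilon> * t)"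
        by blast
      have "sqrt (a t t) \<le> sqrt B * exp (\<epsilon> * t)" if "t \<ge> 0" for t
      proof -
        have "sqrt (a t t) \<le> sqrt (B * (exp (\<epsilon> * t))\<^sup>2)"
          using B[OF that] by (simp add: exp_double[symmetric] mult.assoc)
        then show ?thesis by (simp add: real_sqrt_mult)
      qed
      then show ?thesis by blast
    qed
  qed (use main a_nonneg \<open>k \<ge> 0\<close> \<open>energy_functional 0 \<ge> 0\<close> \<open>t \<ge> 0\<close> in auto)
  then have "(sqrt (a t t))\<^sup>2 \<le> (2 * (sqrt (a 0 0) + sqrt (k * energy_functional 0)))\<^sup>2"
    using a_nonneg[OF \<open>t \<ge> 0\<close>] by (intro power_mono) auto
  also have "\<dots> \<le> 8 * ((sqrt (a 0 0))\<^sup>2 + (sqrt (k * energy_functional 0))\<^sup>2)"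
    using zero_le_power2[of "sqrt (a 0 0) - sqrt (k * energy_functional 0)"]
    by (simp add: power2_eq_square algebra_simps)
  also have "\<dots> = 8 * (a 0 0 + k * energy_functional 0)"
    using a_nonneg[of 0] \<open>k \<ge> 0\<close> \<open>energy_functional 0 \<ge> 0\<close> by simp
  finally show ?thesis
    using a_nonneg[OF \<open>t \<ge> 0\<close>] unfolding F0 k_def by simp
qed


text \<open>Subexponential growth of |U|_1^2 comes from the nondegenerate estimate for \<delta>' <
  \<delta>. Its constant blows up as \<delta>' approaches \<delta>, but
  \<open>degenerate_bound\<close> uses it only qualitatively, so the final constant is uniform. The
  assumption \<alpha> < \<delta> makes the zero-order coefficient \<open>c\<close> positive.\<close>

lemma degenerate_decay:
  assumes "\<alpha> \<ge> 0" "\<beta> \<ge> 0" "lam > 0" and \<beta>\<delta>: "\<beta> * \<delta> = 1" and \<delta>: "\<alpha> < \<delta>" "\<delta> \<le> (\<alpha> + \<beta> * lam) / 2"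
  shows "\<exists>C>0. \<forall>p q m a. damped_kernel p q m a \<alpha> \<beta> 1 0 lam \<longrightarrow>
    (\<forall>t\<ge>0. m t t + a t t \<le> C * exp (- 2 * \<delta> * t) * (m 0 0 + a 0 0))"
proof -
  have "\<beta> > 0" using \<beta>\<delta> \<open>\<beta> \<ge> 0\<close> by (cases "\<beta> = 0") auto
  have "\<delta> > 0" using \<delta> \<open>\<alpha> \<ge> 0\<close> by simp
  define c where "c = \<delta> * (\<delta> - \<alpha>)"
  have "c > 0" using \<delta> \<open>\<delta> > 0\<close> by (simp add: c_def)
  define k where "k = (4 * (1 + 1 / c) + 4 * \<bar>\<alpha> - 2 * \<delta>\<bar> / c) / \<beta>"
  have "k \<ge> 0" using \<open>c > 0\<close> \<open>\<beta> > 0\<close> by (simp add: k_def)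
  define K where "K = 1 + \<delta>\<^sup>2 / lam + c / (2 * lam)"
  have "K > 0" using \<open>c > 0\<close> \<open>lam > 0\<close> by (simp add: K_def add_pos_nonneg)
  let ?d = "2 * \<delta>\<^sup>2 / lam + 1"
  define C where "C = 4 * K + ?d * (8 * (1 + k * K))"
  have "C > 0" using \<open>K > 0\<close> \<open>k \<ge> 0\<close> \<open>lam > 0\<close> by (simp add: C_def add_pos_nonneg)
  have decay: "m t t + a t t \<le> C * exp (- 2 * \<delta> * t) * (m 0 0 + a 0 0)"
    if kernel: "damped_kernel p q m a \<alpha> \<beta> 1 0 lam" and "t \<ge> 0" for p q m a t
  proof -
    interpret K: damped_kernel p q m a \<alpha> \<beta> 1 0 lam by fact
    let ?P = "\<lambda>t s. exp (\<delta> * (t + s)) * p t s" and ?Q = "\<lambda>t s. exp (\<delta> * (t + s)) * (q t s + \<delta> * p t s)"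
      and ?M = "\<lambda>t s. exp (\<delta> * (t + s)) * (m t s + \<delta> * q t s + \<delta> * q s t + \<delta>\<^sup>2 * p t s)"
      and ?A = "\<lambda>t s. exp (\<delta> * (t + s)) * a t s"
    have weighted: "damped_kernel ?P ?Q ?M ?A (\<alpha> - 2 * \<delta>) \<beta> 0 c lam"
      using weighted_kernel[OF kernel, of \<delta>] \<beta>\<delta> by (simp add: c_def)
    interpret W: damped_kernel ?P ?Q ?M ?A "\<alpha> - 2 * \<delta>" \<beta> 0 c lam by fact
    have p_le: "p s s \<le> a s s / lam" if "s \<ge> 0" for s
      using K.poincare[OF that] \<open>lam > 0\<close> by (simp add: field_simps)
    have pos: "m 0 0 \<ge> 0" "a 0 0 \<ge> 0" "a t t \<ge> 0" "p 0 0 \<ge> 0"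
      using K.m_nonneg K.a_nonneg K.p_nonneg \<open>t \<ge> 0\<close> by auto
    have subexp: "\<exists>B. \<forall>t\<ge>0. ?A t t \<le> B * exp (\<epsilon> * t)" if "\<epsilon> > 0" for \<epsilon>
    proof -
      \<comment> \<open>Close enough to \<delta> that the squared weights differ by a factor of at
        most exp (\<epsilon> t), yet above \<alpha>, so that the zero-order term stays
        nonnegative.\<close>
      define \<delta>' where "\<delta>' = max ((\<alpha> + \<delta>) / 2) (\<delta> - \<epsilon> / 2)"
      have \<delta>': "\<alpha> < \<delta>'" "\<delta>' < \<delta>" "2 * \<delta> - 2 * \<delta>' \<le> \<epsilon>"
        using \<delta> that by (auto simp: \<delta>'_def max_def field_simps)
      have "\<delta>' > 0" using \<delta>' \<open>\<alpha> \<ge> 0\<close> by simp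
      have "\<beta> * \<delta>' < 1"
        using \<delta>'(2) \<open>\<beta> > 0\<close> \<beta>\<delta> mult_strict_left_mono[of \<delta>' \<delta> \<beta>] by simp
      define c0 where "c0 = 1 - \<beta> * \<delta>'"
      have c0: "0 < c0" "c0 \<le> 1"
        using \<open>\<beta> * \<delta>' < 1\<close> \<open>\<beta> > 0\<close> \<open>\<delta>' > 0\<close> by (auto simp: c0_def)
      define B where "B = (2 * \<delta>\<^sup>2 / lam + \<delta> * (\<delta> + \<alpha>) / lam + 3) * (2 * \<delta>\<^sup>2 / lam + 3) / c0 * (m 0 0 + a 0 0)"
      have "B \<ge> 0" using pos \<open>lam > 0\<close> \<open>\<delta> > 0\<close> c0 \<open>\<alpha> \<ge> 0\<close> by (simp add: B_def)
      have "?A s s \<le> B * exp (\<epsilon> * s)" if "s \<ge> 0" for s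
      proof -
        have "m s s + a s s \<le> (2 * \<delta>\<^sup>2 / lam + \<delta> * (\<delta> + \<alpha>) / lam + 3) * (2 * \<delta>\<^sup>2 / lam + 3) / c0 *
          exp (- 2 * \<delta>' * s) * (m 0 0 + a 0 0)"
        proof (rule nondegenerate_decay[OF kernel \<open>\<alpha> \<ge> 0\<close>])
          fix x y :: real assume "0 \<le> x"
          then show "c0 * y \<le> (1 - \<beta> * \<delta>') * y + \<delta>' * (\<delta>' - \<alpha>) * x"
            using \<delta>' \<open>\<delta>' > 0\<close> by (simp add: c0_def)
        qed (use \<delta>' \<open>\<delta>' > 0\<close> \<delta> c0 that in auto)
        then have "a s s \<le> B * exp (- 2 * \<delta>' * s)"
          using K.m_nonneg[OF that] by (simp add: B_def algebra_simps)
        then have "?A s s \<le> exp (\<delta> * (s + s)) * (B * exp (- 2 * \<delta>' * s))"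
          by simp
        also have "\<dots> = B * exp ((2 * \<delta> - 2 * \<delta>') * s)"
          by (simp add: algebra_simps flip: exp_add)
        also have "\<dots> \<le> B * exp (\<epsilon> * s)"
          using \<open>B \<ge> 0\<close> \<delta>'(3) that by (intro mult_left_mono) (auto intro: mult_right_mono)
        finally show ?thesis .
      qed
      then show ?thesis by blast
    qed
    define F0 where "F0 = (?M 0 0 + c * ?P 0 0) / 2"
    have A_le: "?A t t \<le> 8 * (a 0 0 + k * F0)"
      using degenerate_bound[OF weighted _ \<open>\<beta> > 0\<close> \<open>c > 0\<close> subexp \<open>t \<ge> 0\<close>] \<delta>
      by (simp add: k_def F0_def)
    have F0_le: "F0 \<le> K * (m 0 0 + a 0 0)"
    proof -
      have "F0 = (m 0 0 + 2 * \<delta> * q 0 0 + \<delta>\<^sup>2 * p 0 0 + c * p 0 0) / 2"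
        by (simp add: F0_def)
      also have "\<dots> \<le> m 0 0 + \<delta>\<^sup>2 * p 0 0 + c * p 0 0 / 2"
        using K.gram[of 0 0 \<delta> 0 "-1"] by (simp add: field_simps)
      also have "\<dots> \<le> m 0 0 + \<delta>\<^sup>2 * (a 0 0 / lam) + c * (a 0 0 / lam) / 2"
        using p_le[of 0] \<open>c > 0\<close> by (intro add_mono mult_left_mono divide_right_mono) auto
      also have "\<dots> = 1 * m 0 0 + (\<delta>\<^sup>2 / lam + c / (2 * lam)) * a 0 0"
        by (simp add: algebra_simps)
      also have "\<dots> \<le> K * m 0 0 + K * a 0 0"
        using pos \<open>c > 0\<close> \<open>lam > 0\<close> by (intro add_mono mult_right_mono) (auto simp: K_def)
      finally show ?thesis by (simp add: algebra_simps)
    qed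
    let ?v = "m t t + 2 * \<delta> * q t t + \<delta>\<^sup>2 * p t t"
    have v_le: "exp (2 * \<delta> * t) * ?v \<le> 2 * F0"
    proof -
      have "?M t t + c * ?P t t \<le> ?M 0 0 + c * ?P 0 0"
        using W.energy_functional_decreasing[OF _ \<open>t \<ge> 0\<close>] \<delta> by (simp add: W.energy_functional_def)
      moreover have "c * ?P t t \<ge> 0"
        using \<open>c > 0\<close> W.p_nonneg[OF \<open>t \<ge> 0\<close>] by simp
      moreover have "?M t t = exp (2 * \<delta> * t) * ?v"
        by (simp add: algebra_simps)
      ultimately show ?thesis by (simp add: F0_def)
    qed
    have "m t t \<le> 2 * ?v + 2 * (\<delta>\<^sup>2 * p t t)"
      using K.gram[of t t "2 * \<delta>" 0 1] \<open>t \<ge> 0\<close> by (simp add: algebra_simps power2_eq_square)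
    also have "\<dots> \<le> 2 * ?v + 2 * (\<delta>\<^sup>2 * (a t t / lam))"
      by (intro add_left_mono mult_left_mono p_le \<open>t \<ge> 0\<close>) auto
    finally have "m t t + a t t \<le> 2 * ?v + ?d * a t t"
      by (simp add: algebra_simps)
    then have "exp (2 * \<delta> * t) * (m t t + a t t) \<le> exp (2 * \<delta> * t) * (2 * ?v + ?d * a t t)"
      by simp
    also have "\<dots> = 2 * (exp (2 * \<delta> * t) * ?v) + ?d * ?A t t"
      by (simp add: algebra_simps)
    also have "\<dots> \<le> 2 * (2 * F0) + ?d * (8 * (a 0 0 + k * F0))"
      using v_le A_le \<open>lam > 0\<close> by (intro add_mono mult_left_mono) auto
    also have "\<dots> \<le> 2 * (2 * (K * (m 0 0 + a 0 0))) +
        ?d * (8 * ((m 0 0 + a 0 0) + k * (K * (m 0 0 + a 0 0))))"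
      using F0_le pos \<open>k \<ge> 0\<close> \<open>lam > 0\<close> by (intro add_mono mult_left_mono) auto
    also have "\<dots> = C * (m 0 0 + a 0 0)"
      unfolding C_def by (simp only: distrib_left distrib_right mult.assoc mult_1_left mult_1_right)
    finally show ?thesis
      by (simp add: exp_minus field_simps)
  qed
  show ?thesis using \<open>C > 0\<close> decay by blast
qed

text \<open>One constant has to serve all \<delta>, so 1 - \<beta> \<delta> must stay away from 0.
  Under \<delta> \<le> lam / (\<alpha> + \<beta> lam) and \<delta> \<le> (\<alpha> + \<beta> lam) /
  2 this can fail only if \<alpha> = 0 and \<beta>^2 lam \<ge> 2. In that case the degenerate rate 1
  / \<beta> is itself attained and implies all smaller rates.\<close>

theorem kernel_decay:
  assumes damping: "(\<alpha> > 0 \<and> \<beta> \<ge> 0) \<or> (\<alpha> \<ge> 0 \<and> \<beta> > 0)" and lam: "lam > 0"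
  shows "\<exists>C>0. \<forall>p q m a \<delta>. damped_kernel p q m a \<alpha> \<beta> 1 0 lam \<and>
    0 < \<delta> \<and> \<delta> \<le> (\<alpha> + \<beta> * lam) / 2 \<and>
    (\<delta> \<le> lam / (\<alpha> + \<beta> * lam) \<or> \<delta> = (\<alpha> + \<beta> * lam) / 2 \<and> \<delta>\<^sup>2 < lam \<and> \<beta> * \<delta> \<le> 1) \<longrightarrow>
    (\<forall>t\<ge>0. m t t + a t t \<le> C * exp (- 2 * \<delta> * t) * (m 0 0 + a 0 0))"
proof -
  define \<mu> where "\<mu> = \<alpha> + \<beta> * lam"
  have nn: "\<alpha> \<ge> 0" "\<beta> \<ge> 0" using damping by auto
  have "\<mu> > 0" using damping lam by (auto simp: \<mu>_def add_pos_nonneg add_nonneg_pos)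
  show ?thesis
  proof (cases "\<alpha> = 0 \<and> \<beta>\<^sup>2 * lam \<ge> 2")
    case True
    then have "\<beta> > 0" using damping by auto
    obtain C where "C > 0" and C: "\<And>p q m a t. damped_kernel p q m a \<alpha> \<beta> 1 0 lam \<Longrightarrow> t \<ge> 0 \<Longrightarrow>
        m t t + a t t \<le> C * exp (- 2 * (1 / \<beta>) * t) * (m 0 0 + a 0 0)"
      using degenerate_decay[of \<alpha> \<beta> lam "1 / \<beta>"] True \<open>\<beta> > 0\<close> lam
      by (auto simp: field_simps power2_eq_square)
    have "m t t + a t t \<le> C * exp (- 2 * \<delta> * t) * (m 0 0 + a 0 0)"
      if kernel: "damped_kernel p q m a \<alpha> \<beta> 1 0 lam" and "t \<ge> 0" and
        \<delta>: "\<delta> \<le> lam / (\<alpha> + \<beta> * lam) \<or> \<beta> * \<delta> \<le> 1" for p q m a \<delta> t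
    proof -
      interpret K: damped_kernel p q m a \<alpha> \<beta> 1 0 lam by fact
      have "\<delta> \<le> 1 / \<beta>"
        using \<delta> True lam \<open>\<beta> > 0\<close> by (auto simp: field_simps)
      then have "exp (- 2 * (1 / \<beta>) * t) \<le> exp (- 2 * \<delta> * t)"
        using \<open>t \<ge> 0\<close> mult_right_mono[of \<delta> "1 / \<beta>" t] by simp
      then have "C * exp (- 2 * (1 / \<beta>) * t) * (m 0 0 + a 0 0) \<le> C * exp (- 2 * \<delta> * t) * (m 0 0 + a 0 0)"
        using \<open>C > 0\<close> K.m_nonneg[of 0] K.a_nonneg[of 0] by (intro mult_right_mono mult_left_mono) auto
      with C[OF kernel \<open>t \<ge> 0\<close>] show ?thesis by linarith
    qed
    then show ?thesis using \<open>C > 0\<close> by blast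
  next
    case False
    define K where "K c0 = (2 * \<mu>\<^sup>2 / lam + \<mu> * (\<mu> + \<alpha>) / lam + 3) * (2 * \<mu>\<^sup>2 / lam + 3) / c0" for c0
    have K_pos: "K c0 > 0" if "c0 > 0" for c0
      using that \<open>\<mu> > 0\<close> lam nn unfolding K_def
      by (intro divide_pos_pos mult_pos_pos add_nonneg_pos add_nonneg_nonneg) auto
    \<comment> \<open>For \<delta> \<le> \<alpha> the zero-order term is nonpositive and is absorbed
      by Poincare's inequality. The number lam - \<delta> \<mu> + \<delta>^2 is the characteristic
      polynomial of the first mode at - \<delta>.\<close>
    have large_\<alpha>: "c0 * y \<le> (1 - \<beta> * \<delta>) * y + \<delta> * (\<delta> - \<alpha>) * x"
      if "\<delta> \<le> \<alpha>" "0 < \<delta>" "c0 * lam \<le> lam - \<delta> * \<mu> + \<delta>\<^sup>2" "lam * x \<le> y" "0 \<le> x" for c0 \<delta> x y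
    proof -
      have "\<delta> * (\<delta> - \<alpha>) * (lam * x) \<ge> \<delta> * (\<delta> - \<alpha>) * y"
        using that by (intro mult_left_mono_neg mult_nonneg_nonpos) auto
      moreover have "c0 * lam * y \<le> (lam - \<delta> * \<mu> + \<delta>\<^sup>2) * y"
      proof (rule mult_right_mono)
        have "0 \<le> lam * x" using lam that by simp
        then show "0 \<le> y" using that by simp
      qed fact
      ultimately have "lam * (c0 * y) \<le> lam * ((1 - \<beta> * \<delta>) * y + \<delta> * (\<delta> - \<alpha>) * x)"
        by (simp add: \<mu>_def algebra_simps power2_eq_square)
      then show ?thesis using lam by simp
    qed
    have small_\<alpha>: "c0 * y \<le> (1 - \<beta> * \<delta>) * y + \<delta> * (\<delta> - \<alpha>) * x"
      if "\<alpha> \<le> \<delta>" "0 < \<delta>" "c0 \<le> 1 - \<beta> * \<delta>" "lam * x \<le> y" "0 \<le> x" for c0 \<delta> x y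
    proof -
      have "0 \<le> lam * x" using lam that by simp
      then have "0 \<le> y" using that by simp
      then have "c0 * y \<le> (1 - \<beta> * \<delta>) * y" using that by (intro mult_right_mono)
      moreover have "\<delta> * (\<delta> - \<alpha>) * x \<ge> 0" using that by simp
      ultimately show ?thesis by linarith
    qed
    \<comment> \<open>A lower bound for 1 - \<beta> \<delta>: it comes from \<delta> \<le> lam /
      \<mu> if \<alpha> > 0 and from \<delta> \<le> \<mu> / 2 if \<alpha> = 0.\<close>
    define b where "b = (if \<alpha> > 0 then \<alpha> / \<mu> else 1 - \<beta>\<^sup>2 * lam / 2)"
    have b: "b > 0" using False nn \<open>\<mu> > 0\<close> by (auto simp: b_def)
    \<comment> \<open>The first two entries bound (lam - \<delta> \<mu> + \<delta>^2) / lam from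
      below: for \<delta> \<le> lam / (2 \<mu>) the part lam - \<delta> \<mu> is at least lam / 2,
      and beyond that \<delta>^2 alone suffices.\<close>
    define c1 where "c1 = min (min (1 / 2) (lam / (4 * \<mu>\<^sup>2))) b"
    have c1: "c1 > 0" "c1 \<le> 1" using b lam \<open>\<mu> > 0\<close> by (auto simp: c1_def)
    have first: "m t t + a t t \<le> K c1 * exp (- 2 * \<delta> * t) * (m 0 0 + a 0 0)"
      if kernel: "damped_kernel p q m a \<alpha> \<beta> 1 0 lam" and "t \<ge> 0" and
        \<delta>: "0 < \<delta>" "\<delta> \<le> \<mu> / 2" "\<delta> \<le> lam / \<mu>" for p q m a \<delta> t
      unfolding K_def
    proof (rule nondegenerate_decay[OF kernel])
      fix x y :: real assume xy: "0 \<le> x" "lam * x \<le> y"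
      show "c1 * y \<le> (1 - \<beta> * \<delta>) * y + \<delta> * (\<delta> - \<alpha>) * x"
      proof (cases "\<delta> \<le> \<alpha>")
        case True
        have "c1 * lam \<le> lam - \<delta> * \<mu> + \<delta>\<^sup>2"
        proof (cases "\<delta> \<le> lam / (2 * \<mu>)")
          case True
          then have "\<delta> * \<mu> \<le> lam / 2" using \<open>\<mu> > 0\<close> by (simp add: field_simps)
          moreover have "c1 * lam \<le> 1 / 2 * lam" using lam by (intro mult_right_mono) (auto simp: c1_def)
          moreover have "\<delta>\<^sup>2 \<ge> 0" by simp
          ultimately show ?thesis by linarith
        next
          case False
          have "c1 * lam \<le> lam / (4 * \<mu>\<^sup>2) * lam" using lam by (intro mult_right_mono) (auto simp: c1_def)
          also have "\<dots> = (lam / (2 * \<mu>))\<^sup>2" by (simp add: power2_eq_square)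
          also have "\<dots> \<le> \<delta>\<^sup>2" using False lam \<open>\<mu> > 0\<close> by (intro power_mono) auto
          also have "\<dots> \<le> lam - \<delta> * \<mu> + \<delta>\<^sup>2" using \<delta> \<open>\<mu> > 0\<close> by (simp add: field_simps)
          finally show ?thesis .
        qed
        then show ?thesis using large_\<alpha> True \<delta> xy by simp
      next
        case False
        have "b \<le> 1 - \<beta> * \<delta>"
        proof (cases "\<alpha> > 0")
          case True
          have "\<beta> * \<delta> \<le> \<beta> * (lam / \<mu>)" using \<delta> nn by (intro mult_left_mono) auto
          also have "\<dots> = 1 - \<alpha> / \<mu>" using \<open>\<mu> > 0\<close> by (simp add: \<mu>_def field_simps)
          finally show ?thesis using True by (simp add: b_def)
        next
          case False
          then have "\<alpha> = 0" using nn by simp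
          have "\<beta> * \<delta> \<le> \<beta> * (\<mu> / 2)" using \<delta> nn by (intro mult_left_mono) auto
          then show ?thesis using \<open>\<alpha> = 0\<close> by (simp add: b_def \<mu>_def power2_eq_square)
        qed
        then show ?thesis using small_\<alpha> False \<delta> xy by (simp add: c1_def)
      qed
    qed (use \<delta> c1 nn \<open>t \<ge> 0\<close> \<open>\<mu> > 0\<close> in \<open>auto simp: \<mu>_def\<close>)
    have "\<exists>C>0. \<forall>p q m a. damped_kernel p q m a \<alpha> \<beta> 1 0 lam \<longrightarrow>
      (\<forall>t\<ge>0. m t t + a t t \<le> C * exp (- 2 * (\<mu> / 2) * t) * (m 0 0 + a 0 0))"
      if \<delta>: "(\<mu> / 2)\<^sup>2 < lam" "\<beta> * (\<mu> / 2) \<le> 1"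
    proof (cases "\<beta> * (\<mu> / 2) = 1")
      case True
      \<comment> \<open>With \<delta> = \<mu> / 2 and \<beta> \<delta> = 1, the number \<beta> lam
        is lam / \<delta> > \<delta>, and \<alpha> + \<beta> lam = 2 \<delta>.\<close>
      have "\<alpha> < \<mu> / 2"
      proof (rule ccontr)
        assume "\<not> \<alpha> < \<mu> / 2"
        then have "\<beta> * lam \<le> \<mu> / 2" by (simp add: \<mu>_def)
        then have "(\<mu> / 2) * (\<beta> * lam) \<le> (\<mu> / 2) * (\<mu> / 2)"
          using \<open>\<mu> > 0\<close> by (intro mult_left_mono) auto
        moreover have "(\<mu> / 2) * (\<beta> * lam) = lam"
          using True by (metis mult.assoc mult.commute mult_1)
        ultimately show False using \<delta>(1) unfolding power2_eq_square by linarith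
      qed
      then show ?thesis
        using degenerate_decay[OF nn lam True] by (simp add: \<mu>_def)
    next
      case False
      \<comment> \<open>At \<delta> = \<mu> / 2 the characteristic polynomial of the first mode
        takes the value lam - \<delta>^2.\<close>
      define c2 where "c2 = min (1 - (\<mu> / 2)\<^sup>2 / lam) (1 - \<beta> * (\<mu> / 2))"
      have c2: "c2 > 0" "c2 \<le> 1"
        using False \<delta> lam \<open>\<mu> > 0\<close> nn by (auto simp: c2_def min_def)
      have "m t t + a t t \<le> K c2 * exp (- 2 * (\<mu> / 2) * t) * (m 0 0 + a 0 0)"
        if kernel: "damped_kernel p q m a \<alpha> \<beta> 1 0 lam" and "t \<ge> 0" for p q m a t
        unfolding K_def
      proof (rule nondegenerate_decay[OF kernel])
        fix x y :: real assume xy: "0 \<le> x" "lam * x \<le> y"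
        have "c2 * lam \<le> (1 - (\<mu> / 2)\<^sup>2 / lam) * lam"
          using lam by (intro mult_right_mono) (auto simp: c2_def)
        also have "\<dots> = lam - (\<mu> / 2) * \<mu> + (\<mu> / 2)\<^sup>2"
          using lam by (simp add: field_simps power2_eq_square)
        finally have "c2 * lam \<le> lam - (\<mu> / 2) * \<mu> + (\<mu> / 2)\<^sup>2" .
        then show "c2 * y \<le> (1 - \<beta> * (\<mu> / 2)) * y + (\<mu> / 2) * ((\<mu> / 2) - \<alpha>) * x"
          using large_\<alpha>[of "\<mu> / 2" c2 x y] small_\<alpha>[of "\<mu> / 2" c2 x y] \<open>\<mu> > 0\<close> xy
          by (cases "\<mu> / 2 \<le> \<alpha>") (auto simp: c2_def)
      qed (use c2 nn \<open>t \<ge> 0\<close> \<open>\<mu> > 0\<close> in \<open>auto simp: \<mu>_def\<close>)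
      then show ?thesis using K_pos[OF c2(1)] by blast
    qed
    \<comment> \<open>The conditions are moved behind the choice of the constant, so that
      \<open>C2\<close> exists in any case; where they fail, 1 will do.\<close>
    then obtain C2 where "C2 > 0" and second: "\<And>p q m a t. (\<mu> / 2)\<^sup>2 < lam \<Longrightarrow> \<beta> * (\<mu> / 2) \<le> 1 \<Longrightarrow>
        damped_kernel p q m a \<alpha> \<beta> 1 0 lam \<Longrightarrow> t \<ge> 0 \<Longrightarrow>
        m t t + a t t \<le> C2 * exp (- 2 * (\<mu> / 2) * t) * (m 0 0 + a 0 0)"
      by (metis zero_less_one)
    have weaken: "x \<le> max (K c1) C2 * e * y" if "x \<le> C * e * y" "C = K c1 \<or> C = C2" "e \<ge> 0" "y \<ge> 0" for x C e y
    proof -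
      have "C * e * y \<le> max (K c1) C2 * e * y" using that by (intro mult_right_mono) auto
      with that show ?thesis by linarith
    qed
    show ?thesis
    proof (intro exI[of _ "max (K c1) C2"] conjI allI impI)
      show "max (K c1) C2 > 0" using \<open>C2 > 0\<close> by simp
    next
      fix p q m a :: "real \<Rightarrow> real \<Rightarrow> real" and \<delta> t :: real
      assume *: "damped_kernel p q m a \<alpha> \<beta> 1 0 lam \<and> 0 < \<delta> \<and> \<delta> \<le> (\<alpha> + \<beta> * lam) / 2 \<and>
        (\<delta> \<le> lam / (\<alpha> + \<beta> * lam) \<or> \<delta> = (\<alpha> + \<beta> * lam) / 2 \<and> \<delta>\<^sup>2 < lam \<and> \<beta> * \<delta> \<le> 1)"
        and "t \<ge> 0"
      interpret K: damped_kernel p q m a \<alpha> \<beta> 1 0 lam using * by simp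
      have pos: "m 0 0 + a 0 0 \<ge> 0" using K.m_nonneg[of 0] K.a_nonneg[of 0] by simp
      from * consider "\<delta> \<le> lam / \<mu>" | "\<delta> = \<mu> / 2" "(\<mu> / 2)\<^sup>2 < lam" "\<beta> * (\<mu> / 2) \<le> 1"
        unfolding \<mu>_def by metis
      then have "m t t + a t t \<le> K c1 * exp (- 2 * \<delta> * t) * (m 0 0 + a 0 0) \<or>
          m t t + a t t \<le> C2 * exp (- 2 * \<delta> * t) * (m 0 0 + a 0 0)"
      proof cases
        case 1
        then show ?thesis using first[of p q m a t \<delta>] * \<open>t \<ge> 0\<close> by (simp add: \<mu>_def)
      next
        case 2
        then show ?thesis using second[of p q m a t] * \<open>t \<ge> 0\<close> by blast
      qed
      then show "m t t + a t t \<le> max (K c1) C2 * exp (- 2 * \<delta> * t) * (m 0 0 + a 0 0)"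
        using weaken[OF _ _ exp_ge_zero pos] by blast
    qed
  qed
qed

section \<open>Test functions\<close>

lemma has_derivative_partial_deriv:
  assumes "f differentiable (at x)"
  shows "(f has_derivative (\<lambda>h. \<Sum>b\<in>Basis. (h \<bullet> b) * partial_deriv b f x)) (at x)"
proof -
  let ?f' = "frechet_derivative f (at x)"
  have deriv: "(f has_derivative ?f') (at x)"
    using assms by (simp add: frechet_derivative_works)
  then have lin: "linear ?f'"
    by (rule has_derivative_linear)
  have "?f' h = (\<Sum>b\<in>Basis. (h \<bullet> b) * partial_deriv b f x)" for h
  proof -
    have "?f' h = ?f' (\<Sum>b\<in>Basis. (h \<bullet> b) *\<^sub>R b)"
      by (simp add: euclidean_representation)
    also have "\<dots> = (\<Sum>b\<in>Basis. (h \<bullet> b) * partial_deriv b f x)"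
      by (simp add: linear_sum[OF lin] linear_cmul[OF lin] partial_deriv_def)
    finally show ?thesis .
  qed
  then have "?f' = (\<lambda>h. \<Sum>b\<in>Basis. (h \<bullet> b) * partial_deriv b f x)"
    by (rule ext)
  with deriv show ?thesis by simp
qed

lemma partial_deriv_eq:
  assumes "(f has_derivative f') (at x)"
  shows "partial_deriv i f x = f' i"
  using frechet_derivative_at[OF assms] by (simp add: partial_deriv_def)

lemma smooth_differentiable: "smooth f \<Longrightarrow> f differentiable (at x)"
  unfolding smooth_def iterated_partial_def by (force dest: spec[of _ "[]"])

lemma smooth_continuous: "smooth f \<Longrightarrow> continuous_on S f"
  by (meson smooth_differentiable differentiable_imp_continuous_within continuous_at_imp_continuous_on)

lemma iterated_partial_snoc: "iterated_partial (is @ [i]) f = iterated_partial is (partial_deriv i f)"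
  by (simp add: iterated_partial_def)

lemma iterated_partial_Cons: "iterated_partial (i # is) f = partial_deriv i (iterated_partial is f)"
  by (simp add: iterated_partial_def)

lemma iterated_partial_Nil: "iterated_partial [] f = f"
  by (simp add: iterated_partial_def)

lemma smooth_partial:
  assumes "smooth f" "i \<in> Basis"
  shows "smooth (partial_deriv i f)"
  unfolding smooth_def
proof (intro allI impI)
  fix "is" x assume "set is \<subseteq> (Basis :: 'a set)"
  then have "set (is @ [i]) \<subseteq> Basis" using assms by simp
  then show "iterated_partial is (partial_deriv i f) differentiable (at x)"
    using assms(1) iterated_partial_snoc unfolding smooth_def by metis
qed

lemma partial_deriv_comb:
  assumes "f differentiable (at x)" "g differentiable (at x)"
  shows "partial_deriv i (\<lambda>x. a * f x + b * g x) x = a * partial_deriv i f x + b * partial_deriv i g x"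
proof -
  have "((\<lambda>x. a * f x + b * g x) has_derivative
      (\<lambda>h. a * frechet_derivative f (at x) h + b * frechet_derivative g (at x) h)) (at x)"
    using assms unfolding frechet_derivative_works by (intro derivative_intros)
  from partial_deriv_eq[OF this] show ?thesis
    by (simp add: partial_deriv_def)
qed

lemma partial_deriv_mult:
  assumes "f differentiable (at x)" "g differentiable (at x)"
  shows "partial_deriv i (\<lambda>x. f x * g x) x = f x * partial_deriv i g x + partial_deriv i f x * g x"
proof -
  have "((\<lambda>x. f x * g x) has_derivative
      (\<lambda>h. f x * frechet_derivative g (at x) h + frechet_derivative f (at x) h * g x)) (at x)"
    using assms unfolding frechet_derivative_works by (rule has_derivative_mult)
  from partial_deriv_eq[OF this] show ?thesis
    by (simp add: partial_deriv_def)
qed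

lemma smooth_comb:
  assumes "smooth f" "smooth g"
  shows "smooth (\<lambda>x. a * f x + b * g x)"
proof -
  have "iterated_partial is (\<lambda>x. a * f x + b * g x) =
      (\<lambda>x. a * iterated_partial is f x + b * iterated_partial is g x)"
    if "set is \<subseteq> Basis" for "is"
    using that
  proof (induction "is")
    case (Cons i "is")
    then have "iterated_partial is f differentiable (at x)" "iterated_partial is g differentiable (at x)" for x
      using assms by (auto simp: smooth_def)
    note comb = partial_deriv_comb[OF this, of i a b]
    have eq: "iterated_partial is (\<lambda>x. a * f x + b * g x) =
        (\<lambda>x. a * iterated_partial is f x + b * iterated_partial is g x)"
      using Cons by simp
    show ?case
      unfolding iterated_partial_Cons eq by (rule ext) (rule comb)
  qed (simp add: iterated_partial_Nil)
  then show ?thesis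
    using assms by (simp add: smooth_def)
qed

lemma test_function_smooth: "test_function \<Omega> \<phi> \<Longrightarrow> smooth \<phi>"
  and test_function_compact: "test_function \<Omega> \<phi> \<Longrightarrow> compact (closure {x. \<phi> x \<noteq> 0})"
  and test_function_support: "test_function \<Omega> \<phi> \<Longrightarrow> closure {x. \<phi> x \<noteq> 0} \<subseteq> \<Omega>"
  by (auto simp: test_function_def)

lemma eq_0_outside_support: "x \<notin> closure {x. f x \<noteq> 0} \<Longrightarrow> f x = 0"
  by (metis (mono_tags, lifting) closure_subset mem_Collect_eq subsetD)

lemma test_function_eq_0:
  assumes "test_function \<Omega> \<phi>" "x \<notin> \<Omega>"
  shows "\<phi> x = 0"
  using test_function_support[OF assms(1)] assms(2) by (intro eq_0_outside_support) auto

lemma test_functionI: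
  assumes "smooth \<phi>" "compact K" "K \<subseteq> \<Omega>" "\<And>x. x \<notin> K \<Longrightarrow> \<phi> x = 0"
  shows "test_function \<Omega> \<phi>"
proof -
  have "closure {x. \<phi> x \<noteq> 0} \<subseteq> K"
    using assms(2,4) by (intro closure_minimal compact_imp_closed) auto
  moreover from this have "compact (closure {x. \<phi> x \<noteq> 0})"
    using compact_Int_closed[OF assms(2) closed_closure, of "{x. \<phi> x \<noteq> 0}"] by (simp add: inf.absorb2)
  ultimately show ?thesis
    using assms unfolding test_function_def by simp
qed

lemma test_function_comb:
  assumes "test_function \<Omega> \<phi>" "test_function \<Omega> \<psi>"
  shows "test_function \<Omega> (\<lambda>x. a * \<phi> x + b * \<psi> x)"
proof (rule test_functionI)
  show "smooth (\<lambda>x. a * \<phi> x + b * \<psi> x)"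
    using assms by (intro smooth_comb test_function_smooth)
  show "compact (closure {x. \<phi> x \<noteq> 0} \<union> closure {x. \<psi> x \<noteq> 0})"
    using assms by (intro compact_Un test_function_compact)
  show "closure {x. \<phi> x \<noteq> 0} \<union> closure {x. \<psi> x \<noteq> 0} \<subseteq> \<Omega>"
    using assms by (simp add: test_function_support)
  show "a * \<phi> x + b * \<psi> x = 0" if "x \<notin> closure {x. \<phi> x \<noteq> 0} \<union> closure {x. \<psi> x \<noteq> 0}" for x
  proof -
    have "\<phi> x = 0" "\<psi> x = 0"
      using that by (metis UnI1 eq_0_outside_support, metis UnI2 eq_0_outside_support)
    then show ?thesis by simp
  qed
qed

lemma test_function_partial:
  assumes "test_function \<Omega> \<phi>" "i \<in> Basis"
  shows "test_function \<Omega> (partial_deriv i \<phi>)"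
proof (rule test_functionI)
  let ?K = "closure {x. \<phi> x \<noteq> 0}"
  show "smooth (partial_deriv i \<phi>)"
    using assms by (intro smooth_partial test_function_smooth)
  show "compact ?K" "?K \<subseteq> \<Omega>"
    by (rule test_function_compact test_function_support, rule assms)+
  show "partial_deriv i \<phi> x = 0" if "x \<notin> ?K" for x
  proof -
    have "(\<phi> has_derivative (\<lambda>h. 0)) (at x)"
    proof (rule has_derivative_transform_within_open)
      show "((\<lambda>x. 0) has_derivative (\<lambda>h. 0 :: real)) (at x)" by simp
      show "open (- ?K)" by (intro open_Compl closed_closure)
      show "x \<in> - ?K" using that by simp
      show "\<And>y. y \<in> - ?K \<Longrightarrow> 0 = \<phi> y"
        by (metis ComplD eq_0_outside_support)
    qed
    from partial_deriv_eq[OF this] show ?thesis by simp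
  qed
qed

lemma test_function_iterated_partial:
  assumes "test_function \<Omega> \<phi>" "set is \<subseteq> Basis"
  shows "test_function \<Omega> (iterated_partial is \<phi>)"
  using assms(2)
  by (induction "is") (auto simp: iterated_partial_Nil iterated_partial_Cons assms(1) test_function_partial)

section \<open>Integration by parts\<close>

lemma compact_support_integrable:
  fixes f :: "'a::euclidean_space \<Rightarrow> real"
  assumes "continuous_on UNIV f" "compact K" "\<And>x. x \<notin> K \<Longrightarrow> f x = 0"
  shows "integrable lborel f"
proof -
  have "integrable lborel (\<lambda>x. indicator K x *\<^sub>R f x)"
    using assms by (intro borel_integrable_compact continuous_on_subset[OF assms(1)]) auto
  also have "(\<lambda>x. indicator K x *\<^sub>R f x) = f"
    using assms(3) by (force simp: indicator_def fun_eq_iff)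
  finally show ?thesis .
qed

text \<open>Test functions vanish outside the domain, so their integrals may be taken over the whole
  space, where translation invariance is at hand.\<close>

lemma borel_integral_restrict:
  fixes f :: "'a::euclidean_space \<Rightarrow> real"
  assumes f: "f \<in> borel_measurable borel" "\<And>x. x \<notin> \<Omega> \<Longrightarrow> f x = 0" and "open \<Omega>"
  shows "integrable (lebesgue_on \<Omega>) f \<longleftrightarrow> integrable lborel f"
    and "(LINT x|lebesgue_on \<Omega>. f x) = (LINT x|lborel. f x)"
proof -
  have \<Omega>: "\<Omega> \<inter> space lebesgue \<in> sets lebesgue"
    using \<open>open \<Omega>\<close> by (simp add: borel_open)
  have eq: "(\<lambda>x. indicator \<Omega> x *\<^sub>R f x) = f"
    using f(2) by (force simp: indicator_def fun_eq_iff)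
  have borel: "f \<in> borel_measurable lborel"
    using f(1) by simp
  show "integrable (lebesgue_on \<Omega>) f \<longleftrightarrow> integrable lborel f"
    unfolding integrable_restrict_space[OF \<Omega>] eq by (rule integrable_completion) (rule borel)
  show "(LINT x|lebesgue_on \<Omega>. f x) = (LINT x|lborel. f x)"
    unfolding integral_restrict_space[OF \<Omega>] eq by (rule integral_completion) (rule borel)
qed

lemma test_function_mult:
  assumes "test_function \<Omega> \<phi>" "test_function \<Omega> \<psi>" "open \<Omega>"
  shows "integrable lborel (\<lambda>x. \<phi> x * \<psi> x)"
    and "L2_inner \<Omega> \<phi> \<psi> = (LINT x|lborel. \<phi> x * \<psi> x)"
proof -
  have cont: "continuous_on UNIV (\<lambda>x. \<phi> x * \<psi> x)"
    using assms by (intro continuous_intros smooth_continuous test_function_smooth)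
  show "integrable lborel (\<lambda>x. \<phi> x * \<psi> x)"
    by (rule compact_support_integrable[OF cont test_function_compact[OF assms(1)]])
      (metis eq_0_outside_support mult_zero_left)
  show "L2_inner \<Omega> \<phi> \<psi> = (LINT x|lborel. \<phi> x * \<psi> x)"
    unfolding L2_inner_def
    by (rule borel_integral_restrict(2)[OF borel_measurable_continuous_onI[OF cont] _ assms(3)])
      (simp add: test_function_eq_0[OF assms(1)])
qed

lemma test_function_L2:
  assumes "test_function \<Omega> \<phi>" "open \<Omega>"
  shows "\<phi> \<in> L2 \<Omega>"
proof -
  have cont: "continuous_on UNIV \<phi>"
    using assms by (intro smooth_continuous test_function_smooth)
  have "\<phi> \<in> borel_measurable (lebesgue_on \<Omega>)"
    by (rule measurable_restrict_space1) (simp add: borel_measurable_continuous_onI[OF cont] measurable_completion)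
  moreover have "integrable (lebesgue_on \<Omega>) (\<lambda>x. (\<phi> x)\<^sup>2)"
    using borel_integral_restrict(1)[of "\<lambda>x. (\<phi> x)\<^sup>2" \<Omega>] test_function_mult(1)[OF assms(1,1,2)]
      cont assms test_function_eq_0[OF assms(1)]
    by (simp add: power2_eq_square continuous_on_mult borel_measurable_continuous_onI)
  ultimately show ?thesis by (simp add: L2_def)
qed

text \<open>By translation invariance every difference quotient of \<open>F\<close> in direction
  \<open>i\<close> has integral zero, and dominated convergence passes to the derivative.\<close>

lemma integral_partial_deriv:
  fixes F :: "'a::euclidean_space \<Rightarrow> real"
  assumes diff: "\<And>x. F differentiable (at x)" and cont: "continuous_on UNIV (partial_deriv i F)"
    and K: "compact K" "\<And>x. x \<notin> K \<Longrightarrow> F x = 0" and i: "i \<in> Basis"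
  shows "(LINT x|lborel. partial_deriv i F x) = 0"
proof -
  let ?g = "partial_deriv i F"
  have contF: "continuous_on UNIV F"
    using diff by (meson differentiable_imp_continuous_within continuous_at_imp_continuous_on)
  have intF: "integrable lborel F"
    by (rule compact_support_integrable[OF contF K])
  have line: "((\<lambda>t. F (x + t *\<^sub>R i)) has_real_derivative ?g (x + t *\<^sub>R i)) (at t)" for x t
  proof -
    have "(F has_derivative (\<lambda>h. \<Sum>b\<in>Basis. (h \<bullet> b) * partial_deriv b F (x + t *\<^sub>R i))) (at (x + t *\<^sub>R i))"
      by (rule has_derivative_partial_deriv) (rule diff)
    moreover have "((\<lambda>t. x + t *\<^sub>R i) has_derivative (\<lambda>h. h *\<^sub>R i)) (at t)"
      by (auto intro!: derivative_eq_intros)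
    ultimately have "((\<lambda>t. F (x + t *\<^sub>R i)) has_derivative
        (\<lambda>h. \<Sum>b\<in>Basis. ((h *\<^sub>R i) \<bullet> b) * partial_deriv b F (x + t *\<^sub>R i))) (at t)"
      using has_derivative_compose by blast
    moreover have "(\<Sum>b\<in>Basis. ((h *\<^sub>R i) \<bullet> b) * partial_deriv b F (x + t *\<^sub>R i)) = ?g (x + t *\<^sub>R i) * h" for h
      using i by (simp add: inner_Basis if_distrib if_distribR sum.delta cong: if_cong)
    ultimately show ?thesis
      by (simp add: has_field_derivative_def)
  qed
  \<comment> \<open>\<open>K'\<close> contains every point that a shift by at most 1 carries into
    \<open>K\<close>, hence the support of every difference quotient used. Adding one more unit ball
    takes in the intermediate points of the mean value theorem.\<close>
  define K' where "K' = {x + y | x y. x \<in> K \<and> y \<in> cball 0 1}"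
  have K': "compact K'"
    unfolding K'_def using K(1) by (intro compact_sums) auto
  have outside: "x + t *\<^sub>R i \<notin> K" if "x \<notin> K'" "0 \<le> t" "t \<le> 1" for x t
  proof
    assume "x + t *\<^sub>R i \<in> K"
    moreover have "- t *\<^sub>R i \<in> cball 0 1"
      using that i by simp
    ultimately have "(x + t *\<^sub>R i) + (- t *\<^sub>R i) \<in> K'"
      unfolding K'_def by blast
    then show False using that by simp
  qed
  have "bounded (?g ` (\<Union>x\<in>K'. \<Union>y\<in>cball 0 1. {x + y}))"
  proof (rule compact_imp_bounded, rule compact_continuous_image)
    show "compact (\<Union>x\<in>K'. \<Union>y\<in>cball 0 1. {x + y})"
      using compact_sums'[OF K' compact_cball[of 0 1]] by (simp add: UNION_singleton_eq_range image_def)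
  qed (use continuous_on_subset[OF cont] in auto)
  then obtain M where M: "\<And>x y. x \<in> K' \<Longrightarrow> norm y \<le> 1 \<Longrightarrow> \<bar>?g (x + y)\<bar> \<le> M"
    unfolding bounded_iff by fastforce
  define s where "s n x = (F (x + (1 / real (Suc n)) *\<^sub>R i) - F x) / (1 / real (Suc n))" for n x
  have "(\<lambda>n. LINT x|lborel. s n x) \<longlonglongrightarrow> (LINT x|lborel. ?g x)"
  proof (rule integral_dominated_convergence[where w = "\<lambda>x. indicator K' x *\<^sub>R M"])
    show "?g \<in> borel_measurable lborel"
      using cont by (simp add: borel_measurable_continuous_onI)
    show "s n \<in> borel_measurable lborel" for n
      unfolding s_def by (auto intro!: borel_measurable_continuous_onI continuous_intros continuous_on_compose2[OF contF])
    show "integrable lborel (\<lambda>x. indicator K' x *\<^sub>R M)"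
      by (rule borel_integrable_compact[OF K']) simp
    show "AE x in lborel. (\<lambda>n. s n x) \<longlonglongrightarrow> ?g x"
    proof (rule AE_I2)
      fix x
      have "((\<lambda>h. (F (x + h *\<^sub>R i) - F x) / h) \<longlongrightarrow> ?g x) (at 0)"
        using line[of x 0] by (simp add: has_field_derivative_iff)
      moreover have "filterlim (\<lambda>n. 1 / real (Suc n)) (at 0) sequentially"
        using LIMSEQ_Suc[OF lim_1_over_n] by (auto simp: filterlim_at)
      ultimately show "(\<lambda>n. s n x) \<longlonglongrightarrow> ?g x"
        unfolding s_def by (rule filterlim_compose)
    qed
    show "AE x in lborel. norm (s n x) \<le> indicator K' x *\<^sub>R M" for n
    proof (rule AE_I2)
      fix x
      let ?h = "1 / real (Suc n)"
      have h: "0 < ?h" "?h \<le> 1" by auto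
      show "norm (s n x) \<le> indicator K' x *\<^sub>R M"
      proof (cases "x \<in> K'")
        case True
        obtain t where t: "0 < t" "t < ?h" "F (x + ?h *\<^sub>R i) - F (x + 0 *\<^sub>R i) = (?h - 0) * ?g (x + t *\<^sub>R i)"
          using MVT2[of 0 ?h "\<lambda>t. F (x + t *\<^sub>R i)" "\<lambda>t. ?g (x + t *\<^sub>R i)"] h line by blast
        then have "s n x = ?g (x + t *\<^sub>R i)"
          by (simp add: s_def)
        then show ?thesis
          using M[OF True, of "t *\<^sub>R i"] True t h i by simp
      next
        case False
        then have "F (x + ?h *\<^sub>R i) = 0" "F (x + 0 *\<^sub>R i) = 0"
          using outside[OF False] K(2) h by (metis less_imp_le, metis order_refl zero_le_one)
        then show ?thesis using False by (simp add: s_def)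
      qed
    qed
  qed
  moreover have "(LINT x|lborel. s n x) = 0" for n
  proof -
    let ?c = "(1 / real (Suc n)) *\<^sub>R i"
    have F_borel: "F \<in> borel_measurable borel"
      using contF by (simp add: borel_measurable_continuous_onI)
    have shift: "integrable lborel (\<lambda>x. F (?c + x))" "(LINT x|lborel. F (?c + x)) = (LINT x|lborel. F x)"
      using integrable_distr_eq[of "(+) ?c" lborel borel F] integral_distr[of "(+) ?c" lborel borel F] F_borel intF
      by (simp_all add: lborel_distr_plus)
    have "(LINT x|lborel. F (x + ?c) - F x) = 0"
      using shift intF by (simp add: add.commute)
    then show ?thesis
      by (simp add: s_def)
  qed
  ultimately show ?thesis
    by (simp add: LIMSEQ_const_iff)
qed

lemma integration_by_parts:
  assumes "test_function \<Omega> \<phi>" "test_function \<Omega> \<psi>" "open \<Omega>" "i \<in> Basis"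
  shows "L2_inner \<Omega> \<phi> (partial_deriv i \<psi>) = - L2_inner \<Omega> (partial_deriv i \<phi>) \<psi>"
proof -
  note test = assms(1,2) test_function_partial[OF assms(1,4)] test_function_partial[OF assms(2,4)]
  note cont = test[THEN test_function_smooth, THEN smooth_continuous]
  have diff: "\<phi> differentiable (at x)" "\<psi> differentiable (at x)" for x
    using assms by (auto intro: smooth_differentiable test_function_smooth)
  have pd: "partial_deriv i (\<lambda>x. \<phi> x * \<psi> x) = (\<lambda>x. \<phi> x * partial_deriv i \<psi> x + partial_deriv i \<phi> x * \<psi> x)"
    using partial_deriv_mult[OF diff] by (simp add: fun_eq_iff)
  have "(LINT x|lborel. partial_deriv i (\<lambda>x. \<phi> x * \<psi> x) x) = 0"
  proof (rule integral_partial_deriv)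
    show "continuous_on UNIV (partial_deriv i (\<lambda>x. \<phi> x * \<psi> x))"
      unfolding pd by (intro continuous_intros cont)
    show "compact (closure {x. \<phi> x \<noteq> 0})"
      by (rule test_function_compact[OF assms(1)])
    show "\<phi> x * \<psi> x = 0" if "x \<notin> closure {x. \<phi> x \<noteq> 0}" for x
      using eq_0_outside_support[OF that] by (simp only: mult_zero_left)
  qed (use assms diff in \<open>simp_all add: differentiable_mult\<close>)
  then have "(LINT x|lborel. \<phi> x * partial_deriv i \<psi> x + partial_deriv i \<phi> x * \<psi> x) = 0"
    unfolding pd .
  then show ?thesis
    using test_function_mult[OF test(1,4) assms(3)] test_function_mult[OF test(3,2) assms(3)] by simp
qed

text \<open>The outermost derivative is moved first and ends up innermost on the other side, hence
  the reversed list; this avoids any appeal to the symmetry of mixed partial derivatives.\<close>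

lemma integration_by_parts_iterated:
  assumes "test_function \<Omega> \<phi>" "test_function \<Omega> \<psi>" "open \<Omega>" "set is \<subseteq> Basis"
  shows "L2_inner \<Omega> \<phi> (iterated_partial is \<psi>) =
    (- 1) ^ length is * L2_inner \<Omega> (iterated_partial (rev is) \<phi>) \<psi>"
  using assms(1,4)
proof (induction "is" arbitrary: \<phi>)
  case (Cons i "is")
  have "L2_inner \<Omega> \<phi> (iterated_partial (i # is) \<psi>) = - L2_inner \<Omega> (partial_deriv i \<phi>) (iterated_partial is \<psi>)"
    unfolding iterated_partial_Cons using Cons.prems assms
    by (intro integration_by_parts test_function_iterated_partial) auto
  also have "\<dots> = - ((- 1) ^ length is * L2_inner \<Omega> (iterated_partial (rev is) (partial_deriv i \<phi>)) \<psi>)"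
    using Cons.prems by (subst Cons.IH) (auto intro: test_function_partial)
  finally show ?case
    by (simp add: iterated_partial_snoc)
qed (simp add: iterated_partial_Nil)

lemma weak_deriv_test_function:
  assumes "test_function \<Omega> \<phi>" "open \<Omega>" "set is \<subseteq> Basis"
  shows "weak_deriv \<Omega> is \<phi> (iterated_partial (rev is) \<phi>)"
  unfolding weak_deriv_def using integration_by_parts_iterated assms by blast

lemma test_function_neg_laplacian:
  assumes "test_function \<Omega> \<phi>" "open \<Omega>"
  shows "(\<phi>, \<lambda>x. - (\<Sum>i\<in>Basis. partial_deriv i (partial_deriv i \<phi>) x)) \<in> neg_laplacian \<Omega>"
proof -
  have L2: "\<phi> \<in> L2 \<Omega>" "i \<in> Basis \<Longrightarrow> partial_deriv i \<phi> \<in> L2 \<Omega>"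
    "i \<in> Basis \<Longrightarrow> partial_deriv i (partial_deriv i \<phi>) \<in> L2 \<Omega>" for i
    using assms by (auto intro: test_function_L2 test_function_partial)
  have w: "weak_deriv \<Omega> [i] \<phi> (partial_deriv i \<phi>)"
    "weak_deriv \<Omega> [i, i] \<phi> (partial_deriv i (partial_deriv i \<phi>))" if "i \<in> Basis" for i
    using weak_deriv_test_function[OF assms, of "[i]"] weak_deriv_test_function[OF assms, of "[i, i]"] that
    by (simp_all add: iterated_partial_Cons iterated_partial_Nil)
  have "\<phi> \<in> sobolev 2 \<Omega>"
    unfolding sobolev_def
  proof (intro CollectI conjI allI impI)
    fix "is" :: "'a list" assume "set is \<subseteq> Basis \<and> length is \<le> 2"
    then have "set is \<subseteq> Basis" "set (rev is) \<subseteq> Basis" by auto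
    then show "\<exists>g\<in>L2 \<Omega>. weak_deriv \<Omega> is \<phi> g"
      using weak_deriv_test_function[OF assms]
        test_function_L2[OF test_function_iterated_partial[OF assms(1)] assms(2)] by blast
  qed (rule L2(1))
  moreover have "\<phi> \<in> H01 \<Omega>"
  proof -
    have "L2_norm \<Omega> (\<lambda>x. 0) = 0"
      by (simp add: L2_norm_def L2_inner_def)
    moreover have "\<exists>g\<in>L2 \<Omega>. weak_deriv \<Omega> [i] \<phi> g \<and>
        (\<lambda>n. L2_norm \<Omega> (\<lambda>x. partial_deriv i \<phi> x - g x)) \<longlonglongrightarrow> 0" if "i \<in> Basis" for i
      using \<open>L2_norm \<Omega> (\<lambda>x. 0) = 0\<close> L2(2)[OF that] w(1)[OF that]
      by (intro bexI[of _ "partial_deriv i \<phi>"] conjI) simp_all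
    ultimately show ?thesis
      unfolding H01_def using assms(1) L2(1)
      by (intro CollectI conjI exI[of _ "\<lambda>n. \<phi>"]) simp_all
  qed
  moreover have "(\<lambda>x. - (\<Sum>i\<in>Basis. partial_deriv i (partial_deriv i \<phi>) x)) \<in> L2 \<Omega>"
    using L2_scale[where c = "- 1", OF L2_sum[where I = Basis, OF L2(3)]] by simp
  ultimately show ?thesis
    unfolding neg_laplacian_def using L2(3) w(2)
    by (intro CollectI case_prodI conjI IntI exI[of _ "\<lambda>i. partial_deriv i (partial_deriv i \<phi>)"])
      (simp_all add: L2_eq_def)
qed

definition dirichlet_energy :: "'a::euclidean_space set \<Rightarrow> ('a \<Rightarrow> real) \<Rightarrow> real" where
  "dirichlet_energy \<Omega> \<phi> = (\<Sum>i\<in>Basis. (L2_norm \<Omega> (partial_deriv i \<phi>))\<^sup>2)"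

lemma test_function_laplacian_inner:
  assumes "test_function \<Omega> \<phi>" "open \<Omega>"
  shows "L2_inner \<Omega> (\<lambda>x. - (\<Sum>i\<in>Basis. partial_deriv i (partial_deriv i \<phi>) x)) \<phi> = dirichlet_energy \<Omega> \<phi>"
proof -
  have L2: "\<phi> \<in> L2 \<Omega>" "i \<in> Basis \<Longrightarrow> partial_deriv i (partial_deriv i \<phi>) \<in> L2 \<Omega>" for i
    using assms by (auto intro: test_function_L2 test_function_partial)
  have "L2_inner \<Omega> (\<lambda>x. - (\<Sum>i\<in>Basis. partial_deriv i (partial_deriv i \<phi>) x)) \<phi> =
      - (\<Sum>i\<in>Basis. L2_inner \<Omega> (partial_deriv i (partial_deriv i \<phi>)) \<phi>)"
    using L2_inner_scale_left[of \<Omega> "- 1" "\<lambda>x. \<Sum>i\<in>Basis. partial_deriv i (partial_deriv i \<phi>) x" \<phi>]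
      L2_inner_sum_left[OF L2(2,1)] by simp
  also have "\<dots> = (\<Sum>i\<in>Basis. L2_inner \<Omega> (partial_deriv i \<phi>) (partial_deriv i \<phi>))"
    unfolding sum_negf[symmetric]
    by (intro sum.cong refl) (use integration_by_parts[OF test_function_partial[OF assms(1)] assms(1,2)] in simp)
  finally show ?thesis
    by (simp add: dirichlet_energy_def L2_norm_power2)
qed

section \<open>Rellich's inequality\<close>

text \<open>The increment is the mean over [0, 1] of the derivative along the segment from x to x +
  h. Jensen's inequality for the square and Cauchy-Schwarz in the coordinates give the
  bound.\<close>

lemma increment_square_le:
  fixes \<phi> :: "'a::euclidean_space \<Rightarrow> real"
  assumes diff: "\<And>x. \<phi> differentiable (at x)"
    and cont: "\<And>b. b \<in> Basis \<Longrightarrow> continuous_on UNIV (partial_deriv b \<phi>)"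
  shows "ennreal ((\<phi> (x + h) - \<phi> x)\<^sup>2) \<le>
    ennreal ((norm h)\<^sup>2) * (\<integral>\<^sup>+t. indicator {0..1} t * ennreal (\<Sum>b\<in>Basis. (partial_deriv b \<phi> (x + t *\<^sub>R h))\<^sup>2) \<partial>lborel)"
proof -
  define g where "g t = (\<Sum>b\<in>Basis. (h \<bullet> b) * partial_deriv b \<phi> (x + t *\<^sub>R h))" for t
  define G where "G y = (\<Sum>b\<in>Basis. (partial_deriv b \<phi> y)\<^sup>2)" for y
  define c where "c = \<phi> (x + h) - \<phi> x"
  have contg: "continuous_on S g" for S
    unfolding g_def by (intro continuous_intros continuous_on_compose2[OF cont]) auto
  have contG: "continuous_on S (\<lambda>t. G (x + t *\<^sub>R h))" for S
    unfolding G_def by (intro continuous_intros continuous_on_compose2[OF cont]) auto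
  have deriv: "((\<lambda>t. \<phi> (x + t *\<^sub>R h)) has_vector_derivative g t) (at t within {0..1})" for t
  proof -
    have "((\<lambda>t. x + t *\<^sub>R h) has_derivative (\<lambda>r. r *\<^sub>R h)) (at t)"
      by (auto intro!: derivative_eq_intros)
    from has_derivative_compose[OF this has_derivative_partial_deriv[OF diff]]
    have "((\<lambda>t. \<phi> (x + t *\<^sub>R h)) has_derivative
        (\<lambda>r. \<Sum>b\<in>Basis. ((r *\<^sub>R h) \<bullet> b) * partial_deriv b \<phi> (x + t *\<^sub>R h))) (at t)" .
    moreover have "(\<Sum>b\<in>Basis. ((r *\<^sub>R h) \<bullet> b) * partial_deriv b \<phi> (x + t *\<^sub>R h)) = r *\<^sub>R g t" for r
      by (simp add: g_def sum_distrib_left mult.assoc)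
    ultimately show ?thesis
      by (simp add: has_vector_derivative_def has_derivative_at_withinI)
  qed
  have g_int: "integrable lborel (\<lambda>t. indicator {0..1} t *\<^sub>R g t)"
    and g2_int: "integrable lborel (\<lambda>t. indicator {0..1} t *\<^sub>R (g t)\<^sup>2)"
    and G_int: "integrable lborel (\<lambda>t. indicator {0..1} t *\<^sub>R ((norm h)\<^sup>2 * G (x + t *\<^sub>R h)))"
    and one_int: "integrable lborel (\<lambda>t. indicator {0..1::real} t *\<^sub>R (c\<^sup>2))"
    by (intro borel_integrable_compact continuous_intros contg contG; simp)+
  have g_eq: "(LINT t|lborel. indicator {0..1} t *\<^sub>R g t) = c"
    using integral_FTC_atLeastAtMost[of 0 1 "\<lambda>t. \<phi> (x + t *\<^sub>R h)" g] deriv contg by (simp add: c_def)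
  \<comment> \<open>Jensen's inequality, as nonnegativity of the variance of \<open>g\<close> around
    its mean \<open>c\<close>.\<close>
  have "0 \<le> (LINT t|lborel. indicator {0..1} t *\<^sub>R (g t - c)\<^sup>2)"
    by (intro Bochner_Integration.integral_nonneg) simp
  also have "\<dots> = (LINT t|lborel. indicator {0..1} t *\<^sub>R (g t)\<^sup>2 - 2 * c * (indicator {0..1} t *\<^sub>R g t) + indicator {0..1} t *\<^sub>R c\<^sup>2)"
    by (intro Bochner_Integration.integral_cong refl) (simp add: power2_diff algebra_simps)
  also have "\<dots> = (LINT t|lborel. indicator {0..1} t *\<^sub>R (g t)\<^sup>2) - 2 * c * c + c\<^sup>2"
    using g_int g2_int one_int g_eq by simp
  finally have "c\<^sup>2 \<le> (LINT t|lborel. indicator {0..1} t *\<^sub>R (g t)\<^sup>2)"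
    by (simp add: power2_eq_square)
  also have "\<dots> \<le> (LINT t|lborel. indicator {0..1} t *\<^sub>R ((norm h)\<^sup>2 * G (x + t *\<^sub>R h)))"
  proof (rule integral_mono[OF g2_int G_int])
    fix t
    have "(g t)\<^sup>2 \<le> (\<Sum>b\<in>Basis. (h \<bullet> b)\<^sup>2) * G (x + t *\<^sub>R h)"
      unfolding g_def G_def by (rule Cauchy_Schwarz_ineq_sum)
    also have "(\<Sum>b\<in>Basis. (h \<bullet> b)\<^sup>2) = (norm h)\<^sup>2"
      unfolding power2_norm_eq_inner by (simp add: euclidean_inner[of h h] power2_eq_square)
    finally show "indicator {0..1} t *\<^sub>R (g t)\<^sup>2 \<le> indicator {0..1} t *\<^sub>R ((norm h)\<^sup>2 * G (x + t *\<^sub>R h))"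
      by (simp add: mult_left_mono)
  qed
  finally have "ennreal (c\<^sup>2) \<le> ennreal (LINT t|lborel. indicator {0..1} t *\<^sub>R ((norm h)\<^sup>2 * G (x + t *\<^sub>R h)))"
    by (rule ennreal_leI)
  also have "\<dots> = (\<integral>\<^sup>+t. ennreal (indicator {0..1} t *\<^sub>R ((norm h)\<^sup>2 * G (x + t *\<^sub>R h))) \<partial>lborel)"
    by (rule nn_integral_eq_integral[OF G_int, symmetric]) (simp add: G_def sum_nonneg)
  also have "\<dots> = (\<integral>\<^sup>+t. ennreal ((norm h)\<^sup>2) * (indicator {0..1} t * ennreal (G (x + t *\<^sub>R h))) \<partial>lborel)"
    by (intro nn_integral_cong) (simp add: ennreal_mult' indicator_def)
  also have "\<dots> = ennreal ((norm h)\<^sup>2) * (\<integral>\<^sup>+t. indicator {0..1} t * ennreal (G (x + t *\<^sub>R h)) \<partial>lborel)"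
  proof (rule nn_integral_cmult)
    have "(\<lambda>t. G (x + t *\<^sub>R h)) \<in> borel_measurable borel"
      by (rule borel_measurable_continuous_onI) (rule contG)
    then show "(\<lambda>t. indicator {0..1} t * ennreal (G (x + t *\<^sub>R h))) \<in> borel_measurable lborel"
      by measurable
  qed
  finally show ?thesis
    by (simp add: c_def G_def)
qed

lemma nn_integral_translate:
  fixes f :: "'a::euclidean_space \<Rightarrow> ennreal"
  assumes "f \<in> borel_measurable borel"
  shows "(\<integral>\<^sup>+x. f (x + c) \<partial>lborel) = (\<integral>\<^sup>+x. f x \<partial>lborel)"
proof -
  have "(\<integral>\<^sup>+x. f x \<partial>distr lborel borel ((+) c)) = (\<integral>\<^sup>+x. f (c + x) \<partial>lborel)"
    by (rule nn_integral_distr) (use assms in auto)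
  then show ?thesis
    by (simp add: lborel_distr_plus add.commute)
qed

text \<open>Integrate over x first: by translation invariance every parameter t of the segment
  contributes the full Dirichlet energy.\<close>

lemma translation_estimate:
  fixes \<phi> :: "'a::euclidean_space \<Rightarrow> real"
  assumes "test_function \<Omega> \<phi>" "open \<Omega>"
  shows "(\<integral>\<^sup>+x. ennreal ((\<phi> (x + h) - \<phi> x)\<^sup>2) \<partial>lborel) \<le> ennreal ((norm h)\<^sup>2 * dirichlet_energy \<Omega> \<phi>)"
proof -
  define G where "G y = (\<Sum>b\<in>Basis. (partial_deriv b \<phi> y)\<^sup>2)" for y
  have test: "test_function \<Omega> (partial_deriv b \<phi>)" if "b \<in> Basis" for b
    using assms(1) that by (rule test_function_partial)
  have cont: "continuous_on UNIV (partial_deriv b \<phi>)" if "b \<in> Basis" for b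
    using test[OF that] by (intro smooth_continuous test_function_smooth)
  have contG: "continuous_on UNIV G"
    unfolding G_def by (intro continuous_intros cont)
  then have G_borel [measurable]: "G \<in> borel_measurable borel"
    by (rule borel_measurable_continuous_onI)
  have int: "integrable lborel (\<lambda>x. (partial_deriv b \<phi> x)\<^sup>2)"
      "(LINT x|lborel. (partial_deriv b \<phi> x)\<^sup>2) = (L2_norm \<Omega> (partial_deriv b \<phi>))\<^sup>2"
    if "b \<in> Basis" for b
    using test_function_mult[OF test test assms(2), OF that that]
    by (simp_all add: L2_norm_power2 flip: power2_eq_square)
  have G_int: "(\<integral>\<^sup>+x. ennreal (G x) \<partial>lborel) = ennreal (dirichlet_energy \<Omega> \<phi>)"
  proof -
    have "integrable lborel G"
      unfolding G_def using int(1) by (rule Bochner_Integration.integrable_sum)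
    then have "(\<integral>\<^sup>+x. ennreal (G x) \<partial>lborel) = ennreal (LINT x|lborel. G x)"
      by (rule nn_integral_eq_integral) (simp add: G_def sum_nonneg)
    also have "(LINT x|lborel. G x) = dirichlet_energy \<Omega> \<phi>"
      unfolding G_def dirichlet_energy_def using int by (subst Bochner_Integration.integral_sum) auto
    finally show ?thesis .
  qed
  have "(\<integral>\<^sup>+x. ennreal ((\<phi> (x + h) - \<phi> x)\<^sup>2) \<partial>lborel) \<le>
      (\<integral>\<^sup>+x. ennreal ((norm h)\<^sup>2) * (\<integral>\<^sup>+t. indicator {0..1} t * ennreal (G (x + t *\<^sub>R h)) \<partial>lborel) \<partial>lborel)"
    unfolding G_def
    by (intro nn_integral_mono increment_square_le cont smooth_differentiable test_function_smooth[OF assms(1)])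
  also have "\<dots> = ennreal ((norm h)\<^sup>2) *
      (\<integral>\<^sup>+x. (\<integral>\<^sup>+t. indicator {0..1} t * ennreal (G (x + t *\<^sub>R h)) \<partial>lborel) \<partial>lborel)"
    by (rule nn_integral_cmult) measurable
  also have "(\<integral>\<^sup>+x. (\<integral>\<^sup>+t. indicator {0..1} t * ennreal (G (x + t *\<^sub>R h)) \<partial>lborel) \<partial>lborel) =
      (\<integral>\<^sup>+t. (\<integral>\<^sup>+x. indicator {0..1} t * ennreal (G (x + t *\<^sub>R h)) \<partial>lborel) \<partial>lborel)"
    by (rule lborel_pair.Fubini'[symmetric]) measurable
  also have "\<dots> = (\<integral>\<^sup>+(t::real). indicator {0..1} t * ennreal (dirichlet_energy \<Omega> \<phi>) \<partial>lborel)"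
  proof (rule nn_integral_cong)
    fix t :: real
    have "(\<integral>\<^sup>+x. indicator {0..1} t * ennreal (G (x + t *\<^sub>R h)) \<partial>lborel) =
        indicator {0..1} t * (\<integral>\<^sup>+x. ennreal (G (x + t *\<^sub>R h)) \<partial>lborel)"
      by (rule nn_integral_cmult) measurable
    also have "(\<integral>\<^sup>+x. ennreal (G (x + t *\<^sub>R h)) \<partial>lborel) = (\<integral>\<^sup>+x. ennreal (G x) \<partial>lborel)"
      by (rule nn_integral_translate[of "\<lambda>x. ennreal (G x)"]) measurable
    finally show "(\<integral>\<^sup>+x. indicator {0..1} t * ennreal (G (x + t *\<^sub>R h)) \<partial>lborel) =
        indicator {0..1} t * ennreal (dirichlet_energy \<Omega> \<phi>)"
      unfolding G_int .
  qed
  also have "\<dots> = ennreal (dirichlet_energy \<Omega> \<phi>)"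
    by (simp add: nn_integral_multc)
  finally show ?thesis
    by (simp add: ennreal_mult')
qed

section \<open>Cubes and local variances\<close>

definition grid_cube :: "real \<Rightarrow> ('a::euclidean_space \<Rightarrow> int) \<Rightarrow> 'a set" where
  "grid_cube \<epsilon> z = {x. \<forall>b\<in>Basis. \<epsilon> * real_of_int (z b) \<le> x \<bullet> b \<and> x \<bullet> b < \<epsilon> * (real_of_int (z b) + 1)}"

lemma grid_cube_measurable [measurable]: "grid_cube \<epsilon> z \<in> sets borel"
  unfolding grid_cube_def by measurable

lemma emeasure_grid_cube:
  fixes z :: "'a::euclidean_space \<Rightarrow> int"
  assumes "\<epsilon> > 0"
  shows "emeasure lborel (grid_cube \<epsilon> z) = ennreal (\<epsilon> ^ DIM('a))"
proof -
  define l where "l = (\<Sum>b\<in>Basis. (\<epsilon> * real_of_int (z b)) *\<^sub>R b :: 'a)"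
  define u where "u = (\<Sum>b\<in>Basis. (\<epsilon> * (real_of_int (z b) + 1)) *\<^sub>R b :: 'a)"
  have lu: "l \<bullet> b = \<epsilon> * real_of_int (z b)" "u \<bullet> b = \<epsilon> * (real_of_int (z b) + 1)" if "b \<in> Basis" for b
    using that by (simp_all add: l_def u_def)
  have le: "l \<bullet> b \<le> u \<bullet> b" if "b \<in> Basis" for b
    using that lu \<open>\<epsilon> > 0\<close> by simp
  have prod: "(\<Prod>b\<in>Basis. (u - l) \<bullet> b) = \<epsilon> ^ DIM('a)"
    using lu by (simp add: inner_diff_left algebra_simps)
  have "box l u \<subseteq> grid_cube \<epsilon> z"
    using lu by (auto simp: grid_cube_def box_def less_imp_le)
  then have "emeasure lborel (box l u) \<le> emeasure lborel (grid_cube \<epsilon> z)"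
    by (rule emeasure_mono) simp
  moreover have "grid_cube \<epsilon> z \<subseteq> cbox l u"
    using lu by (auto simp: grid_cube_def cbox_def less_imp_le)
  then have "emeasure lborel (grid_cube \<epsilon> z) \<le> emeasure lborel (cbox l u)"
    by (rule emeasure_mono) simp
  ultimately show ?thesis
    using le prod by (simp add: emeasure_lborel_box emeasure_lborel_cbox)
qed

lemma grid_cube_floor:
  assumes "\<epsilon> > 0" "x \<in> grid_cube \<epsilon> z" "b \<in> Basis"
  shows "z b = \<lfloor>x \<bullet> b / \<epsilon>\<rfloor>"
  using assms by (auto simp: grid_cube_def field_simps intro!: floor_unique[symmetric])

lemma bounded_grid_cover:
  fixes \<Omega> :: "'a::euclidean_space set"
  assumes "bounded \<Omega>" "\<epsilon> > 0"
  obtains Z where "finite Z" "\<Omega> \<subseteq> (\<Union>z\<in>Z. grid_cube \<epsilon> z)"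
    "\<And>z z'. z \<in> Z \<Longrightarrow> z' \<in> Z \<Longrightarrow> z \<noteq> z' \<Longrightarrow> grid_cube \<epsilon> z \<inter> grid_cube \<epsilon> z' = {}"
proof -
  obtain M where M: "\<And>x. x \<in> \<Omega> \<Longrightarrow> norm x \<le> M"
    using assms(1) by (auto simp: bounded_iff)
  define K where "K = \<lceil>M / \<epsilon>\<rceil> + 1"
  \<comment> \<open>A cube depends only on the values of its index on \<open>Basis\<close>;
    extensional indices are determined by these values, so different members of \<open>Z\<close>
    have disjoint cubes.\<close>
  define Z where "Z = (PiE Basis (\<lambda>_. {- K..K}) :: ('a \<Rightarrow> int) set)"
  have fin: "finite Z"
    unfolding Z_def by (intro finite_PiE) auto
  have cover: "\<Omega> \<subseteq> (\<Union>z\<in>Z. grid_cube \<epsilon> z)"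
  proof
    fix x assume "x \<in> \<Omega>"
    define z where "z = (\<lambda>b\<in>Basis. \<lfloor>x \<bullet> b / \<epsilon>\<rfloor>)"
    have "\<lfloor>x \<bullet> b / \<epsilon>\<rfloor> \<in> {- K..K}" if "b \<in> Basis" for b
    proof -
      have "\<bar>x \<bullet> b\<bar> \<le> M"
        using Basis_le_norm[OF that, of x] M[OF \<open>x \<in> \<Omega>\<close>] by simp
      then have "- (M / \<epsilon>) \<le> x \<bullet> b / \<epsilon>" "x \<bullet> b / \<epsilon> \<le> M / \<epsilon>"
        using \<open>\<epsilon> > 0\<close> by (simp_all add: field_simps)
      then show ?thesis
        unfolding K_def atLeastAtMost_iff by linarith
    qed
    then have "z \<in> Z"
      by (auto simp: Z_def z_def)
    moreover have "x \<in> grid_cube \<epsilon> z"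
      unfolding grid_cube_def z_def
    proof (intro CollectI ballI)
      fix b :: 'a assume "b \<in> Basis"
      have "real_of_int \<lfloor>x \<bullet> b / \<epsilon>\<rfloor> \<le> x \<bullet> b / \<epsilon>" "x \<bullet> b / \<epsilon> < real_of_int \<lfloor>x \<bullet> b / \<epsilon>\<rfloor> + 1"
        by linarith+
      then show "\<epsilon> * real_of_int ((\<lambda>b\<in>Basis. \<lfloor>x \<bullet> b / \<epsilon>\<rfloor>) b) \<le> x \<bullet> b \<and>
          x \<bullet> b < \<epsilon> * (real_of_int ((\<lambda>b\<in>Basis. \<lfloor>x \<bullet> b / \<epsilon>\<rfloor>) b) + 1)"
        using \<open>\<epsilon> > 0\<close> \<open>b \<in> Basis\<close> mult_left_mono[of "real_of_int \<lfloor>x \<bullet> b / \<epsilon>\<rfloor>" "x \<bullet> b / \<epsilon>" \<epsilon>]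
          mult_strict_left_mono[of "x \<bullet> b / \<epsilon>" "real_of_int \<lfloor>x \<bullet> b / \<epsilon>\<rfloor> + 1" \<epsilon>]
        by (simp only: restrict_apply') simp
    qed
    ultimately show "x \<in> (\<Union>z\<in>Z. grid_cube \<epsilon> z)" by blast
  qed
  have disj: "grid_cube \<epsilon> z \<inter> grid_cube \<epsilon> z' = {}" if z: "z \<in> Z" "z' \<in> Z" "z \<noteq> z'" for z z'
  proof (rule ccontr)
    assume "grid_cube \<epsilon> z \<inter> grid_cube \<epsilon> z' \<noteq> {}"
    then obtain x where "x \<in> grid_cube \<epsilon> z" "x \<in> grid_cube \<epsilon> z'" by auto
    then have "z b = z' b" if "b \<in> Basis" for b
      using grid_cube_floor[OF \<open>\<epsilon> > 0\<close> _ that] by metis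
    then have "z = z'"
      using z(1,2) unfolding Z_def by (rule PiE_ext[rotated 2])
    then show False using z by simp
  qed
  show ?thesis using that[OF fin cover disj] by blast
qed

text \<open>Expand the square. Divided by 2 V, the double integral is the squared norm on Q minus
  the part c^2 / V carried by the mean value, which is the quantity that a local Poincare inequality
  has to bound.\<close>

lemma variance_identity:
  fixes \<phi> :: "'a \<Rightarrow> real"
  assumes Q: "Q \<in> sets M" "emeasure M Q = ennreal V" "V \<ge> 0"
    and int: "integrable M (\<lambda>x. indicator Q x * \<phi> x)" "integrable M (\<lambda>x. indicator Q x * (\<phi> x)\<^sup>2)"
  defines "c \<equiv> LINT x|M. indicator Q x * \<phi> x" and "s \<equiv> LINT x|M. indicator Q x * (\<phi> x)\<^sup>2"
  shows "(\<integral>\<^sup>+x. (\<integral>\<^sup>+y. ennreal (indicator Q x * (indicator Q y * (\<phi> y - \<phi> x)\<^sup>2)) \<partial>M) \<partial>M) =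
      ennreal (2 * V * s - 2 * c\<^sup>2)" and "2 * V * s - 2 * c\<^sup>2 \<ge> 0"
proof -
  have one: "integrable M (\<lambda>y. indicator Q y :: real)" "(LINT y|M. indicator Q y) = V"
    using Q by (auto simp: measure_def intro!: integrable_real_indicator)
  define I where "I x = V * (\<phi> x)\<^sup>2 - 2 * \<phi> x * c + s" for x
  have inner: "integrable M (\<lambda>y. indicator Q y * (\<phi> y - \<phi> x)\<^sup>2)"
      "(LINT y|M. indicator Q y * (\<phi> y - \<phi> x)\<^sup>2) = I x" for x
  proof -
    have eq: "(\<lambda>y. indicator Q y * (\<phi> y - \<phi> x)\<^sup>2) =
        (\<lambda>y. (\<phi> x)\<^sup>2 * indicator Q y - 2 * \<phi> x * (indicator Q y * \<phi> y) + indicator Q y * (\<phi> y)\<^sup>2)"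
      by (simp add: fun_eq_iff power2_diff algebra_simps)
    show "integrable M (\<lambda>y. indicator Q y * (\<phi> y - \<phi> x)\<^sup>2)"
      unfolding eq using one int by simp
    show "(LINT y|M. indicator Q y * (\<phi> y - \<phi> x)\<^sup>2) = I x"
      unfolding eq using one int by (simp add: I_def c_def s_def)
  qed
  have I_nonneg: "I x \<ge> 0" for x
    unfolding inner(2)[symmetric] by (intro Bochner_Integration.integral_nonneg) simp
  have eq: "(\<lambda>x. indicator Q x * I x) =
      (\<lambda>x. V * (indicator Q x * (\<phi> x)\<^sup>2) - 2 * c * (indicator Q x * \<phi> x) + s * indicator Q x)"
    by (simp add: fun_eq_iff I_def algebra_simps)
  have outer: "integrable M (\<lambda>x. indicator Q x * I x)" "(LINT x|M. indicator Q x * I x) = 2 * V * s - 2 * c\<^sup>2"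
    unfolding eq using one int by (simp_all add: c_def s_def power2_eq_square)
  have "(\<integral>\<^sup>+x. (\<integral>\<^sup>+y. ennreal (indicator Q x * (indicator Q y * (\<phi> y - \<phi> x)\<^sup>2)) \<partial>M) \<partial>M) =
      (\<integral>\<^sup>+x. ennreal (indicator Q x * I x) \<partial>M)"
  proof (rule nn_integral_cong)
    fix x
    show "(\<integral>\<^sup>+y. ennreal (indicator Q x * (indicator Q y * (\<phi> y - \<phi> x)\<^sup>2)) \<partial>M) = ennreal (indicator Q x * I x)"
      using nn_integral_eq_integral[OF inner(1)[of x]] inner(2)[of x] by (simp add: indicator_def)
  qed
  also have "\<dots> = ennreal (2 * V * s - 2 * c\<^sup>2)"
    unfolding outer(2)[symmetric] by (rule nn_integral_eq_integral[OF outer(1)]) (simp add: I_nonneg)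
  finally show "(\<integral>\<^sup>+x. (\<integral>\<^sup>+y. ennreal (indicator Q x * (indicator Q y * (\<phi> y - \<phi> x)\<^sup>2)) \<partial>M) \<partial>M) =
      ennreal (2 * V * s - 2 * c\<^sup>2)" .
  show "2 * V * s - 2 * c\<^sup>2 \<ge> 0"
    unfolding outer(2)[symmetric] by (intro Bochner_Integration.integral_nonneg) (simp add: I_nonneg)
qed

text \<open>Exchange the integrals and apply \<open>translation_estimate\<close> to each shift h of
  the window. The window has volume (2 \<epsilon>)^d, and there |h|^2 \<le> d \<epsilon>^2.\<close>

lemma near_diagonal_estimate:
  fixes \<phi> :: "'a::euclidean_space \<Rightarrow> real" and \<epsilon> :: real
  assumes "test_function \<Omega> \<phi>" "open \<Omega>" "\<epsilon> > 0"
  shows "(\<integral>\<^sup>+x. (\<integral>\<^sup>+h. indicator (cbox (- \<epsilon> *\<^sub>R One) (\<epsilon> *\<^sub>R One)) h * ennreal ((\<phi> (x + h) - \<phi> x)\<^sup>2) \<partial>lborel) \<partial>lborel)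
    \<le> ennreal ((2 * \<epsilon>) ^ DIM('a) * (DIM('a) * \<epsilon>\<^sup>2 * dirichlet_energy \<Omega> \<phi>))"
proof -
  let ?W = "cbox (- \<epsilon> *\<^sub>R One) (\<epsilon> *\<^sub>R One) :: 'a set"
  have [measurable]: "\<phi> \<in> borel_measurable borel"
    using assms(1) by (intro borel_measurable_continuous_onI smooth_continuous test_function_smooth)
  have E: "dirichlet_energy \<Omega> \<phi> \<ge> 0"
    by (simp add: dirichlet_energy_def sum_nonneg)
  have W: "(norm h)\<^sup>2 \<le> DIM('a) * \<epsilon>\<^sup>2" if "h \<in> ?W" for h
  proof -
    have "(norm h)\<^sup>2 = (\<Sum>b\<in>Basis. (h \<bullet> b)\<^sup>2)"
      unfolding power2_norm_eq_inner by (simp add: euclidean_inner[of h h] power2_eq_square)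
    also have "\<dots> \<le> (\<Sum>b\<in>(Basis :: 'a set). \<epsilon>\<^sup>2)"
      using that by (intro sum_mono) (auto simp: mem_box abs_le_iff abs_le_square_iff[symmetric])
    finally show ?thesis by simp
  qed
  have "(\<integral>\<^sup>+x. (\<integral>\<^sup>+h. indicator ?W h * ennreal ((\<phi> (x + h) - \<phi> x)\<^sup>2) \<partial>lborel) \<partial>lborel) =
      (\<integral>\<^sup>+h. (\<integral>\<^sup>+x. indicator ?W h * ennreal ((\<phi> (x + h) - \<phi> x)\<^sup>2) \<partial>lborel) \<partial>lborel)"
    by (rule lborel_pair.Fubini'[symmetric]) measurable
  also have "\<dots> = (\<integral>\<^sup>+h. indicator ?W h * (\<integral>\<^sup>+x. ennreal ((\<phi> (x + h) - \<phi> x)\<^sup>2) \<partial>lborel) \<partial>lborel)"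
    by (intro nn_integral_cong nn_integral_cmult) measurable
  also have "\<dots> \<le> (\<integral>\<^sup>+h. indicator ?W h * ennreal (DIM('a) * \<epsilon>\<^sup>2 * dirichlet_energy \<Omega> \<phi>) \<partial>lborel)"
  proof (rule nn_integral_mono)
    fix h
    show "indicator ?W h * (\<integral>\<^sup>+x. ennreal ((\<phi> (x + h) - \<phi> x)\<^sup>2) \<partial>lborel) \<le>
        indicator ?W h * ennreal (DIM('a) * \<epsilon>\<^sup>2 * dirichlet_energy \<Omega> \<phi>)"
    proof (cases "h \<in> ?W")
      case True
      have "(\<integral>\<^sup>+x. ennreal ((\<phi> (x + h) - \<phi> x)\<^sup>2) \<partial>lborel) \<le> ennreal ((norm h)\<^sup>2 * dirichlet_energy \<Omega> \<phi>)"
        by (rule translation_estimate[OF assms(1,2)])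
      also have "\<dots> \<le> ennreal (DIM('a) * \<epsilon>\<^sup>2 * dirichlet_energy \<Omega> \<phi>)"
        using W[OF True] E by (intro ennreal_leI mult_right_mono)
      finally show ?thesis using True by simp
    qed simp
  qed
  also have "\<dots> = (\<integral>\<^sup>+h. ennreal (DIM('a) * \<epsilon>\<^sup>2 * dirichlet_energy \<Omega> \<phi>) * indicator ?W h \<partial>lborel)"
    by (simp only: mult.commute)
  also have "\<dots> = ennreal (DIM('a) * \<epsilon>\<^sup>2 * dirichlet_energy \<Omega> \<phi>) * emeasure lborel ?W"
    by (rule nn_integral_cmult_indicator) simp
  also have "emeasure lborel ?W = ennreal ((2 * \<epsilon>) ^ DIM('a))"
  proof -
    have "emeasure lborel ?W = ennreal (\<Prod>b\<in>Basis. (\<epsilon> *\<^sub>R One - - \<epsilon> *\<^sub>R One) \<bullet> (b :: 'a))"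
      using \<open>\<epsilon> > 0\<close> by (intro emeasure_lborel_cbox) simp
    also have "(\<Prod>b\<in>Basis. (\<epsilon> *\<^sub>R One - - \<epsilon> *\<^sub>R One) \<bullet> (b :: 'a)) = (\<Prod>b\<in>(Basis :: 'a set). 2 * \<epsilon>)"
      by (intro prod.cong refl) (simp add: inner_diff_left inner_add_left)
    finally show ?thesis by simp
  qed
  finally show ?thesis
    using E \<open>\<epsilon> > 0\<close> by (simp add: ennreal_mult'[symmetric] mult.commute)
qed


text \<open>Two points of one cube differ by a shift in the window of half side \<epsilon>. As the
  cubes are disjoint, the sum of their double integrals is at most one near-diagonal integral;
  division by 2 \<epsilon>^d gives the constants.\<close>

lemma L2_norm_le_cubes:
  fixes \<phi> :: "'a::euclidean_space \<Rightarrow> real" and \<epsilon> :: real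
  assumes \<phi>: "test_function \<Omega> \<phi>" "open \<Omega>" and "\<epsilon> > 0"
    and Z: "finite Z" "\<Omega> \<subseteq> (\<Union>z\<in>Z. grid_cube \<epsilon> z)"
      "\<And>z z'. z \<in> Z \<Longrightarrow> z' \<in> Z \<Longrightarrow> z \<noteq> z' \<Longrightarrow> grid_cube \<epsilon> z \<inter> grid_cube \<epsilon> z' = {}"
  shows "(L2_norm \<Omega> \<phi>)\<^sup>2 \<le> 2 ^ DIM('a) * DIM('a) * \<epsilon>\<^sup>2 / 2 * dirichlet_energy \<Omega> \<phi> +
    (1 / \<epsilon> ^ DIM('a)) * (\<Sum>z\<in>Z. (L2_inner \<Omega> \<phi> (indicator (grid_cube \<epsilon> z)))\<^sup>2)"
proof -
  let ?Q = "grid_cube \<epsilon> :: ('a \<Rightarrow> int) \<Rightarrow> 'a set" and ?E = "dirichlet_energy \<Omega> \<phi>"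
  let ?W = "cbox (- \<epsilon> *\<^sub>R One) (\<epsilon> *\<^sub>R One) :: 'a set"
  define V where "V = \<epsilon> ^ DIM('a)"
  have "V > 0" using \<open>\<epsilon> > 0\<close> by (simp add: V_def)
  have cont: "continuous_on UNIV \<phi>"
    using \<phi>(1) by (intro smooth_continuous test_function_smooth)
  then have [measurable]: "\<phi> \<in> borel_measurable borel"
    by (rule borel_measurable_continuous_onI)
  have int\<phi>: "integrable lborel \<phi>"
    by (rule compact_support_integrable[OF cont test_function_compact[OF \<phi>(1)]]) (rule eq_0_outside_support)
  have int\<phi>2: "integrable lborel (\<lambda>x. (\<phi> x)\<^sup>2)" "(L2_norm \<Omega> \<phi>)\<^sup>2 = (LINT x|lborel. (\<phi> x)\<^sup>2)"
    using test_function_mult[OF \<phi>(1,1,2)] by (simp_all add: L2_norm_power2 flip: power2_eq_square)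
  have intQ: "integrable lborel (\<lambda>x. indicator (?Q z) x * \<phi> x)"
    "integrable lborel (\<lambda>x. indicator (?Q z) x * (\<phi> x)\<^sup>2)" for z
    using integrable_mult_indicator[OF _ int\<phi>, of "?Q z"] integrable_mult_indicator[OF _ int\<phi>2(1), of "?Q z"]
    by simp_all
  define c where "c z = (LINT x|lborel. indicator (?Q z) x * \<phi> x)" for z
  define s where "s z = (LINT x|lborel. indicator (?Q z) x * (\<phi> x)\<^sup>2)" for z
  have c_eq: "L2_inner \<Omega> \<phi> (indicator (?Q z)) = c z" for z
    unfolding L2_inner_def c_def using test_function_eq_0[OF \<phi>(1)]
    by (subst borel_integral_restrict(2)[OF _ _ \<phi>(2)]) (auto simp: mult.commute)
  have sum1: "(\<Sum>z\<in>Z. indicator (?Q z) x) = (1 :: real)" if "x \<in> \<Omega>" for x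
  proof -
    from that Z(2) obtain z0 where "z0 \<in> Z" "x \<in> ?Q z0" by auto
    have "(\<Sum>z\<in>Z. indicator (?Q z) x :: real) = (\<Sum>z\<in>{z0}. indicator (?Q z) x)"
      using \<open>z0 \<in> Z\<close> \<open>x \<in> ?Q z0\<close> Z(1) Z(3)[OF \<open>z0 \<in> Z\<close>]
      by (intro sum.mono_neutral_right) (auto simp: indicator_def)
    then show ?thesis using \<open>x \<in> ?Q z0\<close> by simp
  qed
  have sum_s: "(\<Sum>z\<in>Z. s z) = (L2_norm \<Omega> \<phi>)\<^sup>2"
  proof -
    have "(\<Sum>z\<in>Z. s z) = (LINT x|lborel. (\<Sum>z\<in>Z. indicator (?Q z) x * (\<phi> x)\<^sup>2))"
      unfolding s_def by (rule Bochner_Integration.integral_sum[symmetric]) (rule intQ)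
    also have "\<dots> = (LINT x|lborel. (\<phi> x)\<^sup>2)"
    proof (rule Bochner_Integration.integral_cong[OF refl])
      fix x
      show "(\<Sum>z\<in>Z. indicator (?Q z) x * (\<phi> x)\<^sup>2) = (\<phi> x)\<^sup>2"
        using sum1[of x] test_function_eq_0[OF \<phi>(1), of x]
        by (cases "x \<in> \<Omega>") (simp_all flip: sum_distrib_right)
    qed
    finally show ?thesis by (simp add: int\<phi>2)
  qed
  have var: "(\<integral>\<^sup>+x. (\<integral>\<^sup>+y. ennreal (indicator (?Q z) x * (indicator (?Q z) y * (\<phi> y - \<phi> x)\<^sup>2)) \<partial>lborel) \<partial>lborel) =
      ennreal (2 * V * s z - 2 * (c z)\<^sup>2)" "2 * V * s z - 2 * (c z)\<^sup>2 \<ge> 0" for z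
    using variance_identity[of "?Q z" lborel V \<phi>] emeasure_grid_cube[OF \<open>\<epsilon> > 0\<close>, of z] \<open>V > 0\<close> intQ[of z]
    by (simp_all add: V_def c_def s_def)
  let ?k = "\<lambda>x. \<integral>\<^sup>+h. indicator ?W h * ennreal ((\<phi> (x + h) - \<phi> x)\<^sup>2) \<partial>lborel"
  have cube_le: "(\<integral>\<^sup>+y. ennreal (indicator (?Q z) x * (indicator (?Q z) y * (\<phi> y - \<phi> x)\<^sup>2)) \<partial>lborel) \<le>
      indicator (?Q z) x * ?k x" for x z
  proof (cases "x \<in> ?Q z")
    case True
    have "(\<integral>\<^sup>+y. ennreal (indicator (?Q z) x * (indicator (?Q z) y * (\<phi> y - \<phi> x)\<^sup>2)) \<partial>lborel) =
        (\<integral>\<^sup>+h. ennreal (indicator (?Q z) x * (indicator (?Q z) (h + x) * (\<phi> (h + x) - \<phi> x)\<^sup>2)) \<partial>lborel)"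
      by (rule nn_integral_translate[symmetric,
          of "\<lambda>y. ennreal (indicator (?Q z) x * (indicator (?Q z) y * (\<phi> y - \<phi> x)\<^sup>2))"]) measurable
    also have "\<dots> \<le> ?k x"
    proof (rule nn_integral_mono)
      fix h
      show "ennreal (indicator (?Q z) x * (indicator (?Q z) (h + x) * (\<phi> (h + x) - \<phi> x)\<^sup>2)) \<le>
          indicator ?W h * ennreal ((\<phi> (x + h) - \<phi> x)\<^sup>2)"
      proof (cases "h + x \<in> ?Q z")
        case h: True
        have "h \<in> ?W"
          unfolding mem_box
        proof
          fix b :: 'a assume b: "b \<in> Basis"
          have "\<epsilon> * real_of_int (z b) \<le> x \<bullet> b" "x \<bullet> b < \<epsilon> * (real_of_int (z b) + 1)"
            "\<epsilon> * real_of_int (z b) \<le> h \<bullet> b + x \<bullet> b" "h \<bullet> b + x \<bullet> b < \<epsilon> * (real_of_int (z b) + 1)"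
            using True h b by (auto simp: grid_cube_def inner_add_left)
          then show "(- \<epsilon> *\<^sub>R One) \<bullet> b \<le> h \<bullet> b \<and> h \<bullet> b \<le> (\<epsilon> *\<^sub>R One) \<bullet> b"
            using b by (simp add: algebra_simps)
        qed
        then show ?thesis
          using True h by (simp add: add.commute)
      qed simp
    qed
    finally show ?thesis using True by simp
  qed simp
  have sum1': "(\<Sum>z\<in>Z. indicator (?Q z) x) \<le> (1 :: ennreal)" for x
  proof (cases "\<exists>z0\<in>Z. x \<in> ?Q z0")
    case True
    then obtain z0 where "z0 \<in> Z" "x \<in> ?Q z0" by auto
    have "(\<Sum>z\<in>Z. indicator (?Q z) x :: ennreal) = (\<Sum>z\<in>{z0}. indicator (?Q z) x)"
      using \<open>z0 \<in> Z\<close> \<open>x \<in> ?Q z0\<close> Z(1) Z(3)[OF \<open>z0 \<in> Z\<close>]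
      by (intro sum.mono_neutral_right) (auto simp: indicator_def)
    then show ?thesis using \<open>x \<in> ?Q z0\<close> by simp
  next
    case False
    then have "(\<Sum>z\<in>Z. indicator (?Q z) x :: ennreal) = 0"
      by (intro sum.neutral) (auto simp: indicator_def)
    then show ?thesis by simp
  qed
  have k_meas: "?k \<in> borel_measurable lborel" by measurable
  have E: "?E \<ge> 0" by (simp add: dirichlet_energy_def sum_nonneg)
  have "ennreal (\<Sum>z\<in>Z. 2 * V * s z - 2 * (c z)\<^sup>2) = (\<Sum>z\<in>Z. ennreal (2 * V * s z - 2 * (c z)\<^sup>2))"
    by (rule sum_ennreal[symmetric]) (rule var)
  also have "\<dots> \<le> (\<Sum>z\<in>Z. \<integral>\<^sup>+x. indicator (?Q z) x * ?k x \<partial>lborel)"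
    unfolding var(1)[symmetric] by (intro sum_mono nn_integral_mono cube_le)
  also have "\<dots> = (\<integral>\<^sup>+x. (\<Sum>z\<in>Z. indicator (?Q z) x * ?k x) \<partial>lborel)"
    by (rule nn_integral_sum[symmetric]) (use k_meas in measurable)
  also have "\<dots> \<le> (\<integral>\<^sup>+x. ?k x \<partial>lborel)"
  proof (rule nn_integral_mono)
    fix x
    show "(\<Sum>z\<in>Z. indicator (?Q z) x * ?k x) \<le> ?k x"
      unfolding sum_distrib_right[symmetric] using mult_right_mono[OF sum1'[of x], of "?k x"] by simp
  qed
  also have "\<dots> \<le> ennreal ((2 * \<epsilon>) ^ DIM('a) * (DIM('a) * \<epsilon>\<^sup>2 * ?E))"
    by (rule near_diagonal_estimate[OF \<phi> \<open>\<epsilon> > 0\<close>])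
  finally have "(\<Sum>z\<in>Z. 2 * V * s z - 2 * (c z)\<^sup>2) \<le> (2 * \<epsilon>) ^ DIM('a) * (DIM('a) * \<epsilon>\<^sup>2 * ?E)"
    using E \<open>\<epsilon> > 0\<close> by (simp add: ennreal_le_iff)
  moreover have "(\<Sum>z\<in>Z. 2 * V * s z - 2 * (c z)\<^sup>2) = 2 * V * (L2_norm \<Omega> \<phi>)\<^sup>2 - 2 * (\<Sum>z\<in>Z. (c z)\<^sup>2)"
    by (simp add: sum_subtractf sum_s flip: sum_distrib_left)
  ultimately have "2 * V * (L2_norm \<Omega> \<phi>)\<^sup>2 - 2 * (\<Sum>z\<in>Z. (c z)\<^sup>2) \<le> V * (2 ^ DIM('a) * (DIM('a) * \<epsilon>\<^sup>2 * ?E))"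
    by (simp add: power_mult_distrib V_def mult_ac)
  then have "(L2_norm \<Omega> \<phi>)\<^sup>2 \<le> 2 ^ DIM('a) * DIM('a) * \<epsilon>\<^sup>2 / 2 * ?E + (1 / V) * (\<Sum>z\<in>Z. (c z)\<^sup>2)"
    using \<open>V > 0\<close> by (simp add: field_simps)
  then show ?thesis
    unfolding c_eq V_def .
qed

text \<open>Rellich's theorem in quantitative form: up to a small multiple of the energy, the norm
  is seen by finitely many functionals, the integrals over the cubes of a fine grid. Boundedness of
  the domain keeps their number finite.\<close>

lemma rellich_inequality:
  fixes \<Omega> :: "'a::euclidean_space set"
  assumes "bounded \<Omega>" "open \<Omega>" "\<eta> > 0"
  obtains G :: "('a \<Rightarrow> real) set" and C :: real where "finite G" "G \<subseteq> L2 \<Omega>" "C \<ge> 0"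
    "\<And>\<phi>. test_function \<Omega> \<phi> \<Longrightarrow>
      (L2_norm \<Omega> \<phi>)\<^sup>2 \<le> \<eta> * dirichlet_energy \<Omega> \<phi> + C * (\<Sum>g\<in>G. (L2_inner \<Omega> \<phi> g)\<^sup>2)"
proof -
  \<comment> \<open>This makes 2^d d \<epsilon>^2 equal to \<eta>, twice what the estimate asks
    for.\<close>
  define \<epsilon> where "\<epsilon> = sqrt (\<eta> / (2 ^ DIM('a) * DIM('a)))"
  have "\<epsilon> > 0" using \<open>\<eta> > 0\<close> by (simp add: \<epsilon>_def)
  have \<epsilon>: "2 ^ DIM('a) * DIM('a) * \<epsilon>\<^sup>2 / 2 \<le> \<eta>"
    using \<open>\<eta> > 0\<close> by (simp add: \<epsilon>_def)
  obtain Z :: "('a \<Rightarrow> int) set" where Z: "finite Z" "\<Omega> \<subseteq> (\<Union>z\<in>Z. grid_cube \<epsilon> z)"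
    "\<And>z z'. z \<in> Z \<Longrightarrow> z' \<in> Z \<Longrightarrow> z \<noteq> z' \<Longrightarrow> grid_cube \<epsilon> z \<inter> grid_cube \<epsilon> z' = {}"
    using bounded_grid_cover[OF assms(1) \<open>\<epsilon> > 0\<close>] by blast
  define g where "g z = (indicator (grid_cube \<epsilon> z) :: 'a \<Rightarrow> real)" for z
  have bound: "(L2_norm \<Omega> \<phi>)\<^sup>2 \<le> \<eta> * dirichlet_energy \<Omega> \<phi> + (Z_card / \<epsilon> ^ DIM('a)) * (\<Sum>g\<in>g ` Z. (L2_inner \<Omega> \<phi> g)\<^sup>2)"
    if "test_function \<Omega> \<phi>" and Z_card: "Z_card = real (card Z)" for \<phi> Z_card
  proof -
    \<comment> \<open>Each term is bounded by the whole sum over the image of \<open>Z\<close>. This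
      costs a factor \<open>card Z\<close> and replaces a proof that different indices give
      different indicators.\<close>
    have "(\<Sum>z\<in>Z. (L2_inner \<Omega> \<phi> (g z))\<^sup>2) \<le> (\<Sum>z\<in>Z. \<Sum>g\<in>g ` Z. (L2_inner \<Omega> \<phi> g)\<^sup>2)"
      using Z(1) by (intro sum_mono member_le_sum) auto
    also have "\<dots> = Z_card * (\<Sum>g\<in>g ` Z. (L2_inner \<Omega> \<phi> g)\<^sup>2)"
      by (simp add: Z_card)
    finally have "(1 / \<epsilon> ^ DIM('a)) * (\<Sum>z\<in>Z. (L2_inner \<Omega> \<phi> (g z))\<^sup>2) \<le>
        (1 / \<epsilon> ^ DIM('a)) * (Z_card * (\<Sum>g\<in>g ` Z. (L2_inner \<Omega> \<phi> g)\<^sup>2))"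
      using \<open>\<epsilon> > 0\<close> by (intro mult_left_mono) auto
    moreover have "2 ^ DIM('a) * DIM('a) * \<epsilon>\<^sup>2 / 2 * dirichlet_energy \<Omega> \<phi> \<le> \<eta> * dirichlet_energy \<Omega> \<phi>"
      using \<epsilon> by (rule mult_right_mono) (simp add: dirichlet_energy_def sum_nonneg)
    ultimately show ?thesis
      using L2_norm_le_cubes[OF that(1) assms(2) \<open>\<epsilon> > 0\<close> Z] by (simp add: g_def)
  qed
  have "g ` Z \<subseteq> L2 \<Omega>"
  proof
    fix f assume "f \<in> g ` Z"
    then obtain z where f: "f = indicator (grid_cube \<epsilon> z)" by (auto simp: g_def)
    have borel: "f \<in> borel_measurable borel" unfolding f by measurable
    have meas: "f \<in> borel_measurable (lebesgue_on \<Omega>)"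
      by (rule measurable_restrict_space1) (use borel in \<open>simp add: measurable_completion\<close>)
    have "emeasure (lebesgue_on \<Omega>) \<Omega> < \<infinity>"
      using assms(2) emeasure_bounded_finite[OF assms(1)] by (simp add: emeasure_restrict_space borel_open)
    then have "integrable (lebesgue_on \<Omega>) (\<lambda>x. 1 :: real)"
      using assms by (simp add: integrable_iff_bounded)
    then have "integrable (lebesgue_on \<Omega>) (\<lambda>x. (f x)\<^sup>2)"
    proof (rule Bochner_Integration.integrable_bound)
      show "(\<lambda>x. (f x)\<^sup>2) \<in> borel_measurable (lebesgue_on \<Omega>)" using meas by measurable
    qed (simp add: f indicator_def)
    with meas show "f \<in> L2 \<Omega>" by (simp add: L2_def)
  qed
  then show ?thesis
    using that[of "g ` Z" "real (card Z) / \<epsilon> ^ DIM('a)"] Z(1) bound \<open>\<epsilon> > 0\<close> by simp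
qed

section \<open>The square root of the Dirichlet Laplacian\<close>

lemma simultaneous_convergent_subsequence:
  fixes f :: "'a \<Rightarrow> nat \<Rightarrow> real"
  assumes "finite G" "\<And>g. g \<in> G \<Longrightarrow> bounded (range (f g))"
  shows "\<exists>r. strict_mono r \<and> (\<forall>g\<in>G. convergent (\<lambda>n. f g (r n)))"
  using assms
proof (induction G rule: finite_induct)
  case empty
  show ?case by (auto intro: strict_mono_id)
next
  case (insert g G)
  then obtain r where r: "strict_mono r" "\<forall>g\<in>G. convergent (\<lambda>n. f g (r n))" by auto
  have "bounded (range (\<lambda>n. f g (r n)))"
    using insert.prems[of g] by (auto intro: bounded_subset)
  then obtain l r' where r': "strict_mono r'" "((\<lambda>n. f g (r n)) \<circ> r') \<longlonglongrightarrow> l"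
    using bounded_imp_convergent_subsequence by blast
  have "convergent (\<lambda>n. f k (r (r' n)))" if "k \<in> insert g G" for k
  proof (cases "k = g")
    case True
    then show ?thesis using r'(2) by (auto simp: convergent_def o_def)
  next
    case False
    then have "convergent (\<lambda>n. f k (r n))" using r(2) that by simp
    then show ?thesis
      using convergent_subseq_convergent[of "\<lambda>n. f k (r n)" r'] r'(1) by (simp add: o_def)
  qed
  moreover have "strict_mono (\<lambda>n. r (r' n))"
    using strict_mono_o[OF r(1) r'(1)] by (simp only: o_def)
  ultimately show ?case
    by (intro exI[of _ "\<lambda>n. r (r' n)"] conjI ballI)
qed

lemma linear_term_eq_0:
  fixes X Y :: real
  assumes "\<And>s. 0 \<le> 2 * s * X + s\<^sup>2 * Y"
  shows "X = 0"
proof (rule ccontr)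
  assume "X \<noteq> 0"
  \<comment> \<open>The denominator makes the quadratic term at most half as large as the linear
    one, which is negative for this sign of \<open>s\<close>.\<close>
  define s where "s = - X / (1 + \<bar>Y\<bar>)"
  have "s\<^sup>2 * Y \<le> s\<^sup>2 * (1 + \<bar>Y\<bar>)" by (intro mult_left_mono) auto
  also have "\<dots> = - s * X" by (simp add: s_def power2_eq_square)
  finally have "2 * s * X + s\<^sup>2 * Y \<le> s * X" by linarith
  moreover have "s * X < 0"
    using \<open>X \<noteq> 0\<close> by (simp add: s_def divide_neg_pos power2_eq_square[symmetric])
  ultimately show False using assms[of s] by linarith
qed

lemma L2_tendsto_comb:
  assumes "\<And>n. f n \<in> L2 \<Omega>" "f0 \<in> L2 \<Omega>" "(\<lambda>n. L2_norm \<Omega> (\<lambda>x. f n x - f0 x)) \<longlonglongrightarrow> 0"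
    and "\<And>n. g n \<in> L2 \<Omega>" "g0 \<in> L2 \<Omega>" "(\<lambda>n. L2_norm \<Omega> (\<lambda>x. g n x - g0 x)) \<longlonglongrightarrow> 0"
  shows "(\<lambda>n. L2_norm \<Omega> (\<lambda>z. (x * f n z + y * g n z) - (x * f0 z + y * g0 z))) \<longlonglongrightarrow> 0"
proof (rule tendsto_sandwich[of "\<lambda>n. 0" _ _ "\<lambda>n. \<bar>x\<bar> * L2_norm \<Omega> (\<lambda>z. f n z - f0 z) + \<bar>y\<bar> * L2_norm \<Omega> (\<lambda>z. g n z - g0 z)"])
  show "\<forall>\<^sub>F n in sequentially. L2_norm \<Omega> (\<lambda>z. (x * f n z + y * g n z) - (x * f0 z + y * g0 z)) \<le>
      \<bar>x\<bar> * L2_norm \<Omega> (\<lambda>z. f n z - f0 z) + \<bar>y\<bar> * L2_norm \<Omega> (\<lambda>z. g n z - g0 z)"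
  proof (intro always_eventually allI)
    fix n
    have "(\<lambda>z. (x * f n z + y * g n z) - (x * f0 z + y * g0 z)) =
        (\<lambda>z. x * (f n z - f0 z) + y * (g n z - g0 z))"
      by (simp add: fun_eq_iff algebra_simps)
    then show "L2_norm \<Omega> (\<lambda>z. (x * f n z + y * g n z) - (x * f0 z + y * g0 z)) \<le>
      \<bar>x\<bar> * L2_norm \<Omega> (\<lambda>z. f n z - f0 z) + \<bar>y\<bar> * L2_norm \<Omega> (\<lambda>z. g n z - g0 z)"
      using L2_norm_triangle[OF L2_scale[OF L2_diff[OF assms(1,2)]] L2_scale[OF L2_diff[OF assms(4,5)]], of x n y n]
      by (simp add: L2_norm_scale)
  qed
  have "(\<lambda>n. \<bar>x\<bar> * L2_norm \<Omega> (\<lambda>z. f n z - f0 z) + \<bar>y\<bar> * L2_norm \<Omega> (\<lambda>z. g n z - g0 z)) \<longlonglongrightarrow> \<bar>x\<bar> * 0 + \<bar>y\<bar> * 0"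
    by (intro tendsto_intros assms)
  then show "(\<lambda>n. \<bar>x\<bar> * L2_norm \<Omega> (\<lambda>z. f n z - f0 z) + \<bar>y\<bar> * L2_norm \<Omega> (\<lambda>z. g n z - g0 z)) \<longlonglongrightarrow> 0"
    by simp
qed (auto simp: L2_norm_nonneg)

lemma L2_norm_cong:
  assumes "L2_eq \<Omega> f g" "f \<in> L2 \<Omega>" "g \<in> L2 \<Omega>"
  shows "L2_norm \<Omega> f = L2_norm \<Omega> g"
  unfolding L2_norm_def using L2_inner_cong[OF assms(1,1,2,3,2,3)] by simp

lemma L2_eq_diff: "L2_eq \<Omega> f f' \<Longrightarrow> L2_eq \<Omega> (\<lambda>x. f x - g x) (\<lambda>x. f' x - g x)"
  unfolding L2_eq_def by (erule AE_mp) simp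

locale dirichlet =
  fixes \<Omega> :: "'a::euclidean_space set" and B :: "'a L2_op" and lam :: real
  assumes setting: "dirichlet_setting \<Omega> B lam"
begin

lemma open_domain: "open \<Omega>" and bounded_domain: "bounded \<Omega>"
  and laplacian_self_adjoint: "adjoint_op \<Omega> (neg_laplacian \<Omega>) = neg_laplacian \<Omega>"
  and B_adjoint: "adjoint_op \<Omega> B = B" and B_dense: "densely_defined \<Omega> B"
  and B_square: "B O B = neg_laplacian \<Omega>"
  and lam_least: "eigenvalue \<Omega> (neg_laplacian \<Omega>) \<mu> \<Longrightarrow> lam \<le> \<mu>"
  using setting by (auto simp: dirichlet_setting_def self_adjoint_def is_sqrt_op_def smallest_eigenvalue_def)

lemma finite_measure_domain: "finite_measure (lebesgue_on \<Omega>)"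
proof
  have "emeasure lborel \<Omega> \<noteq> \<infinity>"
    using emeasure_bounded_finite[OF bounded_domain] by simp
  then show "emeasure (lebesgue_on \<Omega>) (space (lebesgue_on \<Omega>)) \<noteq> \<infinity>"
    using open_domain by (simp add: emeasure_restrict_space borel_open)
qed

lemmas L2_complete_domain = L2_complete[OF finite_measure_domain]

lemma B_L2: "(v, g) \<in> B \<Longrightarrow> v \<in> L2 \<Omega>" "(v, g) \<in> B \<Longrightarrow> g \<in> L2 \<Omega>"
  by (subst (asm) B_adjoint[symmetric]; simp add: adjoint_op_def)+

lemma B_symmetric:
  assumes "(v, g) \<in> B" "(w, z) \<in> B"
  shows "L2_inner \<Omega> g w = L2_inner \<Omega> v z"
proof -
  have "(w, z) \<in> adjoint_op \<Omega> B" using assms(2) by (simp add: B_adjoint)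
  then show ?thesis using assms(1) by (auto simp: adjoint_op_def)
qed

text \<open>A self-adjoint graph is maximal: symmetry against all of \<open>B\<close> is already
  membership. Linearity and closedness of \<open>B\<close> are derived from this.\<close>

lemma B_intro:
  assumes "w \<in> L2 \<Omega>" "z \<in> L2 \<Omega>" "\<And>v g. (v, g) \<in> B \<Longrightarrow> L2_inner \<Omega> g w = L2_inner \<Omega> v z"
  shows "(w, z) \<in> B"
proof -
  have "(w, z) \<in> adjoint_op \<Omega> B" using assms by (auto simp: adjoint_op_def)
  then show ?thesis by (simp add: B_adjoint)
qed

lemma B_comb:
  assumes "(v, g) \<in> B" "(w, z) \<in> B"
  shows "((\<lambda>r. x * v r + y * w r), (\<lambda>r. x * g r + y * z r)) \<in> B"
proof (rule B_intro)
  note L2 = B_L2[OF assms(1)] B_L2[OF assms(2)]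
  show "(\<lambda>r. x * v r + y * w r) \<in> L2 \<Omega>" "(\<lambda>r. x * g r + y * z r) \<in> L2 \<Omega>"
    using L2 by (auto intro!: L2_add L2_scale)
  fix v' g' assume *: "(v', g') \<in> B"
  show "L2_inner \<Omega> g' (\<lambda>r. x * v r + y * w r) = L2_inner \<Omega> v' (\<lambda>r. x * g r + y * z r)"
    using B_symmetric[OF * assms(1)] B_symmetric[OF * assms(2)] L2 B_L2[OF *]
    by (simp add: L2_inner_add_right L2_scale L2_inner_scale_right)
qed

lemma B_closed:
  assumes "\<And>n. (v n, g n) \<in> B" "v0 \<in> L2 \<Omega>" "g0 \<in> L2 \<Omega>"
    and "(\<lambda>n. L2_norm \<Omega> (\<lambda>x. v n x - v0 x)) \<longlonglongrightarrow> 0" "(\<lambda>n. L2_norm \<Omega> (\<lambda>x. g n x - g0 x)) \<longlonglongrightarrow> 0"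
  shows "(v0, g0) \<in> B"
proof (rule B_intro[OF assms(2,3)])
  fix w z assume *: "(w, z) \<in> B"
  have zero: "(\<lambda>n. L2_norm \<Omega> (\<lambda>x. f x - f x)) \<longlonglongrightarrow> 0" for f
    by (simp add: L2_norm_def L2_inner_def)
  have "(\<lambda>n. L2_inner \<Omega> z (v n)) \<longlonglongrightarrow> L2_inner \<Omega> z v0"
    by (rule L2_inner_tendsto[OF _ _ zero]) (use assms B_L2[OF *] B_L2[OF assms(1)] in simp_all)
  moreover have "(\<lambda>n. L2_inner \<Omega> w (g n)) \<longlonglongrightarrow> L2_inner \<Omega> w g0"
    by (rule L2_inner_tendsto[OF _ _ zero]) (use assms B_L2[OF *] B_L2[OF assms(1)] in simp_all)
  ultimately show "L2_inner \<Omega> z v0 = L2_inner \<Omega> w g0"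
    using B_symmetric[OF * assms(1)] LIMSEQ_unique by simp
qed

text \<open>The difference of two values is orthogonal to the domain of \<open>B\<close>, which is
  dense.\<close>

lemma B_unique:
  assumes "(v, g) \<in> B" "(v, g') \<in> B"
  shows "L2_eq \<Omega> g g'"
proof -
  note L2 = B_L2[OF assms(1)] B_L2[OF assms(2)]
  let ?d = "\<lambda>x. g x - g' x"
  have d: "?d \<in> L2 \<Omega>" using L2 by (intro L2_diff)
  have "L2_norm \<Omega> ?d \<le> 0"
  proof (rule field_le_epsilon)
    fix e :: real assume "e > 0"
    obtain w where "w \<in> Domain B" and w2: "L2_norm \<Omega> (\<lambda>x. ?d x - w x) < e"
      using B_dense[unfolded densely_defined_def, rule_format, OF d \<open>e > 0\<close>] by (elim bexE)
    then obtain z where w: "(w, z) \<in> B" by (elim DomainE)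
    have "L2_inner \<Omega> ?d w = 0"
      using B_symmetric[OF assms(1) w] B_symmetric[OF assms(2) w] L2 B_L2[OF w]
      by (simp add: L2_inner_diff_left)
    then have "(L2_norm \<Omega> ?d)\<^sup>2 = L2_inner \<Omega> ?d (\<lambda>x. ?d x - w x)"
      using d B_L2[OF w] by (simp add: L2_norm_power2 L2_inner_diff_right)
    also have "\<dots> \<le> L2_norm \<Omega> ?d * L2_norm \<Omega> (\<lambda>x. ?d x - w x)"
      using L2_cauchy_schwarz[OF d L2_diff[OF d B_L2(1)[OF w]]] by simp
    also have "\<dots> \<le> L2_norm \<Omega> ?d * e"
      using w2 by (intro mult_left_mono L2_norm_nonneg) simp
    finally have "L2_norm \<Omega> ?d * L2_norm \<Omega> ?d \<le> L2_norm \<Omega> ?d * e"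
      by (simp add: power2_eq_square)
    then show "L2_norm \<Omega> ?d \<le> 0 + e"
      using \<open>e > 0\<close> L2_norm_nonneg[of \<Omega> ?d] by (cases "L2_norm \<Omega> ?d = 0") (auto simp: mult_le_cancel_left)
  qed
  then show ?thesis
    using L2_norm_nonneg[of \<Omega> ?d] by (simp add: L2_eq_iff_norm[OF L2(2,4)])
qed

lemma op_app_B: "(v, g) \<in> B \<Longrightarrow> (v, op_app B v) \<in> B"
  unfolding op_app_def by (rule someI[of "\<lambda>g. (v, g) \<in> B"])

lemma op_app_eq: "(v, g) \<in> B \<Longrightarrow> L2_eq \<Omega> (op_app B v) g"
  by (rule B_unique[OF op_app_B])

lemma a_form_eq:
  assumes "(v, g) \<in> B" "(w, z) \<in> B"
  shows "a_form \<Omega> B v w = L2_inner \<Omega> g z"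
  unfolding a_form_def
  by (rule L2_inner_cong[OF op_app_eq[OF assms(1)] op_app_eq[OF assms(2)]])
    (use op_app_B assms B_L2 in blast)+

lemma norm1_eq: "(v, g) \<in> B \<Longrightarrow> norm1 \<Omega> B v = L2_norm \<Omega> g"
  using a_form_eq[of v g v g] by (simp add: a_form_def norm1_def L2_norm_def)

text \<open>A test function lies in the domain of the square of \<open>B\<close>, so both it and its
  image under \<open>B\<close> lie in the domain of \<open>B\<close>. This gives the energy as (A
  \<phi>, \<phi>). The last claim, that a(v, \<phi>) = (v, A \<phi>) is bounded in the L^2 norm of
  v, allows differentiating a(u(t), \<phi>) although u is differentiable only in L^2.\<close>

lemma test_function_B:
  assumes "test_function \<Omega> \<phi>"
  shows "(\<phi>, op_app B \<phi>) \<in> B"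
    and "(L2_norm \<Omega> (op_app B \<phi>))\<^sup>2 = dirichlet_energy \<Omega> \<phi>"
    and "\<exists>g. \<forall>v z. (v, z) \<in> B \<longrightarrow> g \<in> L2 \<Omega> \<and> a_form \<Omega> B v \<phi> = L2_inner \<Omega> v g"
proof -
  let ?g = "\<lambda>x. - (\<Sum>i\<in>Basis. partial_deriv i (partial_deriv i \<phi>) x)"
  have "(\<phi>, ?g) \<in> B O B"
    unfolding B_square by (rule test_function_neg_laplacian[OF assms open_domain])
  then obtain w where w: "(\<phi>, w) \<in> B" "(w, ?g) \<in> B" by auto
  show "(\<phi>, op_app B \<phi>) \<in> B" by (rule op_app_B) fact
  have "(L2_norm \<Omega> (op_app B \<phi>))\<^sup>2 = L2_inner \<Omega> w w"
    using norm1_eq[OF w(1)] by (simp add: norm1_def L2_norm_power2)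
  also have "\<dots> = L2_inner \<Omega> ?g \<phi>"
    using B_symmetric[OF w] by (simp add: L2_inner_commute)
  also have "\<dots> = dirichlet_energy \<Omega> \<phi>"
    by (rule test_function_laplacian_inner[OF assms open_domain])
  finally show "(L2_norm \<Omega> (op_app B \<phi>))\<^sup>2 = dirichlet_energy \<Omega> \<phi>" .
  have "?g \<in> L2 \<Omega> \<and> a_form \<Omega> B v \<phi> = L2_inner \<Omega> v ?g" if "(v, z) \<in> B" for v z
    using a_form_eq[OF that w(1)] B_symmetric[OF that w(2)] B_L2[OF w(2)] by simp
  then show "\<exists>g. \<forall>v z. (v, z) \<in> B \<longrightarrow> g \<in> L2 \<Omega> \<and> a_form \<Omega> B v \<phi> = L2_inner \<Omega> v g"
    by blast
qed

text \<open>The graph closure of \<open>B\<close> restricted to test functions; it contains \<open>H\<^sub>0\<^sup>1(\<Omega>)\<close>, which makes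
  \<open>a_form\<close> and \<open>norm1\<close> meaningful there.\<close>

definition core :: "('a \<Rightarrow> real) \<Rightarrow> ('a \<Rightarrow> real) \<Rightarrow> bool" where
  "core v g \<longleftrightarrow> v \<in> L2 \<Omega> \<and> g \<in> L2 \<Omega> \<and> (\<exists>\<phi>. (\<forall>n. test_function \<Omega> (\<phi> n)) \<and>
     (\<lambda>n. L2_norm \<Omega> (\<lambda>x. \<phi> n x - v x)) \<longlonglongrightarrow> 0 \<and>
     (\<lambda>n. L2_norm \<Omega> (\<lambda>x. op_app B (\<phi> n) x - g x)) \<longlonglongrightarrow> 0)"

lemma coreE:
  assumes "core v g"
  obtains \<phi> where "v \<in> L2 \<Omega>" "g \<in> L2 \<Omega>" "\<forall>n. test_function \<Omega> (\<phi> n)"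
    "(\<lambda>n. L2_norm \<Omega> (\<lambda>x. \<phi> n x - v x)) \<longlonglongrightarrow> 0" "(\<lambda>n. L2_norm \<Omega> (\<lambda>x. op_app B (\<phi> n) x - g x)) \<longlonglongrightarrow> 0"
proof -
  from assms obtain \<phi> where "v \<in> L2 \<Omega>" "g \<in> L2 \<Omega>" "\<forall>n. test_function \<Omega> (\<phi> n)"
    "(\<lambda>n. L2_norm \<Omega> (\<lambda>x. \<phi> n x - v x)) \<longlonglongrightarrow> 0" "(\<lambda>n. L2_norm \<Omega> (\<lambda>x. op_app B (\<phi> n) x - g x)) \<longlonglongrightarrow> 0"
    unfolding core_def by (elim conjE exE)
  then show ?thesis by (intro that[of \<phi>]) simp_all
qed

lemma core_B:
  assumes "core v g"
  shows "(v, g) \<in> B"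
proof -
  obtain \<phi> where \<phi>': "v \<in> L2 \<Omega>" "g \<in> L2 \<Omega>" "\<forall>n. test_function \<Omega> (\<phi> n)"
    "(\<lambda>n. L2_norm \<Omega> (\<lambda>x. \<phi> n x - v x)) \<longlonglongrightarrow> 0" "(\<lambda>n. L2_norm \<Omega> (\<lambda>x. op_app B (\<phi> n) x - g x)) \<longlonglongrightarrow> 0"
    by (rule coreE[OF assms])
  note \<phi> = \<phi>'(1,2) \<phi>'(3)[rule_format] \<phi>'(4,5)
  show ?thesis
    by (rule B_closed[OF test_function_B(1)[OF \<phi>(3)] \<phi>(1,2,4,5)])
qed

lemma op_app_L2: "test_function \<Omega> \<phi> \<Longrightarrow> op_app B \<phi> \<in> L2 \<Omega>"
  using test_function_B(1) B_L2 by blast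

lemma core_cong:
  assumes "core v g" "L2_eq \<Omega> g g'" "g' \<in> L2 \<Omega>"
  shows "core v g'"
proof -
  obtain \<phi> where \<phi>': "v \<in> L2 \<Omega>" "g \<in> L2 \<Omega>" "\<forall>n. test_function \<Omega> (\<phi> n)"
    "(\<lambda>n. L2_norm \<Omega> (\<lambda>x. \<phi> n x - v x)) \<longlonglongrightarrow> 0" "(\<lambda>n. L2_norm \<Omega> (\<lambda>x. op_app B (\<phi> n) x - g x)) \<longlonglongrightarrow> 0"
    by (rule coreE[OF assms(1)])
  note \<phi> = \<phi>'(1,2) \<phi>'(3)[rule_format] \<phi>'(4,5)
  have "L2_norm \<Omega> (\<lambda>x. op_app B (\<phi> n) x - g' x) = L2_norm \<Omega> (\<lambda>x. op_app B (\<phi> n) x - g x)" for n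
    unfolding L2_norm_diff_commute[of \<Omega> "op_app B (\<phi> n)"]
    using L2_norm_cong[OF L2_eq_diff[OF assms(2)] L2_diff[OF \<phi>(2)] L2_diff[OF assms(3)]]
      op_app_L2[OF \<phi>(3)] by simp
  then show ?thesis
    unfolding core_def using \<phi> assms(3) by (intro conjI exI[of _ \<phi>]) simp_all
qed

lemma core_comb:
  assumes "core v g" "core w z"
  shows "core (\<lambda>r. x * v r + y * w r) (\<lambda>r. x * g r + y * z r)"
proof -
  obtain \<phi> where \<phi>': "v \<in> L2 \<Omega>" "g \<in> L2 \<Omega>" "\<forall>n. test_function \<Omega> (\<phi> n)"
    "(\<lambda>n. L2_norm \<Omega> (\<lambda>x. \<phi> n x - v x)) \<longlonglongrightarrow> 0" "(\<lambda>n. L2_norm \<Omega> (\<lambda>x. op_app B (\<phi> n) x - g x)) \<longlonglongrightarrow> 0"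
    by (rule coreE[OF assms(1)])
  note \<phi> = \<phi>'(1,2) \<phi>'(3)[rule_format] \<phi>'(4,5)
  obtain \<psi> where \<psi>': "w \<in> L2 \<Omega>" "z \<in> L2 \<Omega>" "\<forall>n. test_function \<Omega> (\<psi> n)"
    "(\<lambda>n. L2_norm \<Omega> (\<lambda>x. \<psi> n x - w x)) \<longlonglongrightarrow> 0" "(\<lambda>n. L2_norm \<Omega> (\<lambda>x. op_app B (\<psi> n) x - z x)) \<longlonglongrightarrow> 0"
    by (rule coreE[OF assms(2)])
  note \<psi> = \<psi>'(1,2) \<psi>'(3)[rule_format] \<psi>'(4,5)
  define \<theta> where "\<theta> n = (\<lambda>r. x * \<phi> n r + y * \<psi> n r)" for n
  have \<theta>: "test_function \<Omega> (\<theta> n)" for n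
    unfolding \<theta>_def by (rule test_function_comb) fact+
  have test_L2: "\<phi> n \<in> L2 \<Omega>" "\<psi> n \<in> L2 \<Omega>" "op_app B (\<phi> n) \<in> L2 \<Omega>" "op_app B (\<psi> n) \<in> L2 \<Omega>" for n
    using \<phi>(3) \<psi>(3) open_domain by (auto intro: test_function_L2 op_app_L2)
  have L2: "(\<lambda>r. x * v r + y * w r) \<in> L2 \<Omega>" "(\<lambda>r. x * g r + y * z r) \<in> L2 \<Omega>"
    using \<phi> \<psi> by (auto intro!: L2_add L2_scale)
  have "(\<lambda>n. L2_norm \<Omega> (\<lambda>r. \<theta> n r - (x * v r + y * w r))) \<longlonglongrightarrow> 0"
    unfolding \<theta>_def by (rule L2_tendsto_comb) (use \<phi> \<psi> test_L2 in auto)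
  moreover have "(\<lambda>n. L2_norm \<Omega> (\<lambda>r. op_app B (\<theta> n) r - (x * g r + y * z r))) \<longlonglongrightarrow> 0"
  proof -
    have "L2_norm \<Omega> (\<lambda>r. op_app B (\<theta> n) r - (x * g r + y * z r)) =
        L2_norm \<Omega> (\<lambda>r. (x * op_app B (\<phi> n) r + y * op_app B (\<psi> n) r) - (x * g r + y * z r))" for n
    proof (rule L2_norm_cong[OF L2_eq_diff])
      show "L2_eq \<Omega> (op_app B (\<theta> n)) (\<lambda>r. x * op_app B (\<phi> n) r + y * op_app B (\<psi> n) r)"
        unfolding \<theta>_def
        by (rule op_app_eq, rule B_comb) (use \<phi> \<psi> test_function_B(1) in auto)
    qed (use \<theta> op_app_L2 test_L2 L2 in \<open>auto intro!: L2_diff L2_add L2_scale\<close>)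
    moreover have "(\<lambda>n. L2_norm \<Omega> (\<lambda>r. (x * op_app B (\<phi> n) r + y * op_app B (\<psi> n) r) - (x * g r + y * z r))) \<longlonglongrightarrow> 0"
      by (rule L2_tendsto_comb) (use \<phi> \<psi> test_L2 in auto)
    ultimately show ?thesis by simp
  qed
  ultimately show ?thesis
    unfolding core_def using L2 \<theta> by (intro conjI exI[of _ \<theta>] allI)
qed

text \<open>Both sides converge along the approximating test functions. The lemma serves with the
  infimum of the Rayleigh quotient, to find an eigenvalue, and afterwards with
  \<open>lam\<close>.\<close>

lemma core_rayleigh:
  assumes "core v g" and test: "\<And>\<phi>. test_function \<Omega> \<phi> \<Longrightarrow> \<kappa> * (L2_norm \<Omega> \<phi>)\<^sup>2 \<le> dirichlet_energy \<Omega> \<phi>"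
  shows "\<kappa> * L2_inner \<Omega> v v \<le> L2_inner \<Omega> g g"
proof -
  obtain \<phi> where \<phi>': "v \<in> L2 \<Omega>" "g \<in> L2 \<Omega>" "\<forall>n. test_function \<Omega> (\<phi> n)"
    "(\<lambda>n. L2_norm \<Omega> (\<lambda>x. \<phi> n x - v x)) \<longlonglongrightarrow> 0" "(\<lambda>n. L2_norm \<Omega> (\<lambda>x. op_app B (\<phi> n) x - g x)) \<longlonglongrightarrow> 0"
    by (rule coreE[OF assms(1)])
  note \<phi> = \<phi>'(1,2) \<phi>'(3)[rule_format] \<phi>'(4,5)
  have L2: "\<phi> n \<in> L2 \<Omega>" "op_app B (\<phi> n) \<in> L2 \<Omega>" for n
    using \<phi>(3) open_domain by (auto intro: test_function_L2 op_app_L2)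
  show ?thesis
  proof (rule LIMSEQ_le)
    show "(\<lambda>n. \<kappa> * L2_inner \<Omega> (\<phi> n) (\<phi> n)) \<longlonglongrightarrow> \<kappa> * L2_inner \<Omega> v v"
      by (intro tendsto_mult_left L2_inner_tendsto) (use \<phi> L2 in simp_all)
    show "(\<lambda>n. L2_inner \<Omega> (op_app B (\<phi> n)) (op_app B (\<phi> n))) \<longlonglongrightarrow> L2_inner \<Omega> g g"
      by (intro L2_inner_tendsto) (use \<phi> L2 in simp_all)
    show "\<exists>N. \<forall>n\<ge>N. \<kappa> * L2_inner \<Omega> (\<phi> n) (\<phi> n) \<le> L2_inner \<Omega> (op_app B (\<phi> n)) (op_app B (\<phi> n))"
      using test[OF \<phi>(3)] test_function_B(2)[OF \<phi>(3)] by (simp add: L2_norm_power2)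
  qed
qed

text \<open>The Dirichlet energy of a difference of test functions is the squared norm of the
  difference of their images under \<open>B\<close>. A sequence that is Cauchy in energy therefore
  has convergent images, by completeness.\<close>

lemma coreI:
  assumes test: "\<And>n. test_function \<Omega> (\<phi> n)" and v: "v \<in> L2 \<Omega>" "(\<lambda>n. L2_norm \<Omega> (\<lambda>x. \<phi> n x - v x)) \<longlonglongrightarrow> 0"
    and cauchy: "\<And>e. e > 0 \<Longrightarrow> \<exists>N. \<forall>m\<ge>N. \<forall>n\<ge>N. dirichlet_energy \<Omega> (\<lambda>x. \<phi> m x - \<phi> n x) < e"
  obtains g where "core v g" "(\<lambda>n. L2_norm \<Omega> (\<lambda>x. op_app B (\<phi> n) x - g x)) \<longlonglongrightarrow> 0"
proof -
  have eq: "(L2_norm \<Omega> (\<lambda>x. op_app B (\<phi> m) x - op_app B (\<phi> n) x))\<^sup>2 = dirichlet_energy \<Omega> (\<lambda>x. \<phi> m x - \<phi> n x)" for m n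
  proof -
    have test_diff: "test_function \<Omega> (\<lambda>x. \<phi> m x - \<phi> n x)"
      using test_function_comb[OF test test, of 1 m "- 1" n] by simp
    have "((\<lambda>x. \<phi> m x - \<phi> n x), (\<lambda>x. op_app B (\<phi> m) x - op_app B (\<phi> n) x)) \<in> B"
      using B_comb[OF test_function_B(1)[OF test] test_function_B(1)[OF test], of 1 m "- 1" n] by simp
    then show ?thesis
      using norm1_eq test_function_B(2)[OF test_diff] by (simp add: norm1_def)
  qed
  have "\<exists>g\<in>L2 \<Omega>. (\<lambda>n. L2_norm \<Omega> (\<lambda>x. op_app B (\<phi> n) x - g x)) \<longlonglongrightarrow> 0"
  proof (rule L2_complete_domain)
    show "op_app B (\<phi> n) \<in> L2 \<Omega>" for n using test by (rule op_app_L2)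
    fix e :: real assume "e > 0"
    then obtain N where N: "\<And>m n. m \<ge> N \<Longrightarrow> n \<ge> N \<Longrightarrow> dirichlet_energy \<Omega> (\<lambda>x. \<phi> m x - \<phi> n x) < e\<^sup>2"
      using cauchy[of "e\<^sup>2"] by auto
    have "L2_norm \<Omega> (\<lambda>x. op_app B (\<phi> m) x - op_app B (\<phi> n) x) < e" if "m \<ge> N" "n \<ge> N" for m n
      by (rule power2_less_imp_less) (use N[OF that] eq[of m n] \<open>e > 0\<close> in auto)
    then show "\<exists>N. \<forall>m\<ge>N. \<forall>n\<ge>N. L2_norm \<Omega> (\<lambda>x. op_app B (\<phi> m) x - op_app B (\<phi> n) x) < e"
      by blast
  qed
  then show ?thesis
    using that test v unfolding core_def by metis
qed

text \<open>The gradients of an approximating sequence converge, so it is Cauchy in energy and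
  \<open>coreI\<close> applies. The limit of the images is then exchanged for the almost everywhere
  equal value that \<open>op_app\<close> chooses.\<close>

lemma H01_core:
  assumes "v \<in> H01 \<Omega>"
  shows "core v (op_app B v)"
proof -
  obtain \<phi> where v: "v \<in> L2 \<Omega>" and \<phi>: "\<And>n. test_function \<Omega> (\<phi> n)"
    "(\<lambda>n. L2_norm \<Omega> (\<lambda>x. \<phi> n x - v x)) \<longlonglongrightarrow> 0"
    "\<forall>i\<in>Basis. \<exists>g \<in> L2 \<Omega>. weak_deriv \<Omega> [i] v g \<and>
       (\<lambda>n. L2_norm \<Omega> (\<lambda>x. partial_deriv i (\<phi> n) x - g x)) \<longlonglongrightarrow> 0"
    using assms unfolding H01_def by blast
  then obtain d where d: "\<And>i. i \<in> Basis \<Longrightarrow> d i \<in> L2 \<Omega>"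
    "\<And>i. i \<in> Basis \<Longrightarrow> (\<lambda>n. L2_norm \<Omega> (\<lambda>x. partial_deriv i (\<phi> n) x - d i x)) \<longlonglongrightarrow> 0"
    by metis
  define e where "e n = (\<Sum>i\<in>Basis. 2 * (L2_norm \<Omega> (\<lambda>x. partial_deriv i (\<phi> n) x - d i x))\<^sup>2)" for n
  have "e \<longlonglongrightarrow> (\<Sum>i\<in>(Basis :: 'a set). 2 * 0\<^sup>2)"
    unfolding e_def by (intro tendsto_intros d)
  then have e_lim: "e \<longlonglongrightarrow> 0" by simp
  have bound: "dirichlet_energy \<Omega> (\<lambda>x. \<phi> m x - \<phi> n x) \<le> e m + e n" for m n
    unfolding dirichlet_energy_def e_def sum.distrib[symmetric]
  proof (rule sum_mono)
    fix i :: 'a assume i: "i \<in> Basis"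
    have L2: "partial_deriv i (\<phi> k) \<in> L2 \<Omega>" for k
      using \<phi>(1) i open_domain by (intro test_function_L2 test_function_partial)
    have "partial_deriv i (\<lambda>x. \<phi> m x - \<phi> n x) = (\<lambda>x. partial_deriv i (\<phi> m) x - partial_deriv i (\<phi> n) x)"
      using partial_deriv_comb[of "\<phi> m" _ "\<phi> n" i 1 "- 1"] smooth_differentiable[OF test_function_smooth[OF \<phi>(1)]]
      by (simp add: fun_eq_iff)
    then have "L2_norm \<Omega> (partial_deriv i (\<lambda>x. \<phi> m x - \<phi> n x)) \<le>
        L2_norm \<Omega> (\<lambda>x. partial_deriv i (\<phi> m) x - d i x) + L2_norm \<Omega> (\<lambda>x. partial_deriv i (\<phi> n) x - d i x)"
      using L2_norm_triangle_diff[OF L2 d(1)[OF i] L2, of m n] L2_norm_diff_commute[of \<Omega> "d i"] by simp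
    then have "(L2_norm \<Omega> (partial_deriv i (\<lambda>x. \<phi> m x - \<phi> n x)))\<^sup>2 \<le>
        (L2_norm \<Omega> (\<lambda>x. partial_deriv i (\<phi> m) x - d i x) + L2_norm \<Omega> (\<lambda>x. partial_deriv i (\<phi> n) x - d i x))\<^sup>2"
      by (intro power_mono L2_norm_nonneg)
    also have "\<dots> \<le> 2 * (L2_norm \<Omega> (\<lambda>x. partial_deriv i (\<phi> m) x - d i x))\<^sup>2 +
        2 * (L2_norm \<Omega> (\<lambda>x. partial_deriv i (\<phi> n) x - d i x))\<^sup>2"
    proof -
      have "(a + b)\<^sup>2 \<le> 2 * a\<^sup>2 + 2 * b\<^sup>2" for a b :: real
        using zero_le_power2[of "a - b"] by (simp add: power2_sum power2_diff)
      then show ?thesis .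
    qed
    finally show "(L2_norm \<Omega> (partial_deriv i (\<lambda>x. \<phi> m x - \<phi> n x)))\<^sup>2 \<le>
        2 * (L2_norm \<Omega> (\<lambda>x. partial_deriv i (\<phi> m) x - d i x))\<^sup>2 +
        2 * (L2_norm \<Omega> (\<lambda>x. partial_deriv i (\<phi> n) x - d i x))\<^sup>2" .
  qed
  obtain g where g: "core v g"
  proof (rule coreI[OF \<phi>(1) v \<phi>(2)])
    fix \<epsilon> :: real assume "\<epsilon> > 0"
    then obtain N where N: "\<And>n. n \<ge> N \<Longrightarrow> e n < \<epsilon> / 2"
      using order_tendstoD(2)[OF e_lim, of "\<epsilon> / 2"] by (auto simp: eventually_sequentially)
    show "\<exists>N. \<forall>m\<ge>N. \<forall>n\<ge>N. dirichlet_energy \<Omega> (\<lambda>x. \<phi> m x - \<phi> n x) < \<epsilon>"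
    proof (intro exI allI impI)
      fix m n assume "m \<ge> N" "n \<ge> N"
      then show "dirichlet_energy \<Omega> (\<lambda>x. \<phi> m x - \<phi> n x) < \<epsilon>"
        using bound[of m n] N[of m] N[of n] by simp
    qed
  qed
  show ?thesis
  proof (rule core_cong[OF g])
    show "L2_eq \<Omega> g (op_app B v)"
      using op_app_eq[OF core_B[OF g]] by (auto simp: L2_eq_def elim: AE_mp)
    show "op_app B v \<in> L2 \<Omega>"
      using B_L2(2)[OF op_app_B[OF core_B[OF g]]] .
  qed
qed

lemma H01_B: "v \<in> H01 \<Omega> \<Longrightarrow> (v, op_app B v) \<in> B"
  by (rule core_B[OF H01_core])

lemma dirichlet_energy_nonneg: "dirichlet_energy \<Omega> \<phi> \<ge> 0"
  by (simp add: dirichlet_energy_def sum_nonneg)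

lemma dirichlet_energy_comb:
  assumes "test_function \<Omega> \<phi>" "test_function \<Omega> \<psi>"
  shows "dirichlet_energy \<Omega> (\<lambda>z. x * \<phi> z + y * \<psi> z) = x\<^sup>2 * dirichlet_energy \<Omega> \<phi> + y\<^sup>2 * dirichlet_energy \<Omega> \<psi>
    + 2 * x * y * L2_inner \<Omega> (op_app B \<phi>) (op_app B \<psi>)"
proof -
  have L2: "op_app B \<phi> \<in> L2 \<Omega>" "op_app B \<psi> \<in> L2 \<Omega>" using assms by (auto intro: op_app_L2)
  have "dirichlet_energy \<Omega> (\<lambda>z. x * \<phi> z + y * \<psi> z) = (norm1 \<Omega> B (\<lambda>z. x * \<phi> z + y * \<psi> z))\<^sup>2"
    using test_function_B(2)[OF test_function_comb[OF assms]] by (simp add: norm1_def)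
  also have "\<dots> = L2_inner \<Omega> (\<lambda>z. x * op_app B \<phi> z + y * op_app B \<psi> z) (\<lambda>z. x * op_app B \<phi> z + y * op_app B \<psi> z)"
    using norm1_eq[OF B_comb[OF test_function_B(1)[OF assms(1)] test_function_B(1)[OF assms(2)]]]
    by (simp add: L2_norm_power2)
  finally show ?thesis
    unfolding L2_inner_comb[OF L2] using test_function_B(2) assms by (simp add: L2_norm_power2)
qed

end

section \<open>Poincare's inequality with the smallest eigenvalue\<close>

context dirichlet
begin

lemma test_function_in_L2: "test_function \<Omega> \<phi> \<Longrightarrow> \<phi> \<in> L2 \<Omega>"
  using test_function_L2 open_domain by blast

lemma dirichlet_energy_parallelogram:
  assumes "test_function \<Omega> \<phi>" "test_function \<Omega> \<psi>"
  shows "dirichlet_energy \<Omega> (\<lambda>z. \<phi> z - \<psi> z) + dirichlet_energy \<Omega> (\<lambda>z. \<phi> z + \<psi> z) =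
    2 * dirichlet_energy \<Omega> \<phi> + 2 * dirichlet_energy \<Omega> \<psi>"
  using dirichlet_energy_comb[OF assms, of 1 1] dirichlet_energy_comb[OF assms, of 1 "- 1"] by simp

lemma L2_parallelogram:
  assumes "f \<in> L2 \<Omega>" "g \<in> L2 \<Omega>"
  shows "(L2_norm \<Omega> (\<lambda>z. f z - g z))\<^sup>2 + (L2_norm \<Omega> (\<lambda>z. f z + g z))\<^sup>2 =
    2 * (L2_norm \<Omega> f)\<^sup>2 + 2 * (L2_norm \<Omega> g)\<^sup>2"
  using L2_inner_comb[OF assms, of 1 1] L2_inner_comb[OF assms, of 1 "- 1"] by (simp add: L2_norm_power2)

text \<open>A single instance of Rellich's inequality suffices: along a minimizing sequence the Dirichlet
  energy of a difference is at most \<open>\<mu>\<close> times the square of its norm, up to a null sequence.\<close>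

lemma minimizing_sequence_converges:
  assumes test: "\<And>n. test_function \<Omega> (\<phi> n)" and norm: "\<And>n. L2_norm \<Omega> (\<phi> n) = 1"
    and lim: "(\<lambda>n. dirichlet_energy \<Omega> (\<phi> n)) \<longlonglongrightarrow> \<mu>" and "\<mu> \<ge> 0"
    and lower: "\<And>\<phi>. test_function \<Omega> \<phi> \<Longrightarrow> \<mu> * (L2_norm \<Omega> \<phi>)\<^sup>2 \<le> dirichlet_energy \<Omega> \<phi>"
  obtains v g where "core v g" "L2_inner \<Omega> v v = 1" "L2_inner \<Omega> g g = \<mu>"
proof -
  \<comment> \<open>With \<eta> \<mu> \<le> 1 / 2, the multiple of the squared norm that Rellich's
    inequality puts on the right is absorbed on the left.\<close>
  define \<eta> where "\<eta> = 1 / (2 * (\<mu> + 1))"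
  have \<eta>: "\<eta> > 0" "\<eta> * \<mu> \<le> 1 / 2"
    using \<open>\<mu> \<ge> 0\<close> by (simp_all add: \<eta>_def field_simps)
  obtain G :: "('a \<Rightarrow> real) set" and C :: real where G: "finite G" "G \<subseteq> L2 \<Omega>" "C \<ge> 0"
    and rellich: "\<And>\<phi>. test_function \<Omega> \<phi> \<Longrightarrow>
      (L2_norm \<Omega> \<phi>)\<^sup>2 \<le> \<eta> * dirichlet_energy \<Omega> \<phi> + C * (\<Sum>g\<in>G. (L2_inner \<Omega> \<phi> g)\<^sup>2)"
    using rellich_inequality[OF bounded_domain open_domain \<eta>(1)] by metis
  have "\<exists>r. strict_mono r \<and> (\<forall>g\<in>G. convergent (\<lambda>n. L2_inner \<Omega> (\<phi> (r n)) g))"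
  proof (rule simultaneous_convergent_subsequence[OF G(1)])
    fix g assume "g \<in> G"
    then have "\<bar>L2_inner \<Omega> (\<phi> n) g\<bar> \<le> L2_norm \<Omega> g" for n
      using L2_cauchy_schwarz[OF test_function_in_L2[OF test], of g n] G(2) norm[of n] by auto
    then show "bounded (range (\<lambda>n. L2_inner \<Omega> (\<phi> n) g))"
      by (auto simp: bounded_iff)
  qed
  then obtain r where r: "strict_mono r" "\<And>g. g \<in> G \<Longrightarrow> convergent (\<lambda>n. L2_inner \<Omega> (\<phi> (r n)) g)"
    by blast
  define \<psi> where "\<psi> n = \<phi> (r n)" for n
  define e where "e n = 2 * (dirichlet_energy \<Omega> (\<psi> n) - \<mu>)" for n
  have \<psi>: "test_function \<Omega> (\<psi> n)" "L2_norm \<Omega> (\<psi> n) = 1" "\<psi> n \<in> L2 \<Omega>" for n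
    using test norm by (simp_all add: \<psi>_def test_function_in_L2)
  have energy_lim: "(\<lambda>n. dirichlet_energy \<Omega> (\<psi> n)) \<longlonglongrightarrow> \<mu>"
    using LIMSEQ_subseq_LIMSEQ[OF lim r(1)] by (simp add: \<psi>_def o_def)
  then have e_lim: "e \<longlonglongrightarrow> 0"
    unfolding e_def by (auto intro!: tendsto_eq_intros)
  have test_diff: "test_function \<Omega> (\<lambda>z. \<psi> m z - \<psi> n z)" for m n
    using test_function_comb[OF \<psi>(1) \<psi>(1), of 1 m "- 1" n] by simp
  have test_sum: "test_function \<Omega> (\<lambda>z. \<psi> m z + \<psi> n z)" for m n
    using test_function_comb[OF \<psi>(1) \<psi>(1), of 1 m 1 n] by simp
  let ?d = "\<lambda>m n. (L2_norm \<Omega> (\<lambda>z. \<psi> m z - \<psi> n z))\<^sup>2"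
  let ?D = "\<lambda>m n. dirichlet_energy \<Omega> (\<lambda>z. \<psi> m z - \<psi> n z)"
  \<comment> \<open>The parallelogram identities for norm and energy, with the lower bound \<mu>
    applied to the sum of the two functions.\<close>
  have D_le: "?D m n \<le> \<mu> * ?d m n + (e m + e n)" for m n
  proof -
    have "(L2_norm \<Omega> (\<lambda>z. \<psi> m z + \<psi> n z))\<^sup>2 = 4 - ?d m n"
      using L2_parallelogram[OF \<psi>(3) \<psi>(3), of m n] \<psi>(2) by simp
    then have "\<mu> * (4 - ?d m n) \<le> dirichlet_energy \<Omega> (\<lambda>z. \<psi> m z + \<psi> n z)"
      using lower[OF test_sum, of m n] by simp
    then show ?thesis
      using dirichlet_energy_parallelogram[OF \<psi>(1) \<psi>(1), of m n] by (simp add: e_def algebra_simps)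
  qed
  let ?\<Delta> = "\<lambda>m n. \<Sum>g\<in>G. (L2_inner \<Omega> (\<psi> m) g - L2_inner \<Omega> (\<psi> n) g)\<^sup>2"
  have d_le: "?d m n \<le> 2 * (\<eta> * (e m + e n) + C * ?\<Delta> m n)" for m n
  proof -
    have "?d m n \<le> \<eta> * ?D m n + C * (\<Sum>g\<in>G. (L2_inner \<Omega> (\<lambda>z. \<psi> m z - \<psi> n z) g)\<^sup>2)"
      by (rule rellich[OF test_diff])
    also have "(\<Sum>g\<in>G. (L2_inner \<Omega> (\<lambda>z. \<psi> m z - \<psi> n z) g)\<^sup>2) = ?\<Delta> m n"
      using G(2) \<psi>(3) by (intro sum.cong refl) (auto simp: L2_inner_diff_left)
    also have "\<eta> * ?D m n \<le> \<eta> * (\<mu> * ?d m n + (e m + e n))"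
      using D_le \<eta>(1) by (intro mult_left_mono) auto
    also have "\<eta> * (\<mu> * ?d m n + (e m + e n)) \<le> 1 / 2 * ?d m n + \<eta> * (e m + e n)"
      using mult_right_mono[OF \<eta>(2), of "?d m n"] by (simp add: algebra_simps)
    finally show ?thesis by simp
  qed
  have d_small: "\<exists>N. \<forall>m\<ge>N. \<forall>n\<ge>N. ?d m n < \<epsilon>" if "\<epsilon> > 0" for \<epsilon>
  proof -
    define \<rho> where "\<rho> = \<epsilon> / (4 * \<eta> + 2 * C * real (card G) + 1)"
    have den: "4 * \<eta> + 2 * C * real (card G) + 1 > 0"
      using \<eta>(1) G(3) by (simp add: add_pos_nonneg add_nonneg_pos)
    then have "\<rho> > 0" using that by (simp add: \<rho>_def)
    have "\<forall>\<^sub>F n in sequentially. e n < \<rho>"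
      using order_tendstoD(2)[OF e_lim \<open>\<rho> > 0\<close>] .
    then obtain N0 where N0: "\<And>n. n \<ge> N0 \<Longrightarrow> e n < \<rho>"
      by (auto simp: eventually_sequentially)
    have "\<exists>N. \<forall>m\<ge>N. \<forall>n\<ge>N. (L2_inner \<Omega> (\<psi> m) g - L2_inner \<Omega> (\<psi> n) g)\<^sup>2 < \<rho>" if "g \<in> G" for g
    proof -
      have "Cauchy (\<lambda>n. L2_inner \<Omega> (\<psi> n) g)"
        using convergent_Cauchy[OF r(2)[OF that]] by (simp add: \<psi>_def)
      then obtain N where N: "\<And>m n. m \<ge> N \<Longrightarrow> n \<ge> N \<Longrightarrow> \<bar>L2_inner \<Omega> (\<psi> m) g - L2_inner \<Omega> (\<psi> n) g\<bar> < sqrt \<rho>"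
        using \<open>\<rho> > 0\<close> unfolding Cauchy_def dist_real_def by (metis real_sqrt_gt_zero)
      have "(L2_inner \<Omega> (\<psi> m) g - L2_inner \<Omega> (\<psi> n) g)\<^sup>2 < \<rho>" if "m \<ge> N" "n \<ge> N" for m n
        using power_strict_mono[OF N[OF that], of 2] \<open>\<rho> > 0\<close> by simp
      then show ?thesis by blast
    qed
    then obtain N1 where N1: "\<And>g m n. g \<in> G \<Longrightarrow> m \<ge> N1 g \<Longrightarrow> n \<ge> N1 g \<Longrightarrow>
        (L2_inner \<Omega> (\<psi> m) g - L2_inner \<Omega> (\<psi> n) g)\<^sup>2 < \<rho>"
      by metis
    define N where "N = Max (insert N0 (N1 ` G))"
    have N: "N \<ge> N0" "\<And>g. g \<in> G \<Longrightarrow> N \<ge> N1 g"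
      using G(1) by (auto simp: N_def)
    have "?d m n < \<epsilon>" if "m \<ge> N" "n \<ge> N" for m n
    proof -
      have "?\<Delta> m n \<le> (\<Sum>g\<in>G. \<rho>)"
      proof (rule sum_mono)
        fix g assume "g \<in> G"
        then show "(L2_inner \<Omega> (\<psi> m) g - L2_inner \<Omega> (\<psi> n) g)\<^sup>2 \<le> \<rho>"
          using N1[of g m n] N(2)[of g] that by simp
      qed
      then have "C * ?\<Delta> m n \<le> C * (real (card G) * \<rho>)"
        using G(3) by (intro mult_left_mono) auto
      moreover have "\<eta> * (e m + e n) \<le> \<eta> * (2 * \<rho>)"
        using N0[of m] N0[of n] N(1) that \<eta>(1) by (intro mult_left_mono) auto
      ultimately have "?d m n \<le> (4 * \<eta> + 2 * C * real (card G)) * \<rho>"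
        using d_le[of m n] by (simp add: algebra_simps)
      also have "\<dots> < (4 * \<eta> + 2 * C * real (card G) + 1) * \<rho>"
        using \<open>\<rho> > 0\<close> by (simp add: distrib_right)
      also have "\<dots> = \<epsilon>" using den by (simp add: \<rho>_def)
      finally show ?thesis .
    qed
    then show ?thesis by blast
  qed
  have "\<exists>v\<in>L2 \<Omega>. (\<lambda>n. L2_norm \<Omega> (\<lambda>x. \<psi> n x - v x)) \<longlonglongrightarrow> 0"
  proof (rule L2_complete_domain[OF \<psi>(3)])
    fix \<epsilon> :: real assume "\<epsilon> > 0"
    then obtain N where N: "\<And>m n. m \<ge> N \<Longrightarrow> n \<ge> N \<Longrightarrow> ?d m n < \<epsilon>\<^sup>2"
      using d_small[of "\<epsilon>\<^sup>2"] by auto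
    have "L2_norm \<Omega> (\<lambda>x. \<psi> m x - \<psi> n x) < \<epsilon>" if "m \<ge> N" "n \<ge> N" for m n
      by (rule power2_less_imp_less[OF N[OF that]]) (use \<open>\<epsilon> > 0\<close> in simp)
    then show "\<exists>N. \<forall>m\<ge>N. \<forall>n\<ge>N. L2_norm \<Omega> (\<lambda>x. \<psi> m x - \<psi> n x) < \<epsilon>"
      by blast
  qed
  then obtain v where v: "v \<in> L2 \<Omega>" "(\<lambda>n. L2_norm \<Omega> (\<lambda>x. \<psi> n x - v x)) \<longlonglongrightarrow> 0" by blast
  have cauchy: "\<exists>N. \<forall>m\<ge>N. \<forall>n\<ge>N. ?D m n < \<epsilon>" if "\<epsilon> > 0" for \<epsilon>
  proof -
    define \<rho> where "\<rho> = \<epsilon> / (\<mu> + 3)"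
    have "\<rho> > 0" using that \<open>\<mu> \<ge> 0\<close> by (simp add: \<rho>_def)
    obtain N1 where N1: "\<And>m n. m \<ge> N1 \<Longrightarrow> n \<ge> N1 \<Longrightarrow> ?d m n < \<rho>"
      using d_small[OF \<open>\<rho> > 0\<close>] by blast
    obtain N0 where N0: "\<And>n. n \<ge> N0 \<Longrightarrow> e n < \<rho>"
      using order_tendstoD(2)[OF e_lim \<open>\<rho> > 0\<close>] by (auto simp: eventually_sequentially)
    have "?D m n < \<epsilon>" if "m \<ge> max N0 N1" "n \<ge> max N0 N1" for m n
    proof -
      have "\<mu> * ?d m n \<le> \<mu> * \<rho>"
        using N1[of m n] that \<open>\<mu> \<ge> 0\<close> by (intro mult_left_mono) auto
      then have "?D m n < \<mu> * \<rho> + 3 * \<rho>"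
        using D_le[of m n] N0[of m] N0[of n] that \<open>\<rho> > 0\<close> by simp
      also have "\<dots> = (\<mu> + 3) * \<rho>" by (simp add: distrib_right)
      also have "\<dots> = \<epsilon>"
        using \<open>\<mu> \<ge> 0\<close> by (simp add: \<rho>_def)
      finally show ?thesis .
    qed
    then show ?thesis by blast
  qed
  obtain g where g: "core v g" "(\<lambda>n. L2_norm \<Omega> (\<lambda>x. op_app B (\<psi> n) x - g x)) \<longlonglongrightarrow> 0"
    using coreI[OF \<psi>(1) v cauchy] by blast
  have g_L2: "g \<in> L2 \<Omega>" using g(1) by (simp add: core_def)
  have "(\<lambda>n. L2_inner \<Omega> (\<psi> n) (\<psi> n)) \<longlonglongrightarrow> L2_inner \<Omega> v v"
    by (intro L2_inner_tendsto) (use \<psi>(3) v in simp_all)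
  moreover have "L2_inner \<Omega> (\<psi> n) (\<psi> n) = 1" for n
    using \<psi>(2)[of n] by (simp flip: L2_norm_power2)
  ultimately have vv: "L2_inner \<Omega> v v = 1"
    by (simp add: LIMSEQ_const_iff)
  have "(\<lambda>n. L2_inner \<Omega> (op_app B (\<psi> n)) (op_app B (\<psi> n))) \<longlonglongrightarrow> L2_inner \<Omega> g g"
    by (intro L2_inner_tendsto) (use op_app_L2[OF \<psi>(1)] g g_L2 in simp_all)
  moreover have "L2_inner \<Omega> (op_app B (\<psi> n)) (op_app B (\<psi> n)) = dirichlet_energy \<Omega> (\<psi> n)" for n
    using test_function_B(2)[OF \<psi>(1)] by (simp add: L2_norm_power2)
  ultimately have "L2_inner \<Omega> g g = \<mu>"
    using LIMSEQ_unique[OF energy_lim] by simp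
  with g(1) vv show ?thesis by (rule that)
qed

text \<open>The minimizer is not shown to be twice weakly differentiable directly. Instead, its
  first variation along w in the domain of A gives (A w, v) = \<mu> (w, v), which places v in the
  domain of the adjoint; self-adjointness of A supplies the regularity.\<close>

lemma minimizer_eigenvalue:
  assumes core: "core v g" and v: "L2_inner \<Omega> v v = 1" "L2_inner \<Omega> g g = \<mu>"
    and lower: "\<And>\<phi>. test_function \<Omega> \<phi> \<Longrightarrow> \<mu> * (L2_norm \<Omega> \<phi>)\<^sup>2 \<le> dirichlet_energy \<Omega> \<phi>"
  shows "eigenvalue \<Omega> (neg_laplacian \<Omega>) \<mu>"
proof -
  have L2: "v \<in> L2 \<Omega>" "g \<in> L2 \<Omega>" using core by (auto simp: core_def)
  have "(v, \<lambda>x. \<mu> * v x) \<in> adjoint_op \<Omega> (neg_laplacian \<Omega>)"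
    unfolding adjoint_op_def
  proof (intro CollectI case_prodI conjI ballI)
    show "v \<in> L2 \<Omega>" "(\<lambda>x. \<mu> * v x) \<in> L2 \<Omega>" using L2 by (auto intro: L2_scale)
    fix wf assume wf: "wf \<in> neg_laplacian \<Omega>"
    obtain w f where wf_eq: "wf = (w, f)" by (cases wf)
    then have "(w, f) \<in> B O B" using wf by (simp add: B_square)
    then obtain k where k: "(w, k) \<in> B" "(k, f) \<in> B" by auto
    have "w \<in> H01 \<Omega>" using wf wf_eq by (auto simp: neg_laplacian_def)
    then have w: "core w k"
      using core_cong[OF H01_core op_app_eq[OF k(1)] B_L2(2)[OF k(1)]] by simp
    note wk = B_L2[OF k(1)]
    \<comment> \<open>The Rayleigh bound along v + s w is a nonnegative quadratic polynomial in s
      without constant term, as v attains the infimum; so its linear coefficient vanishes.\<close>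
    have "L2_inner \<Omega> g k - \<mu> * L2_inner \<Omega> v w = 0"
    proof (rule linear_term_eq_0)
      fix s :: real
      have "\<mu> * L2_inner \<Omega> (\<lambda>r. 1 * v r + s * w r) (\<lambda>r. 1 * v r + s * w r) \<le>
          L2_inner \<Omega> (\<lambda>r. 1 * g r + s * k r) (\<lambda>r. 1 * g r + s * k r)"
        by (rule core_rayleigh[OF core_comb[OF core w] lower])
      then show "0 \<le> 2 * s * (L2_inner \<Omega> g k - \<mu> * L2_inner \<Omega> v w) +
          s\<^sup>2 * (L2_inner \<Omega> k k - \<mu> * L2_inner \<Omega> w w)"
        unfolding L2_inner_comb[OF L2(1) wk(1)] L2_inner_comb[OF L2(2) wk(2)] v
        by (simp add: algebra_simps)
    qed
    moreover have "L2_inner \<Omega> f v = L2_inner \<Omega> k g"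
      by (rule B_symmetric[OF k(2) core_B[OF core]])
    ultimately have "L2_inner \<Omega> f v = L2_inner \<Omega> w (\<lambda>x. \<mu> * v x)"
      by (simp add: L2_inner_scale_right L2_inner_commute[of \<Omega> k] L2_inner_commute[of \<Omega> w])
    then show "case wf of (w, f) \<Rightarrow> L2_inner \<Omega> f v = L2_inner \<Omega> w (\<lambda>x. \<mu> * v x)"
      by (simp add: wf_eq)
  qed
  moreover have "\<not> L2_eq \<Omega> v (\<lambda>x. 0)"
    using v(1) L2_norm_eq_0_iff[OF L2(1)] by (auto simp: L2_norm_def)
  ultimately show ?thesis
    unfolding eigenvalue_def laplacian_self_adjoint by blast
qed

text \<open>Since \<open>lam\<close> is given as an eigenvalue and not as a Rayleigh quotient, the
  infimum \<mu> of the quotient over test functions has to be recognized as an eigenvalue first;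
  then \<open>lam\<close> \<le> \<mu> by minimality.\<close>

lemma test_function_poincare:
  assumes "test_function \<Omega> \<phi>"
  shows "lam * (L2_norm \<Omega> \<phi>)\<^sup>2 \<le> dirichlet_energy \<Omega> \<phi>"
proof (cases "L2_norm \<Omega> \<phi> = 0")
  case True
  then show ?thesis by (simp add: dirichlet_energy_nonneg)
next
  case False
  have scale: "dirichlet_energy \<Omega> (\<lambda>z. c * \<psi> z) = c\<^sup>2 * dirichlet_energy \<Omega> \<psi>" "test_function \<Omega> (\<lambda>z. c * \<psi> z)"
    if "test_function \<Omega> \<psi>" for c \<psi>
    using dirichlet_energy_comb[OF that that, of c 0] test_function_comb[OF that that, of c 0] by simp_all
  define S where "S = {dirichlet_energy \<Omega> \<psi> | \<psi>. test_function \<Omega> \<psi> \<and> L2_norm \<Omega> \<psi> = 1}"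
  define \<mu> where "\<mu> = Inf S"
  have normalized: "dirichlet_energy \<Omega> \<psi> / (L2_norm \<Omega> \<psi>)\<^sup>2 \<in> S" if "test_function \<Omega> \<psi>" "L2_norm \<Omega> \<psi> \<noteq> 0" for \<psi>
  proof -
    let ?\<psi> = "\<lambda>z. (1 / L2_norm \<Omega> \<psi>) * \<psi> z"
    have "L2_norm \<Omega> ?\<psi> = 1"
      using that L2_norm_nonneg[of \<Omega> \<psi>] unfolding L2_norm_scale by simp
    moreover have "dirichlet_energy \<Omega> ?\<psi> = dirichlet_energy \<Omega> \<psi> / (L2_norm \<Omega> \<psi>)\<^sup>2"
      unfolding scale(1)[OF that(1)] by (simp add: power_divide)
    ultimately show ?thesis
      using scale(2)[OF that(1), of "1 / L2_norm \<Omega> \<psi>"] unfolding S_def by (metis (mono_tags, lifting) mem_Collect_eq)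
  qed
  have bdd: "bdd_below S" by (rule bdd_belowI[of _ 0]) (auto simp: S_def dirichlet_energy_nonneg)
  have "S \<noteq> {}" using normalized[OF assms False] by auto
  have "\<mu> \<ge> 0"
    unfolding \<mu>_def using \<open>S \<noteq> {}\<close> by (rule cInf_greatest) (auto simp: S_def dirichlet_energy_nonneg)
  have lower: "\<mu> * (L2_norm \<Omega> \<psi>)\<^sup>2 \<le> dirichlet_energy \<Omega> \<psi>" if "test_function \<Omega> \<psi>" for \<psi>
  proof (cases "L2_norm \<Omega> \<psi> = 0")
    case True
    then show ?thesis by (simp add: dirichlet_energy_nonneg)
  next
    case False
    then have "\<mu> \<le> dirichlet_energy \<Omega> \<psi> / (L2_norm \<Omega> \<psi>)\<^sup>2"
      unfolding \<mu>_def by (intro cInf_lower normalized that bdd)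
    then show ?thesis using False by (simp add: pos_le_divide_eq)
  qed
  have "\<exists>\<psi>. test_function \<Omega> \<psi> \<and> L2_norm \<Omega> \<psi> = 1 \<and> dirichlet_energy \<Omega> \<psi> < \<mu> + 1 / real (Suc n)" for n
  proof -
    obtain s where "s \<in> S" "s < \<mu> + 1 / real (Suc n)"
      using cInf_lessD[OF \<open>S \<noteq> {}\<close>, of "\<mu> + 1 / real (Suc n)"] by (auto simp: \<mu>_def)
    then show ?thesis by (auto simp: S_def)
  qed
  then obtain \<psi> where \<psi>: "\<And>n. test_function \<Omega> (\<psi> n)" "\<And>n. L2_norm \<Omega> (\<psi> n) = 1"
    "\<And>n. dirichlet_energy \<Omega> (\<psi> n) < \<mu> + 1 / real (Suc n)" by metis
  have lim: "(\<lambda>n. dirichlet_energy \<Omega> (\<psi> n)) \<longlonglongrightarrow> \<mu>"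
  proof (rule tendsto_sandwich[of "\<lambda>n. \<mu>" _ _ "\<lambda>n. \<mu> + 1 / real (Suc n)"])
    have "(\<lambda>n. \<mu> + 1 / real (Suc n)) \<longlonglongrightarrow> \<mu> + 0"
      by (intro tendsto_add tendsto_const LIMSEQ_Suc[OF lim_1_over_n])
    then show "(\<lambda>n. \<mu> + 1 / real (Suc n)) \<longlonglongrightarrow> \<mu>" by simp
    show "\<forall>\<^sub>F n in sequentially. \<mu> \<le> dirichlet_energy \<Omega> (\<psi> n)"
      using lower[OF \<psi>(1)] \<psi>(2) by simp
    show "\<forall>\<^sub>F n in sequentially. dirichlet_energy \<Omega> (\<psi> n) \<le> \<mu> + 1 / real (Suc n)"
      using \<psi>(3) by (intro always_eventually allI less_imp_le)
  qed simp
  have "lam \<le> \<mu>"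
  proof (rule minimizing_sequence_converges[OF \<psi>(1,2) lim \<open>\<mu> \<ge> 0\<close> lower])
    fix v g assume *: "core v g" "L2_inner \<Omega> v v = 1" "L2_inner \<Omega> g g = \<mu>"
    show "lam \<le> \<mu>"
      by (rule lam_least[OF minimizer_eigenvalue[OF * lower]])
  qed
  then have "lam * (L2_norm \<Omega> \<phi>)\<^sup>2 \<le> \<mu> * (L2_norm \<Omega> \<phi>)\<^sup>2"
    by (intro mult_right_mono) auto
  with lower[OF assms] show ?thesis by linarith
qed

text \<open>Poincare's inequality for x v + y w, expanded into the shape of the kernel axiom
  \<open>coercive\<close>.\<close>

lemma H01_poincare:
  assumes "v \<in> H01 \<Omega>" "w \<in> H01 \<Omega>"
  shows "lam * (x\<^sup>2 * L2_inner \<Omega> v v + y\<^sup>2 * L2_inner \<Omega> w w + 2 * x * y * L2_inner \<Omega> v w)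
    \<le> x\<^sup>2 * a_form \<Omega> B v v + y\<^sup>2 * a_form \<Omega> B w w + 2 * x * y * a_form \<Omega> B v w"
proof -
  have "lam * L2_inner \<Omega> (\<lambda>r. x * v r + y * w r) (\<lambda>r. x * v r + y * w r) \<le>
      L2_inner \<Omega> (\<lambda>r. x * op_app B v r + y * op_app B w r) (\<lambda>r. x * op_app B v r + y * op_app B w r)"
    by (rule core_rayleigh[OF core_comb[OF H01_core[OF assms(1)] H01_core[OF assms(2)]] test_function_poincare])
  then show ?thesis
    unfolding a_form_def L2_inner_comb[OF B_L2(1)[OF H01_B[OF assms(1)]] B_L2(1)[OF H01_B[OF assms(2)]]]
      L2_inner_comb[OF B_L2(2)[OF H01_B[OF assms(1)]] B_L2(2)[OF H01_B[OF assms(2)]]] .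
qed

end

section \<open>Decay of variational solutions\<close>

text \<open>Points of the product other than (a, b) may have first coordinate a, so the limit has to
  be the value f a itself.\<close>

lemma tendsto_fst_within:
  fixes f :: "real \<Rightarrow> real" and a b :: real
  assumes "(f \<longlongrightarrow> f a) (at a within S)"
  shows "((\<lambda>z. f (fst z)) \<longlongrightarrow> f a) (at (a, b) within S \<times> T)"
proof (rule tendstoI)
  fix e :: real assume "e > 0"
  then obtain d where d: "d > 0" "\<And>x. x \<in> S \<Longrightarrow> x \<noteq> a \<Longrightarrow> dist x a < d \<Longrightarrow> dist (f x) (f a) < e"
    using tendstoD[OF assms \<open>e > 0\<close>] unfolding eventually_at by metis
  have "dist (f (fst z)) (f a) < e" if "z \<in> S \<times> T" "dist z (a, b) < d" for z
  proof (cases "fst z = a")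
    case False
    have "dist (fst z) a < d"
      using dist_fst_le[of z "(a, b)"] that(2) by simp
    then show ?thesis using d(2)[of "fst z"] False that(1) by auto
  qed (use \<open>e > 0\<close> in simp)
  then show "\<forall>\<^sub>F z in at (a, b) within S \<times> T. dist (f (fst z)) (f a) < e"
    unfolding eventually_at using d(1) by blast
qed

lemma tendsto_snd_within:
  fixes f :: "real \<Rightarrow> real" and a b :: real
  assumes "(f \<longlongrightarrow> f b) (at b within T)"
  shows "((\<lambda>z. f (snd z)) \<longlongrightarrow> f b) (at (a, b) within S \<times> T)"
proof (rule tendstoI)
  fix e :: real assume "e > 0"
  then obtain d where d: "d > 0" "\<And>x. x \<in> T \<Longrightarrow> x \<noteq> b \<Longrightarrow> dist x b < d \<Longrightarrow> dist (f x) (f b) < e"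
    using tendstoD[OF assms \<open>e > 0\<close>] unfolding eventually_at by metis
  have "dist (f (snd z)) (f b) < e" if "z \<in> S \<times> T" "dist z (a, b) < d" for z
  proof (cases "snd z = b")
    case False
    have "dist (snd z) b < d"
      using dist_snd_le[of z "(a, b)"] that(2) by simp
    then show ?thesis using d(2)[of "snd z"] False that(1) by auto
  qed (use \<open>e > 0\<close> in simp)
  then show "\<forall>\<^sub>F z in at (a, b) within S \<times> T. dist (f (snd z)) (f b) < e"
    unfolding eventually_at using d(1) by blast
qed

lemma L2_norm_zero: "L2_norm \<Omega> (\<lambda>z. 0) = 0"
  by (simp add: L2_norm_def L2_inner_def)

lemma L2_inner_kernel_continuous:
  assumes x: "\<And>t. t \<in> S \<Longrightarrow> x t \<in> L2 \<Omega>" "\<And>t. t \<in> S \<Longrightarrow> ((\<lambda>s. L2_norm \<Omega> (\<lambda>z. x s z - x t z)) \<longlongrightarrow> 0) (at t within S)"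
    and y: "\<And>t. t \<in> T \<Longrightarrow> y t \<in> L2 \<Omega>" "\<And>t. t \<in> T \<Longrightarrow> ((\<lambda>s. L2_norm \<Omega> (\<lambda>z. y s z - y t z)) \<longlongrightarrow> 0) (at t within T)"
  shows "continuous_on (S \<times> T) (\<lambda>(t :: real, s :: real). L2_inner \<Omega> (x t) (y s))"
  unfolding continuous_on_def
proof
  fix z assume "z \<in> S \<times> T"
  then obtain t s where z: "z = (t, s)" "t \<in> S" "s \<in> T" by auto
  let ?F = "at (t, s) within S \<times> T"
  have ev: "\<forall>\<^sub>F z in ?F. z \<in> S \<times> T" by (simp add: eventually_at_filter)
  have "((\<lambda>z. L2_inner \<Omega> (x (fst z)) (y (snd z))) \<longlongrightarrow> L2_inner \<Omega> (x t) (y s)) ?F"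
  proof (rule L2_inner_tendsto)
    show "\<forall>\<^sub>F z in ?F. x (fst z) \<in> L2 \<Omega>" "\<forall>\<^sub>F z in ?F. y (snd z) \<in> L2 \<Omega>"
      using ev by (eventually_elim, use x(1) y(1) in auto)+
    have "((\<lambda>r. L2_norm \<Omega> (\<lambda>z. x r z - x t z)) \<longlongrightarrow> L2_norm \<Omega> (\<lambda>z. x t z - x t z)) (at t within S)"
      using x(2)[OF z(2)] by (simp add: L2_norm_zero)
    from tendsto_fst_within[OF this]
    show "((\<lambda>r. L2_norm \<Omega> (\<lambda>z. x (fst r) z - x t z)) \<longlongrightarrow> 0) ?F"
      by (simp add: L2_norm_zero)
    have "((\<lambda>r. L2_norm \<Omega> (\<lambda>z. y r z - y s z)) \<longlongrightarrow> L2_norm \<Omega> (\<lambda>z. y s z - y s z)) (at s within T)"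
      using y(2)[OF z(3)] by (simp add: L2_norm_zero)
    from tendsto_snd_within[OF this]
    show "((\<lambda>r. L2_norm \<Omega> (\<lambda>z. y (snd r) z - y s z)) \<longlongrightarrow> 0) ?F"
      by (simp add: L2_norm_zero)
  qed (use z x y in auto)
  then show "((\<lambda>(t, s). L2_inner \<Omega> (x t) (y s)) \<longlongrightarrow> (case z of (t, s) \<Rightarrow> L2_inner \<Omega> (x t) (y s))) (at z within S \<times> T)"
    by (simp add: z(1) case_prod_beta')
qed

section \<open>Kernels of a variational solution\<close>

locale damped_wave = dirichlet +
  fixes \<alpha> \<beta> :: real and u\<^sub>0 u\<^sub>1 :: "'a \<Rightarrow> real" and u u' :: "real \<Rightarrow> 'a \<Rightarrow> real"
  assumes sol: "damped_wave_solution \<Omega> B \<alpha> \<beta> u\<^sub>0 u\<^sub>1 u u'"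
    and pos: "lam > 0" "\<alpha> \<ge> 0" "\<beta> \<ge> 0"
begin

lemma u_H01: "t \<ge> 0 \<Longrightarrow> u t \<in> H01 \<Omega>"
  and u'_L2: "t \<ge> 0 \<Longrightarrow> u' t \<in> L2 \<Omega>"
  and u_norm1_cont: "t \<ge> 0 \<Longrightarrow> ((\<lambda>s. norm1 \<Omega> B (\<lambda>x. u s x - u t x)) \<longlongrightarrow> 0) (at t within {0..})"
  and u_quotient: "t \<ge> 0 \<Longrightarrow> ((\<lambda>s. L2_norm \<Omega> (\<lambda>x. (u s x - u t x) / (s - t) - u' t x)) \<longlongrightarrow> 0) (at t within {0..})"
  and u'_cont: "t \<ge> 0 \<Longrightarrow> ((\<lambda>s. L2_norm \<Omega> (\<lambda>x. u' s x - u' t x)) \<longlongrightarrow> 0) (at t within {0..})"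
  and u'_H01: "\<beta> > 0 \<Longrightarrow> t > 0 \<Longrightarrow> u' t \<in> H01 \<Omega>"
  and variational: "v \<in> H01 \<Omega> \<Longrightarrow> t > 0 \<Longrightarrow> \<exists>r. ((\<lambda>s. L2_inner \<Omega> (u' s) v) has_real_derivative r) (at t) \<and>
    r + \<beta> * a_form \<Omega> B (u' t) v + \<alpha> * L2_inner \<Omega> (u' t) v + a_form \<Omega> B (u t) v = 0"
  using sol unfolding damped_wave_solution_def by simp_all

lemma u_B: "t \<ge> 0 \<Longrightarrow> (u t, op_app B (u t)) \<in> B"
  by (rule H01_B[OF u_H01])

lemma u_L2: "t \<ge> 0 \<Longrightarrow> u t \<in> L2 \<Omega>" and Bu_L2: "t \<ge> 0 \<Longrightarrow> op_app B (u t) \<in> L2 \<Omega>"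
  using u_B B_L2 by blast+

lemma Bu_cont:
  assumes "t \<ge> 0"
  shows "((\<lambda>s. L2_norm \<Omega> (\<lambda>x. op_app B (u s) x - op_app B (u t) x)) \<longlongrightarrow> 0) (at t within {0..})"
proof -
  have "norm1 \<Omega> B (\<lambda>x. u s x - u t x) = L2_norm \<Omega> (\<lambda>x. op_app B (u s) x - op_app B (u t) x)" if "s \<ge> 0" for s
    using norm1_eq[OF B_comb[OF u_B[OF that] u_B[OF assms], of 1 "- 1"]] by simp
  then have "\<forall>\<^sub>F s in at t within {0..}. norm1 \<Omega> B (\<lambda>x. u s x - u t x) =
      L2_norm \<Omega> (\<lambda>x. op_app B (u s) x - op_app B (u t) x)"
    by (simp add: eventually_at_filter)
  then show ?thesis
    using u_norm1_cont[OF assms] by (simp add: filterlim_cong[OF refl refl])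
qed

text \<open>Continuity in time is assumed in the norm |.|_1; Poincare's inequality passes it on to
  L^2.\<close>

lemma u_cont:
  assumes "t \<ge> 0"
  shows "((\<lambda>s. L2_norm \<Omega> (\<lambda>x. u s x - u t x)) \<longlongrightarrow> 0) (at t within {0..})"
proof (rule tendsto_sandwich[of "\<lambda>s. 0" _ _ "\<lambda>s. L2_norm \<Omega> (\<lambda>x. op_app B (u s) x - op_app B (u t) x) / sqrt lam"])
  have "L2_norm \<Omega> (\<lambda>x. u s x - u t x) \<le> L2_norm \<Omega> (\<lambda>x. op_app B (u s) x - op_app B (u t) x) / sqrt lam"
    if "s \<ge> 0" for s
  proof -
    have "lam * L2_inner \<Omega> (\<lambda>x. 1 * u s x + - 1 * u t x) (\<lambda>x. 1 * u s x + - 1 * u t x) \<le>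
        L2_inner \<Omega> (\<lambda>x. 1 * op_app B (u s) x + - 1 * op_app B (u t) x) (\<lambda>x. 1 * op_app B (u s) x + - 1 * op_app B (u t) x)"
      by (rule core_rayleigh[OF core_comb[OF H01_core[OF u_H01[OF that]] H01_core[OF u_H01[OF assms]]] test_function_poincare])
    then have "sqrt (lam * L2_inner \<Omega> (\<lambda>x. u s x - u t x) (\<lambda>x. u s x - u t x)) \<le>
        L2_norm \<Omega> (\<lambda>x. op_app B (u s) x - op_app B (u t) x)"
      unfolding L2_norm_def by (intro real_sqrt_le_mono) simp
    then show ?thesis
      using pos(1) by (simp add: real_sqrt_mult L2_norm_def pos_le_divide_eq mult.commute)
  qed
  then show "\<forall>\<^sub>F s in at t within {0..}. L2_norm \<Omega> (\<lambda>x. u s x - u t x) \<le>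
      L2_norm \<Omega> (\<lambda>x. op_app B (u s) x - op_app B (u t) x) / sqrt lam"
    by (simp add: eventually_at_filter)
  show "((\<lambda>s. L2_norm \<Omega> (\<lambda>x. op_app B (u s) x - op_app B (u t) x) / sqrt lam) \<longlongrightarrow> 0) (at t within {0..})"
    using tendsto_divide_zero[OF Bu_cont[OF assms]] by simp
qed (simp_all add: L2_norm_nonneg)

lemma u_deriv:
  assumes "t > 0" "w \<in> L2 \<Omega>"
  shows "((\<lambda>s. L2_inner \<Omega> (u s) w) has_real_derivative L2_inner \<Omega> (u' t) w) (at t)"
proof -
  have t: "t \<ge> 0" using assms by simp
  have ev: "\<forall>\<^sub>F s in at t within {0..}. s \<in> {0..}" by (simp add: eventually_at_filter)
  have quot: "(\<lambda>x. (u s x - u t x) / (s - t)) = (\<lambda>x. (1 / (s - t)) * (u s x - u t x))" for s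
    by (simp add: fun_eq_iff)
  have "((\<lambda>s. L2_inner \<Omega> (\<lambda>x. (u s x - u t x) / (s - t)) w) \<longlongrightarrow> L2_inner \<Omega> (u' t) w) (at t within {0..})"
  proof (rule L2_inner_tendsto[OF _ u'_L2[OF t] u_quotient[OF t]])
    show "\<forall>\<^sub>F s in at t within {0..}. (\<lambda>x. (u s x - u t x) / (s - t)) \<in> L2 \<Omega>"
      using ev by eventually_elim (simp only: quot atLeast_iff L2_scale L2_diff u_L2 t)
  qed (use assms in \<open>simp_all add: L2_norm_zero\<close>)
  moreover have "\<forall>\<^sub>F s in at t within {0..}. L2_inner \<Omega> (\<lambda>x. (u s x - u t x) / (s - t)) w =
      (L2_inner \<Omega> (u s) w - L2_inner \<Omega> (u t) w) / (s - t)"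
    using ev
  proof eventually_elim
    case (elim s)
    then show ?case
      unfolding quot L2_inner_scale_left using u_L2[of s] u_L2[OF t] assms(2) by (simp add: L2_inner_diff_left)
  qed
  ultimately have "((\<lambda>s. L2_inner \<Omega> (u s) w) has_real_derivative L2_inner \<Omega> (u' t) w) (at t within {0..})"
    unfolding has_field_derivative_iff by (simp add: filterlim_cong[OF refl refl])
  then show ?thesis
    using assms(1) by (simp add: at_within_interior[of t "{0..}"] interior_real_atLeast)
qed

text \<open>For \<open>\<beta> > 0\<close> the form \<open>a(u(t), v)\<close> is only known to be differentiable in time if \<open>v\<close> is a
  test function, so that \<open>A v\<close> is square integrable. The sum with \<open>(u'(t), v)\<close>
  has the derivative \<open>- \<alpha> (u', v) - a(u, v)\<close>, which depends continuously on \<open>v \<in> H\<^sub>0\<^sup>1(\<Omega>)\<close>.\<close>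

lemma evolution_test_function:
  assumes "test_function \<Omega> \<phi>" "t > 0"
  shows "((\<lambda>s. L2_inner \<Omega> (u' s) \<phi> + \<beta> * a_form \<Omega> B (u s) \<phi>) has_real_derivative
    - \<alpha> * L2_inner \<Omega> (u' t) \<phi> - a_form \<Omega> B (u t) \<phi>) (at t)"
proof -
  have "\<phi> \<in> H01 \<Omega>"
    using test_function_neg_laplacian[OF assms(1) open_domain] by (auto simp: neg_laplacian_def)
  then obtain r where r: "((\<lambda>s. L2_inner \<Omega> (u' s) \<phi>) has_real_derivative r) (at t)"
    "r + \<beta> * a_form \<Omega> B (u' t) \<phi> + \<alpha> * L2_inner \<Omega> (u' t) \<phi> + a_form \<Omega> B (u t) \<phi> = 0"
    using variational[OF _ assms(2)] by blast
  show ?thesis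
  proof (cases "\<beta> = 0")
    case True
    then have "r = - \<alpha> * L2_inner \<Omega> (u' t) \<phi> - a_form \<Omega> B (u t) \<phi>"
      using r(2) by simp
    then show ?thesis using r(1) True by simp
  next
    case False
    then have "\<beta> > 0" using pos by simp
    obtain g where g: "\<And>v z. (v, z) \<in> B \<Longrightarrow> g \<in> L2 \<Omega> \<and> a_form \<Omega> B v \<phi> = L2_inner \<Omega> v g"
      using test_function_B(3)[OF assms(1)] by blast
    have g_L2: "g \<in> L2 \<Omega>" using g[OF u_B[of 0]] by simp
    have "((\<lambda>s. a_form \<Omega> B (u s) \<phi>) has_real_derivative L2_inner \<Omega> (u' t) g) (at t)"
    proof (rule has_field_derivative_transform_within_open[OF u_deriv[OF assms(2) g_L2], of "{0<..}"])
      show "L2_inner \<Omega> (u s) g = a_form \<Omega> B (u s) \<phi>" if "s \<in> {0<..}" for s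
        using g[OF u_B[of s]] that by simp
    qed (use assms in auto)
    moreover have "L2_inner \<Omega> (u' t) g = a_form \<Omega> B (u' t) \<phi>"
      using g[OF H01_B[OF u'_H01[OF \<open>\<beta> > 0\<close> assms(2)]]] by simp
    ultimately have "((\<lambda>s. L2_inner \<Omega> (u' s) \<phi> + \<beta> * a_form \<Omega> B (u s) \<phi>) has_real_derivative
        r + \<beta> * a_form \<Omega> B (u' t) \<phi>) (at t)"
      using r(1) by (intro DERIV_add DERIV_cmult) simp_all
    moreover have "r + \<beta> * a_form \<Omega> B (u' t) \<phi> = - \<alpha> * L2_inner \<Omega> (u' t) \<phi> - a_form \<Omega> B (u t) \<phi>"
      using r(2) by simp
    ultimately show ?thesis by simp
  qed
qed

lemma norm_bounded_on_compact:
  fixes x :: "real \<Rightarrow> 'a \<Rightarrow> real" and b :: real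
  assumes x: "\<And>t. t \<ge> 0 \<Longrightarrow> x t \<in> L2 \<Omega>" "\<And>t. t \<ge> 0 \<Longrightarrow> ((\<lambda>s. L2_norm \<Omega> (\<lambda>z. x s z - x t z)) \<longlongrightarrow> 0) (at t within {0..})"
  shows "\<exists>M. \<forall>t\<in>{0..b}. L2_norm \<Omega> (x t) \<le> M"
proof -
  have "continuous_on ({0..} \<times> {0..}) (\<lambda>(t, s). L2_inner \<Omega> (x t) (x s))"
    by (rule L2_inner_kernel_continuous) (use x in auto)
  then have "continuous_on {0..b} (\<lambda>t. (\<lambda>(t, s). L2_inner \<Omega> (x t) (x s)) (t, t))"
    by (rule continuous_on_compose2) (auto intro!: continuous_intros)
  then have "continuous_on {0..b} (\<lambda>t. L2_norm \<Omega> (x t))"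
    unfolding L2_norm_def by (intro continuous_intros) simp
  then have "bounded ((\<lambda>t. L2_norm \<Omega> (x t)) ` {0..b})"
    by (intro compact_imp_bounded compact_continuous_image) auto
  then show ?thesis
    by (auto simp: bounded_iff L2_norm_nonneg)
qed

text \<open>Approximate v by test functions in the graph norm of \<open>B\<close>. The time
  derivatives then converge uniformly near t, so the limit of the functions is differentiable with
  the limit derivative. In this form u(s) itself may serve as v, as the kernels require.\<close>

lemma evolution_H01:
  assumes "v \<in> H01 \<Omega>" "t > 0"
  shows "((\<lambda>s. L2_inner \<Omega> (u' s) v + \<beta> * a_form \<Omega> B (u s) v) has_real_derivative
    - \<alpha> * L2_inner \<Omega> (u' t) v - a_form \<Omega> B (u t) v) (at t)"
proof -
  obtain \<phi> where \<phi>': "v \<in> L2 \<Omega>" "op_app B v \<in> L2 \<Omega>" "\<forall>n. test_function \<Omega> (\<phi> n)"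
    "(\<lambda>n. L2_norm \<Omega> (\<lambda>x. \<phi> n x - v x)) \<longlonglongrightarrow> 0" "(\<lambda>n. L2_norm \<Omega> (\<lambda>x. op_app B (\<phi> n) x - op_app B v x)) \<longlonglongrightarrow> 0"
    by (rule coreE[OF H01_core[OF assms(1)]])
  note \<phi> = \<phi>'(1,2) \<phi>'(3)[rule_format] \<phi>'(4,5)
  have test_L2: "\<phi> n \<in> L2 \<Omega>" "op_app B (\<phi> n) \<in> L2 \<Omega>" for n
    using \<phi>(3) by (auto intro: test_function_in_L2 op_app_L2)
  obtain M1 where M1: "\<And>s. s \<in> {0..2 * t} \<Longrightarrow> L2_norm \<Omega> (u' s) \<le> M1"
    using norm_bounded_on_compact[OF u'_L2 u'_cont, of "2 * t"] by blast
  obtain M2 where M2: "\<And>s. s \<in> {0..2 * t} \<Longrightarrow> L2_norm \<Omega> (op_app B (u s)) \<le> M2"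
    using norm_bounded_on_compact[OF Bu_L2 Bu_cont, of "2 * t"] by blast
  \<comment> \<open>An interval around t on which the norms of u' and of its companion
    \<open>op_app B (u s)\<close> are bounded by \<open>M1\<close> and \<open>M2\<close>; these
    bounds make the convergence uniform.\<close>
  let ?S = "{0<..<2 * t}"
  define f where "f w s = L2_inner \<Omega> (u' s) w + \<beta> * a_form \<Omega> B (u s) w" for w s
  define f' where "f' w s = - \<alpha> * L2_inner \<Omega> (u' s) w - a_form \<Omega> B (u s) w" for w s
  define e where "e n = \<alpha> * (M1 * L2_norm \<Omega> (\<lambda>x. \<phi> n x - v x)) + M2 * L2_norm \<Omega> (\<lambda>x. op_app B (\<phi> n) x - op_app B v x)" for n
  have "e \<longlonglongrightarrow> \<alpha> * (M1 * 0) + M2 * 0"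
    unfolding e_def by (intro tendsto_intros \<phi>)
  then have e_lim: "e \<longlonglongrightarrow> 0" by simp
  have f'_diff: "\<bar>f' (\<phi> n) s - f' v s\<bar> \<le> e n" if "s \<in> ?S" for n s
  proof -
    have s: "s \<ge> 0" "s \<in> {0..2 * t}" using that by auto
    have "\<bar>L2_inner \<Omega> (u' s) (\<lambda>x. \<phi> n x - v x)\<bar> \<le> L2_norm \<Omega> (u' s) * L2_norm \<Omega> (\<lambda>x. \<phi> n x - v x)"
      by (intro L2_cauchy_schwarz u'_L2 s L2_diff test_L2 \<phi>)
    also have "\<dots> \<le> M1 * L2_norm \<Omega> (\<lambda>x. \<phi> n x - v x)"
      by (intro mult_right_mono M1 s L2_norm_nonneg)
    finally have 1: "\<alpha> * \<bar>L2_inner \<Omega> (u' s) (\<lambda>x. \<phi> n x - v x)\<bar> \<le> \<alpha> * (M1 * L2_norm \<Omega> (\<lambda>x. \<phi> n x - v x))"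
      using pos(2) by (rule mult_left_mono)
    have "\<bar>L2_inner \<Omega> (op_app B (u s)) (\<lambda>x. op_app B (\<phi> n) x - op_app B v x)\<bar> \<le>
        L2_norm \<Omega> (op_app B (u s)) * L2_norm \<Omega> (\<lambda>x. op_app B (\<phi> n) x - op_app B v x)"
      by (intro L2_cauchy_schwarz Bu_L2 s L2_diff test_L2 \<phi>)
    also have "\<dots> \<le> M2 * L2_norm \<Omega> (\<lambda>x. op_app B (\<phi> n) x - op_app B v x)"
      by (intro mult_right_mono M2 s L2_norm_nonneg)
    finally have 2: "\<bar>L2_inner \<Omega> (op_app B (u s)) (\<lambda>x. op_app B (\<phi> n) x - op_app B v x)\<bar> \<le>
        M2 * L2_norm \<Omega> (\<lambda>x. op_app B (\<phi> n) x - op_app B v x)" .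
    have "f' (\<phi> n) s - f' v s = - \<alpha> * L2_inner \<Omega> (u' s) (\<lambda>x. \<phi> n x - v x) -
        L2_inner \<Omega> (op_app B (u s)) (\<lambda>x. op_app B (\<phi> n) x - op_app B v x)"
      unfolding f'_def a_form_def L2_inner_diff_right[OF test_L2(1) \<phi>(1) u'_L2[OF s(1)]]
        L2_inner_diff_right[OF test_L2(2) \<phi>(2) Bu_L2[OF s(1)]]
      by (simp add: algebra_simps)
    then have "\<bar>f' (\<phi> n) s - f' v s\<bar> \<le> \<alpha> * \<bar>L2_inner \<Omega> (u' s) (\<lambda>x. \<phi> n x - v x)\<bar> +
        \<bar>L2_inner \<Omega> (op_app B (u s)) (\<lambda>x. op_app B (\<phi> n) x - op_app B v x)\<bar>"
      using abs_triangle_ineq4[of "- \<alpha> * L2_inner \<Omega> (u' s) (\<lambda>x. \<phi> n x - v x)"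
        "L2_inner \<Omega> (op_app B (u s)) (\<lambda>x. op_app B (\<phi> n) x - op_app B v x)"] pos(2)
      by (simp add: abs_mult)
    then show ?thesis
      using 1 2 by (simp add: e_def)
  qed
  have f_lim: "(\<lambda>n. f (\<phi> n) s) \<longlonglongrightarrow> f v s" if "s \<in> ?S" for s
    unfolding f_def a_form_def
    by (intro tendsto_add tendsto_mult_left L2_inner_tendsto)
      (use that u'_L2 Bu_L2 test_L2 \<phi> in \<open>simp_all add: L2_norm_zero\<close>)
  have "\<exists>g. \<forall>s\<in>?S. (\<lambda>n. f (\<phi> n) s) \<longlonglongrightarrow> g s \<and> (g has_derivative (*) (f' v s)) (at s within ?S)"
  proof (rule has_derivative_sequence)
    show "convex ?S" by simp
    show "(f (\<phi> n) has_derivative (*) (f' (\<phi> n) s)) (at s within ?S)" if "s \<in> ?S" for n s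
      using evolution_test_function[OF \<phi>(3), of s n] that unfolding f_def f'_def
      by (auto simp: has_field_derivative_def intro: has_derivative_at_withinI)
    show "\<forall>\<^sub>F n in sequentially. \<forall>s\<in>?S. \<forall>h. norm (f' (\<phi> n) s * h - f' v s * h) \<le> \<epsilon> * norm h" if "\<epsilon> > 0" for \<epsilon>
      using order_tendstoD(2)[OF e_lim that]
    proof eventually_elim
      case (elim n)
      show ?case
      proof (intro ballI allI)
        fix s h assume "s \<in> ?S"
        have "\<bar>f' (\<phi> n) s - f' v s\<bar> * \<bar>h\<bar> \<le> \<epsilon> * \<bar>h\<bar>"
          using f'_diff[OF \<open>s \<in> ?S\<close>, of n] elim by (intro mult_right_mono) auto
        then show "norm (f' (\<phi> n) s * h - f' v s * h) \<le> \<epsilon> * norm h"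
          by (simp add: abs_mult flip: left_diff_distrib)
      qed
    qed
    show "t \<in> ?S" using assms by simp
    show "(\<lambda>n. f (\<phi> n) t) \<longlonglongrightarrow> f v t"
      by (rule f_lim) (use assms in simp)
  qed
  then obtain g where g: "\<And>s. s \<in> ?S \<Longrightarrow> (\<lambda>n. f (\<phi> n) s) \<longlonglongrightarrow> g s"
    "\<And>s. s \<in> ?S \<Longrightarrow> (g has_derivative (*) (f' v s)) (at s within ?S)"
    by blast
  have t: "t \<in> ?S" using assms by simp
  have "(g has_real_derivative f' v t) (at t)"
    using g(2)[OF t] at_within_open[OF t] by (simp add: has_field_derivative_def)
  then have "(f v has_real_derivative f' v t) (at t)"
  proof (rule has_field_derivative_transform_within_open[of _ _ _ ?S])
    show "g s = f v s" if "s \<in> ?S" for s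
      using LIMSEQ_unique[OF g(1)[OF that] f_lim[OF that]] .
  qed (use t in auto)
  then show ?thesis
    unfolding f_def f'_def .
qed

lemma damped_kernel_solution:
  "damped_kernel (\<lambda>t s. L2_inner \<Omega> (u t) (u s)) (\<lambda>t s. L2_inner \<Omega> (u' t) (u s))
    (\<lambda>t s. L2_inner \<Omega> (u' t) (u' s)) (\<lambda>t s. a_form \<Omega> B (u t) (u s)) \<alpha> \<beta> 1 0 lam"
proof
  show "continuous_on ({0..} \<times> {0..}) (\<lambda>(t, s). L2_inner \<Omega> (u t) (u s))"
    "continuous_on ({0..} \<times> {0..}) (\<lambda>(t, s). L2_inner \<Omega> (u' t) (u s))"
    "continuous_on ({0..} \<times> {0..}) (\<lambda>(t, s). L2_inner \<Omega> (u' t) (u' s))"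
    by (rule L2_inner_kernel_continuous; simp add: u_L2 u'_L2 u_cont u'_cont)+
  show "continuous_on ({0..} \<times> {0..}) (\<lambda>(t, s). a_form \<Omega> B (u t) (u s))"
    unfolding a_form_def
    by (rule L2_inner_kernel_continuous; simp add: Bu_L2 Bu_cont)
next
  fix t s :: real
  show "L2_inner \<Omega> (u s) (u t) = L2_inner \<Omega> (u t) (u s)" "L2_inner \<Omega> (u' s) (u' t) = L2_inner \<Omega> (u' t) (u' s)"
    "a_form \<Omega> B (u s) (u t) = a_form \<Omega> B (u t) (u s)"
    unfolding a_form_def by (rule L2_inner_commute)+
next
  fix t s :: real assume "t > 0" "s > 0"
  then show "((\<lambda>t. L2_inner \<Omega> (u t) (u s)) has_real_derivative L2_inner \<Omega> (u' t) (u s)) (at t)"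
    by (intro u_deriv u_L2) simp_all
  show "((\<lambda>s. L2_inner \<Omega> (u' t) (u s)) has_real_derivative L2_inner \<Omega> (u' t) (u' s)) (at s)"
    using u_deriv[OF \<open>s > 0\<close> u'_L2, of t] \<open>t > 0\<close> by (simp add: L2_inner_commute[of \<Omega> "u' t"])
  show "((\<lambda>t. L2_inner \<Omega> (u' t) (u s) + \<beta> * a_form \<Omega> B (u t) (u s)) has_real_derivative
      - \<alpha> * L2_inner \<Omega> (u' t) (u s) - 1 * a_form \<Omega> B (u t) (u s) - 0 * L2_inner \<Omega> (u t) (u s)) (at t)"
    using evolution_H01[OF u_H01 \<open>t > 0\<close>, of s] \<open>s > 0\<close> by simp
next
  fix t s x y z :: real assume ts: "t \<ge> 0" "s \<ge> 0"
  have L2: "u t \<in> L2 \<Omega>" "u s \<in> L2 \<Omega>" "u' t \<in> L2 \<Omega>" "(\<lambda>r. x * u t r + y * u s r) \<in> L2 \<Omega>"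
    using ts by (auto intro!: u_L2 u'_L2 L2_add L2_scale)
  have cross: "L2_inner \<Omega> (\<lambda>r. x * u t r + y * u s r) (u' t) =
      x * L2_inner \<Omega> (u' t) (u t) + y * L2_inner \<Omega> (u' t) (u s)"
    unfolding L2_inner_add_left[OF L2_scale[OF L2(1)] L2_scale[OF L2(2)] L2(3)] L2_inner_scale_left
    by (simp only: L2_inner_commute[of \<Omega> "u t"] L2_inner_commute[of \<Omega> "u s"])
  have "0 \<le> L2_inner \<Omega> (\<lambda>r. 1 * (x * u t r + y * u s r) + z * u' t r) (\<lambda>r. 1 * (x * u t r + y * u s r) + z * u' t r)"
    by (rule L2_inner_self_nonneg)
  also have "\<dots> = x\<^sup>2 * L2_inner \<Omega> (u t) (u t) + y\<^sup>2 * L2_inner \<Omega> (u s) (u s) + z\<^sup>2 * L2_inner \<Omega> (u' t) (u' t) +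
      2 * x * y * L2_inner \<Omega> (u t) (u s) + 2 * x * z * L2_inner \<Omega> (u' t) (u t) + 2 * y * z * L2_inner \<Omega> (u' t) (u s)"
    unfolding L2_inner_comb[OF L2(4,3)] L2_inner_comb[OF L2(1,2)] cross by (simp add: algebra_simps)
  finally show "0 \<le> x\<^sup>2 * L2_inner \<Omega> (u t) (u t) + y\<^sup>2 * L2_inner \<Omega> (u s) (u s) + z\<^sup>2 * L2_inner \<Omega> (u' t) (u' t) +
      2 * x * y * L2_inner \<Omega> (u t) (u s) + 2 * x * z * L2_inner \<Omega> (u' t) (u t) + 2 * y * z * L2_inner \<Omega> (u' t) (u s)" .
  show "lam * (x\<^sup>2 * L2_inner \<Omega> (u t) (u t) + y\<^sup>2 * L2_inner \<Omega> (u s) (u s) + 2 * x * y * L2_inner \<Omega> (u t) (u s))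
      \<le> x\<^sup>2 * a_form \<Omega> B (u t) (u t) + y\<^sup>2 * a_form \<Omega> B (u s) (u s) + 2 * x * y * a_form \<Omega> B (u t) (u s)"
    using ts by (intro H01_poincare u_H01)
qed (use pos in auto)

lemma energy_eq: "energy \<Omega> B u u' t = (L2_inner \<Omega> (u' t) (u' t) + a_form \<Omega> B (u t) (u t)) / 2"
  by (simp add: energy_def L2_norm_power2 norm1_def a_form_def)

end

text \<open>The side conditions reflect the spectrum. For \<delta> = (\<alpha> + \<beta>
  \<open>lam\<^sub>1\<close>) / 2, the first mode contains t exp (- \<delta> t) if \<delta>^2 =
  \<open>lam\<^sub>1\<close> and decays more slowly than exp (- \<delta> t) if \<delta>^2 >
  \<open>lam\<^sub>1\<close>; if \<beta> \<delta> > 1, the high modes are too slow, since their slow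
  rates tend to 1 / \<beta>. In the second part, \<delta> > (\<alpha> + \<beta>
  \<open>lam\<^sub>1\<close>) / 2 would make the first mode oscillate and decay at the smaller rate
  (\<alpha> + \<beta> \<open>lam\<^sub>1\<close>) / 2.\<close>

theorem theorem2p1:
  fixes \<alpha> \<beta> lam\<^sub>1 :: real
  assumes damping: "(\<alpha> > 0 \<and> \<beta> \<ge> 0) \<or> (\<alpha> \<ge> 0 \<and> \<beta> > 0)"
    and "lam\<^sub>1 > 0"
  shows
    "(\<exists>C>0. \<forall>(\<Omega> :: 'a::euclidean_space set) B u\<^sub>0 u\<^sub>1 u u' \<delta>.
        dirichlet_setting \<Omega> B lam\<^sub>1 \<and> damped_wave_solution \<Omega> B \<alpha> \<beta> u\<^sub>0 u\<^sub>1 u u' \<and>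
        (0 < \<delta> \<and> \<delta> < min ((\<alpha> + \<beta> * lam\<^sub>1) / 2) (lam\<^sub>1 / (\<alpha> + \<beta> * lam\<^sub>1)) \<or>
         0 < \<delta> \<and> \<delta> = (\<alpha> + \<beta> * lam\<^sub>1) / 2 \<and> \<delta>\<^sup>2 < lam\<^sub>1 \<and> \<beta> * \<delta> \<le> 1) \<longrightarrow>
        (\<forall>t\<ge>0. energy \<Omega> B u u' t \<le> C * exp (- 2 * \<delta> * t) * energy \<Omega> B u u' 0)) \<and>
     (\<forall>(\<Omega> :: 'a set) B \<delta>.
        dirichlet_setting \<Omega> B lam\<^sub>1 \<and>
        \<delta> = lam\<^sub>1 / (\<alpha> + \<beta> * lam\<^sub>1) \<and> \<delta> \<le> (\<alpha> + \<beta> * lam\<^sub>1) / 2 \<longrightarrow>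
        (\<exists>C>0. \<forall>u\<^sub>0 u\<^sub>1 u u'. damped_wave_solution \<Omega> B \<alpha> \<beta> u\<^sub>0 u\<^sub>1 u u' \<longrightarrow>
           (\<forall>t\<ge>0. (L2_norm \<Omega> (u' t))\<^sup>2 \<le> C * exp (- 2 * \<delta> * t) * energy \<Omega> B u u' 0)))"
proof -
  from kernel_decay[OF assms] obtain C where "C > 0" and C: "\<forall>p q m a \<delta>. damped_kernel p q m a \<alpha> \<beta> 1 0 lam\<^sub>1 \<and>
      0 < \<delta> \<and> \<delta> \<le> (\<alpha> + \<beta> * lam\<^sub>1) / 2 \<and>
      (\<delta> \<le> lam\<^sub>1 / (\<alpha> + \<beta> * lam\<^sub>1) \<or> \<delta> = (\<alpha> + \<beta> * lam\<^sub>1) / 2 \<and> \<delta>\<^sup>2 < lam\<^sub>1 \<and> \<beta> * \<delta> \<le> 1) \<longrightarrow>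
      (\<forall>t\<ge>0. m t t + a t t \<le> C * exp (- 2 * \<delta> * t) * (m 0 0 + a 0 0))"
    by (elim exE conjE)
  have \<mu>: "\<alpha> + \<beta> * lam\<^sub>1 > 0"
    using assms by (auto simp: add_pos_nonneg add_nonneg_pos)
  have decay: "energy \<Omega> B u u' t \<le> C * exp (- 2 * \<delta> * t) * energy \<Omega> B u u' 0"
    if setting: "dirichlet_setting \<Omega> B lam\<^sub>1" and sol: "damped_wave_solution \<Omega> B \<alpha> \<beta> u\<^sub>0 u\<^sub>1 u u'"
      and \<delta>: "0 < \<delta>" "\<delta> \<le> (\<alpha> + \<beta> * lam\<^sub>1) / 2"
        "\<delta> \<le> lam\<^sub>1 / (\<alpha> + \<beta> * lam\<^sub>1) \<or> \<delta> = (\<alpha> + \<beta> * lam\<^sub>1) / 2 \<and> \<delta>\<^sup>2 < lam\<^sub>1 \<and> \<beta> * \<delta> \<le> 1"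
      and "t \<ge> 0"
    for \<Omega> :: "'a set" and B u\<^sub>0 u\<^sub>1 u u' \<delta> t
  proof -
    interpret damped_wave \<Omega> B lam\<^sub>1 \<alpha> \<beta> u\<^sub>0 u\<^sub>1 u u'
      using setting sol assms by unfold_locales auto
    show "energy \<Omega> B u u' t \<le> C * exp (- 2 * \<delta> * t) * energy \<Omega> B u u' 0"
      using C[rule_format, OF conjI[OF damped_kernel_solution conjI[OF \<delta>(1) conjI[OF \<delta>(2,3)]]] \<open>t \<ge> 0\<close>]
      by (simp add: energy_eq)
  qed
  show ?thesis
  proof (intro conjI allI impI)
    show "\<exists>C>0. \<forall>(\<Omega> :: 'a set) B u\<^sub>0 u\<^sub>1 u u' \<delta>.
        dirichlet_setting \<Omega> B lam\<^sub>1 \<and> damped_wave_solution \<Omega> B \<alpha> \<beta> u\<^sub>0 u\<^sub>1 u u' \<and>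
        (0 < \<delta> \<and> \<delta> < min ((\<alpha> + \<beta> * lam\<^sub>1) / 2) (lam\<^sub>1 / (\<alpha> + \<beta> * lam\<^sub>1)) \<or>
         0 < \<delta> \<and> \<delta> = (\<alpha> + \<beta> * lam\<^sub>1) / 2 \<and> \<delta>\<^sup>2 < lam\<^sub>1 \<and> \<beta> * \<delta> \<le> 1) \<longrightarrow>
        (\<forall>t\<ge>0. energy \<Omega> B u u' t \<le> C * exp (- 2 * \<delta> * t) * energy \<Omega> B u u' 0)"
      using \<open>C > 0\<close> by (intro exI[of _ C] conjI allI impI, assumption)
        (elim conjE disjE; rule decay; simp)
  next
    fix \<Omega> :: "'a set" and B \<delta>
    assume *: "dirichlet_setting \<Omega> B lam\<^sub>1 \<and> \<delta> = lam\<^sub>1 / (\<alpha> + \<beta> * lam\<^sub>1) \<and> \<delta> \<le> (\<alpha> + \<beta> * lam\<^sub>1) / 2"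
    then have \<delta>: "0 < \<delta>" "\<delta> \<le> lam\<^sub>1 / (\<alpha> + \<beta> * lam\<^sub>1)" using \<mu> assms(2) by auto
    have "(L2_norm \<Omega> (u' t))\<^sup>2 \<le> (2 * C) * exp (- 2 * \<delta> * t) * energy \<Omega> B u u' 0"
      if "damped_wave_solution \<Omega> B \<alpha> \<beta> u\<^sub>0 u\<^sub>1 u u'" "t \<ge> 0" for u\<^sub>0 u\<^sub>1 u u' t
    proof -
      have "energy \<Omega> B u u' t \<le> C * exp (- 2 * \<delta> * t) * energy \<Omega> B u u' 0"
        by (rule decay) (use * \<delta> that in blast)+
      moreover have "(L2_norm \<Omega> (u' t))\<^sup>2 \<le> 2 * energy \<Omega> B u u' t"
        by (simp add: energy_def)
      ultimately show ?thesis by (simp add: mult.assoc)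
    qed
    then show "\<exists>C>0. \<forall>u\<^sub>0 u\<^sub>1 u u'. damped_wave_solution \<Omega> B \<alpha> \<beta> u\<^sub>0 u\<^sub>1 u u' \<longrightarrow>
        (\<forall>t\<ge>0. (L2_norm \<Omega> (u' t))\<^sup>2 \<le> C * exp (- 2 * \<delta> * t) * energy \<Omega> B u u' 0)"
      using \<open>C > 0\<close> by (intro exI[of _ "2 * C"]) auto
  qed
qed

end
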